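(* Let $g=\lambda_+^2g_{Kerr}$ be the complex Kähler metric conformal to Kerr, with Levi-Civita connection $\nabla$, scalar curvature $s$, self-dual 2-forms $\omega,\Omega^\pm$ and 1-form $a$ as in the context. Let $d_+=P_+d:\Lambda^1\to\Lambda^+$ and $d_+^*=\delta P_+:\Lambda^2\to\Lambda^1$, where $\delta$ is the codifferential of $g$, and let $\Delta_H=d\delta+\delta d$ be the Hodge Laplacian of $g$ on 2-forms. Then $\mathcal{O}:=2d_+d_+^*=\Delta_HP_+$, and for all smooth complex functions $\Phi,\Phi^+,\Phi^-$, $$\mathcal{O}\big(\Phi\,\omega+\Phi^-\Omega^++\Phi^+\Omega^-\big)=\big(-\nabla^\alpha\nabla_\alpha\Phi\big)\,\omega+\big(\mathcal{O}_{-1}\Phi^-\big)\,\Omega^++\big(\mathcal{O}_{+1}\Phi^+\big)\,\Omega^-,$$ where $\mathcal{O}_{k}\Psi=-(\nabla^\alpha+{\rm i}ka^\alpha)(\nabla_\alpha+{\rm i}ka_\alpha)\Psi+\frac{1+2k^2}{6}s\Psi$, so that $\mathcal{O}_{\pm1}\Psi=-(\nabla^\alpha\pm{\rm i}a^\alpha)(\nabla_\alpha\pm{\rm i}a_\alpha)\Psi+\frac{s}{2}\Psi$. In particular $\mathcal{O}$ preserves each of the line subbundles of $\Lambda^+$ spanned by $\omega$, $\Omega^+$, $\Omega^-$.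
   Context: Coordinates $(t,r,q,\phi)$ on the region where $C(r)=r^2-2Mr+a^2>0$ and $-1<q<1$; $D(q)=1-q^2$, $\rho^2=r^2+a^2q^2$, $M,a$ real. Coframe: $e^0=\frac{\sqrt C}{\rho}(dt-a(1-q^2)d\phi)$, $e^1=\frac{\rho}{\sqrt C}dr$, $e^2=\frac{\rho}{\sqrt D}dq$, $e^3=\frac{\sqrt D}{\rho}((r^2+a^2)d\phi-a\,dt)$; the Kerr metric is $g_{Kerr}=-e^0\otimes e^0+\sum_{i=1}^3e^i\otimes e^i$. Set $\Sigma^1={\rm i}e^0\wedge e^1-e^2\wedge e^3$, $\Sigma^2={\rm i}e^0\wedge e^2-e^3\wedge e^1$, $\Sigma^3={\rm i}e^0\wedge e^3-e^1\wedge e^2$. Let $\lambda_\pm=1/(r\pm{\rm i}aq)$, $g=\lambda_+^2g_{Kerr}$ (complex-valued), $\Omega^i=\lambda_+^2\Sigma^i$, $\omega=\Omega^1$, $\Omega^\pm=(\Omega^2\pm{\rm i}\Omega^3)/\sqrt2$. $\Lambda^+$ is the complex span of $\Omega^1,\Omega^2,\Omega^3$ (the self-dual 2-forms); $\star$ denotes the Hodge star on 2-forms (conformally invariant, the same for $g$ and $g_{Kerr}$) with orientation such that $\star\Sigma^i={\rm i}\Sigma^i$, and $P_+=\frac12(1-{\rm i}\star)$ is the projector onto $\Lambda^+$. The codifferential is $(\delta B)_\nu=-\nabla^\mu B_{\mu\nu}$ on 2-forms and $\delta\theta=-\nabla^\mu\theta_\mu$ on 1-forms, indices raised with $g$. The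 metric $g$ satisfies $\nabla\omega=0$, and $a$ is the (unique) complex 1-form with $(\nabla_\mu+{\rm i}a_\mu)\Omega^+_{\rho\sigma}=0$ and $(\nabla_\mu-{\rm i}a_\mu)\Omega^-_{\rho\sigma}=0$. In $\mathcal{O}_k$, $(\nabla_\alpha+{\rm i}ka_\alpha)\Psi=\partial_\alpha\Psi+{\rm i}ka_\alpha\Psi$ and $(\nabla^\alpha+{\rm i}ka^\alpha)v_\alpha=\nabla^\alpha v_\alpha+{\rm i}ka^\alpha v_\alpha$. *)

theory Defs
  imports "HOL-Analysis.Analysis"
begin

text \<open>Coordinate rendering on the chart (t,r,q,phi) = (x$0, x$1, x$2, x$3) of real^4.
  Tensors are represented by their coordinate components; a k-form is a function
  of the point and k indices of type 4. The rotation parameter a of the paper is am.\<close>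

type_synonym pt = "real^4"

definition pd :: "4 \<Rightarrow> (pt \<Rightarrow> complex) \<Rightarrow> pt \<Rightarrow> complex" where
  "pd i f x = vector_derivative (\<lambda>h. f (x + h *\<^sub>R axis i 1)) (at 0)"

fun iter_pd :: "4 list \<Rightarrow> (pt \<Rightarrow> complex) \<Rightarrow> pt \<Rightarrow> complex" where
  "iter_pd [] f = f"
| "iter_pd (i # js) f = pd i (iter_pd js f)"

definition smooth_fn :: "pt set \<Rightarrow> (pt \<Rightarrow> complex) \<Rightarrow> bool" where
  "smooth_fn U f \<longleftrightarrow> (\<forall>js. continuous_on U (iter_pd js f) \<and>
      (\<forall>x\<in>U. \<forall>i. (\<lambda>h. iter_pd js f (x + h *\<^sub>R axis i 1)) differentiable (at 0)))"

definition Cf :: "real \<Rightarrow> real \<Rightarrow> pt \<Rightarrow> real" where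
  "Cf M am x = (x$1)^2 - 2*M*(x$1) + am^2"

definition Df :: "pt \<Rightarrow> real" where
  "Df x = 1 - (x$2)^2"

definition rho :: "real \<Rightarrow> pt \<Rightarrow> real" where
  "rho am x = sqrt ((x$1)^2 + am^2 * (x$2)^2)"

text \<open>The region: C(r) > 0, -1 < q < 1, away from the ring singularity rho = 0.\<close>
definition kerr_dom :: "real \<Rightarrow> real \<Rightarrow> pt set" where
  "kerr_dom M am = {x. Cf M am x > 0 \<and> -1 < x$2 \<and> x$2 < 1 \<and> rho am x \<noteq> 0}"

text \<open>Coframe: ef M am k x mu is the mu-component of e^k at x.\<close>
definition ef :: "real \<Rightarrow> real \<Rightarrow> 4 \<Rightarrow> pt \<Rightarrow> 4 \<Rightarrow> real" where
  "ef M am k x mu =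
    (let C = Cf M am x; D = Df x; p = rho am x; r = x$1; q = x$2 in
     if k = 0 then (if mu = 0 then sqrt C / p else if mu = 3 then - am * (1 - q^2) * sqrt C / p else 0)
     else if k = 1 then (if mu = 1 then p / sqrt C else 0)
     else if k = 2 then (if mu = 2 then p / sqrt D else 0)
     else (if mu = 0 then - am * sqrt D / p else if mu = 3 then sqrt D * (r^2 + am^2) / p else 0))"

definition eta :: "4 \<Rightarrow> real" where
  "eta k = (if k = 0 then -1 else 1)"

definition gKerr :: "real \<Rightarrow> real \<Rightarrow> pt \<Rightarrow> 4 \<Rightarrow> 4 \<Rightarrow> real" where
  "gKerr M am x m n = (\<Sum>k\<in>UNIV. eta k * ef M am k x m * ef M am k x n)"

definition gKinv :: "real \<Rightarrow> real \<Rightarrow> pt \<Rightarrow> 4 \<Rightarrow> 4 \<Rightarrow> real" where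
  "gKinv M am x m n = matrix_inv (\<chi> i j. gKerr M am x i j) $ m $ n"

definition lamp :: "real \<Rightarrow> pt \<Rightarrow> complex" where
  "lamp am x = 1 / Complex (x$1) (am * x$2)"

definition gmet :: "real \<Rightarrow> real \<Rightarrow> pt \<Rightarrow> 4 \<Rightarrow> 4 \<Rightarrow> complex" where
  "gmet M am x m n = (lamp am x)^2 * complex_of_real (gKerr M am x m n)"

definition ginv :: "real \<Rightarrow> real \<Rightarrow> pt \<Rightarrow> 4 \<Rightarrow> 4 \<Rightarrow> complex" where
  "ginv M am x m n = matrix_inv (\<chi> i j. gmet M am x i j) $ m $ n"

definition Gam :: "real \<Rightarrow> real \<Rightarrow> pt \<Rightarrow> 4 \<Rightarrow> 4 \<Rightarrow> 4 \<Rightarrow> complex" where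
  "Gam M am x l m n = (1/2) * (\<Sum>s\<in>UNIV. ginv M am x l s *
      (pd m (\<lambda>y. gmet M am y s n) x + pd n (\<lambda>y. gmet M am y s m) x - pd s (\<lambda>y. gmet M am y m n) x))"

definition cov1 :: "real \<Rightarrow> real \<Rightarrow> (pt \<Rightarrow> 4 \<Rightarrow> complex) \<Rightarrow> pt \<Rightarrow> 4 \<Rightarrow> 4 \<Rightarrow> complex" where
  "cov1 M am th x m n = pd m (\<lambda>y. th y n) x - (\<Sum>l\<in>UNIV. Gam M am x l m n * th x l)"

definition cov2 :: "real \<Rightarrow> real \<Rightarrow> (pt \<Rightarrow> 4 \<Rightarrow> 4 \<Rightarrow> complex) \<Rightarrow> pt \<Rightarrow> 4 \<Rightarrow> 4 \<Rightarrow> 4 \<Rightarrow> complex" where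
  "cov2 M am B x m r s = pd m (\<lambda>y. B y r s) x
     - (\<Sum>l\<in>UNIV. Gam M am x l m r * B x l s + Gam M am x l m s * B x r l)"

definition cov3 :: "real \<Rightarrow> real \<Rightarrow> (pt \<Rightarrow> 4 \<Rightarrow> 4 \<Rightarrow> 4 \<Rightarrow> complex) \<Rightarrow> pt \<Rightarrow> 4 \<Rightarrow> 4 \<Rightarrow> 4 \<Rightarrow> 4 \<Rightarrow> complex" where
  "cov3 M am T x m a b c = pd m (\<lambda>y. T y a b c) x
     - (\<Sum>l\<in>UNIV. Gam M am x l m a * T x l b c + Gam M am x l m b * T x a l c + Gam M am x l m c * T x a b l)"

text \<open>Exterior derivative (forms as antisymmetric tensors, (a wedge b)_{mn} = a_m b_n - a_n b_m).\<close>
definition d0 :: "(pt \<Rightarrow> complex) \<Rightarrow> pt \<Rightarrow> 4 \<Rightarrow> complex" where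
  "d0 f x m = pd m f x"

definition d1 :: "(pt \<Rightarrow> 4 \<Rightarrow> complex) \<Rightarrow> pt \<Rightarrow> 4 \<Rightarrow> 4 \<Rightarrow> complex" where
  "d1 th x m n = pd m (\<lambda>y. th y n) x - pd n (\<lambda>y. th y m) x"

definition d2 :: "(pt \<Rightarrow> 4 \<Rightarrow> 4 \<Rightarrow> complex) \<Rightarrow> pt \<Rightarrow> 4 \<Rightarrow> 4 \<Rightarrow> 4 \<Rightarrow> complex" where
  "d2 B x a b c = pd a (\<lambda>y. B y b c) x + pd b (\<lambda>y. B y c a) x + pd c (\<lambda>y. B y a b) x"

definition del1 :: "real \<Rightarrow> real \<Rightarrow> (pt \<Rightarrow> 4 \<Rightarrow> complex) \<Rightarrow> pt \<Rightarrow> complex" where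
  "del1 M am th x = - (\<Sum>m\<in>UNIV. \<Sum>a\<in>UNIV. ginv M am x m a * cov1 M am th x a m)"

definition del2 :: "real \<Rightarrow> real \<Rightarrow> (pt \<Rightarrow> 4 \<Rightarrow> 4 \<Rightarrow> complex) \<Rightarrow> pt \<Rightarrow> 4 \<Rightarrow> complex" where
  "del2 M am B x n = - (\<Sum>m\<in>UNIV. \<Sum>a\<in>UNIV. ginv M am x m a * cov2 M am B x a m n)"

definition del3 :: "real \<Rightarrow> real \<Rightarrow> (pt \<Rightarrow> 4 \<Rightarrow> 4 \<Rightarrow> 4 \<Rightarrow> complex) \<Rightarrow> pt \<Rightarrow> 4 \<Rightarrow> 4 \<Rightarrow> complex" where
  "del3 M am T x n r = - (\<Sum>m\<in>UNIV. \<Sum>a\<in>UNIV. ginv M am x m a * cov3 M am T x a m n r)"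

text \<open>Volume form e^0 wedge e^1 wedge e^2 wedge e^3 of g_Kerr (fixes the orientation).\<close>
definition vol :: "real \<Rightarrow> real \<Rightarrow> pt \<Rightarrow> 4 \<Rightarrow> 4 \<Rightarrow> 4 \<Rightarrow> 4 \<Rightarrow> real" where
  "vol M am x m n p s = det (\<chi> k j. ef M am k x
      (if j = 0 then m else if j = 1 then n else if j = 2 then p else s))"

text \<open>Hodge star on 2-forms (conformally invariant; computed with g_Kerr).\<close>
definition hstar :: "real \<Rightarrow> real \<Rightarrow> (pt \<Rightarrow> 4 \<Rightarrow> 4 \<Rightarrow> complex) \<Rightarrow> pt \<Rightarrow> 4 \<Rightarrow> 4 \<Rightarrow> complex" where
  "hstar M am B x m n = (1/2) * (\<Sum>a\<in>UNIV. \<Sum>b\<in>UNIV. \<Sum>c\<in>UNIV. \<Sum>d\<in>UNIV.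
      complex_of_real (vol M am x m n a b * gKinv M am x a c * gKinv M am x b d) * B x c d)"

definition Pplus :: "real \<Rightarrow> real \<Rightarrow> (pt \<Rightarrow> 4 \<Rightarrow> 4 \<Rightarrow> complex) \<Rightarrow> pt \<Rightarrow> 4 \<Rightarrow> 4 \<Rightarrow> complex" where
  "Pplus M am B x m n = (1/2) * (B x m n - \<i> * hstar M am B x m n)"

definition dplus :: "real \<Rightarrow> real \<Rightarrow> (pt \<Rightarrow> 4 \<Rightarrow> complex) \<Rightarrow> pt \<Rightarrow> 4 \<Rightarrow> 4 \<Rightarrow> complex" where
  "dplus M am th = Pplus M am (d1 th)"

definition dplus_star :: "real \<Rightarrow> real \<Rightarrow> (pt \<Rightarrow> 4 \<Rightarrow> 4 \<Rightarrow> complex) \<Rightarrow> pt \<Rightarrow> 4 \<Rightarrow> complex" where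
  "dplus_star M am B = del2 M am (Pplus M am B)"

definition Oop :: "real \<Rightarrow> real \<Rightarrow> (pt \<Rightarrow> 4 \<Rightarrow> 4 \<Rightarrow> complex) \<Rightarrow> pt \<Rightarrow> 4 \<Rightarrow> 4 \<Rightarrow> complex" where
  "Oop M am B x m n = 2 * dplus M am (dplus_star M am B) x m n"

definition lapH :: "real \<Rightarrow> real \<Rightarrow> (pt \<Rightarrow> 4 \<Rightarrow> 4 \<Rightarrow> complex) \<Rightarrow> pt \<Rightarrow> 4 \<Rightarrow> 4 \<Rightarrow> complex" where
  "lapH M am B x m n = d1 (del2 M am B) x m n + del3 M am (d2 B) x m n"

definition wedge :: "(pt \<Rightarrow> 4 \<Rightarrow> complex) \<Rightarrow> (pt \<Rightarrow> 4 \<Rightarrow> complex) \<Rightarrow> pt \<Rightarrow> 4 \<Rightarrow> 4 \<Rightarrow> complex" where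
  "wedge al be x m n = al x m * be x n - al x n * be x m"

definition ec :: "real \<Rightarrow> real \<Rightarrow> 4 \<Rightarrow> pt \<Rightarrow> 4 \<Rightarrow> complex" where
  "ec M am k x m = complex_of_real (ef M am k x m)"

definition Sig :: "real \<Rightarrow> real \<Rightarrow> nat \<Rightarrow> pt \<Rightarrow> 4 \<Rightarrow> 4 \<Rightarrow> complex" where
  "Sig M am i x m n =
    (if i = 1 then \<i> * wedge (ec M am 0) (ec M am 1) x m n - wedge (ec M am 2) (ec M am 3) x m n
     else if i = 2 then \<i> * wedge (ec M am 0) (ec M am 2) x m n - wedge (ec M am 3) (ec M am 1) x m n
     else \<i> * wedge (ec M am 0) (ec M am 3) x m n - wedge (ec M am 1) (ec M am 2) x m n)"

definition Om :: "real \<Rightarrow> real \<Rightarrow> nat \<Rightarrow> pt \<Rightarrow> 4 \<Rightarrow> 4 \<Rightarrow> complex" where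
  "Om M am i x m n = (lamp am x)^2 * Sig M am i x m n"

definition omega :: "real \<Rightarrow> real \<Rightarrow> pt \<Rightarrow> 4 \<Rightarrow> 4 \<Rightarrow> complex" where
  "omega M am = Om M am 1"

definition Omp :: "real \<Rightarrow> real \<Rightarrow> pt \<Rightarrow> 4 \<Rightarrow> 4 \<Rightarrow> complex" where
  "Omp M am x m n = (Om M am 2 x m n + \<i> * Om M am 3 x m n) / complex_of_real (sqrt 2)"

definition Omm :: "real \<Rightarrow> real \<Rightarrow> pt \<Rightarrow> 4 \<Rightarrow> 4 \<Rightarrow> complex" where
  "Omm M am x m n = (Om M am 2 x m n - \<i> * Om M am 3 x m n) / complex_of_real (sqrt 2)"

definition aform :: "real \<Rightarrow> real \<Rightarrow> pt \<Rightarrow> 4 \<Rightarrow> complex" where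
  "aform M am x = (THE v :: 4 \<Rightarrow> complex. \<forall>m r s.
      cov2 M am (Omp M am) x m r s + \<i> * v m * Omp M am x r s = 0 \<and>
      cov2 M am (Omm M am) x m r s - \<i> * v m * Omm M am x r s = 0)"

definition Riem :: "real \<Rightarrow> real \<Rightarrow> pt \<Rightarrow> 4 \<Rightarrow> 4 \<Rightarrow> 4 \<Rightarrow> 4 \<Rightarrow> complex" where
  "Riem M am x r s m n = pd m (\<lambda>y. Gam M am y r n s) x - pd n (\<lambda>y. Gam M am y r m s) x
     + (\<Sum>l\<in>UNIV. Gam M am x r m l * Gam M am x l n s - Gam M am x r n l * Gam M am x l m s)"

definition Ric :: "real \<Rightarrow> real \<Rightarrow> pt \<Rightarrow> 4 \<Rightarrow> 4 \<Rightarrow> complex" where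
  "Ric M am x s n = (\<Sum>r\<in>UNIV. Riem M am x r s r n)"

definition scal :: "real \<Rightarrow> real \<Rightarrow> pt \<Rightarrow> complex" where
  "scal M am x = (\<Sum>s\<in>UNIV. \<Sum>n\<in>UNIV. ginv M am x s n * Ric M am x s n)"

definition boxneg :: "real \<Rightarrow> real \<Rightarrow> (pt \<Rightarrow> complex) \<Rightarrow> pt \<Rightarrow> complex" where
  "boxneg M am Phi x = - (\<Sum>al\<in>UNIV. \<Sum>be\<in>UNIV. ginv M am x al be * cov1 M am (d0 Phi) x be al)"

definition Ok :: "real \<Rightarrow> real \<Rightarrow> real \<Rightarrow> (pt \<Rightarrow> complex) \<Rightarrow> pt \<Rightarrow> complex" where
  "Ok M am k Psi x =
    (let v = (\<lambda>y al. pd al Psi y + \<i> * complex_of_real k * aform M am y al * Psi y) in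
     - (\<Sum>al\<in>UNIV. \<Sum>be\<in>UNIV. ginv M am x al be *
           (cov1 M am v x be al + \<i> * complex_of_real k * aform M am x be * v x al))
     + complex_of_real ((1 + 2 * k^2) / 6) * scal M am x * Psi x)"

end

theory Submission
  imports Defs
begin

text \<open>
  Replace the Lorentzian coframe by \<open>h\<^sup>0 = \<i>\<lambda>\<^sub>+e\<^sup>0\<close>, \<open>h\<^sup>k = \<lambda>\<^sub>+e\<^sup>k\<close>.  Then \<open>g = \<Sum>h\<^sup>a\<otimes>h\<^sup>a\<close>
  is formally Euclidean, \<open>\<Omega>\<^sup>i = h\<^sup>0\<and>h\<^sup>i - h\<^sup>j\<and>h\<^sup>k\<close> has constant coefficients, and \<open>P\<^sub>+\<close> is the
  Euclidean projection onto anti-self-dual forms.  The connection forms \<open>W\<close> of this coframe satisfy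
  \<open>W\<^sub>0\<^sub>2 = W\<^sub>3\<^sub>1\<close> and \<open>W\<^sub>0\<^sub>3 = W\<^sub>1\<^sub>2\<close>, which is \<open>\<nabla>\<omega> = 0\<close>; the remaining combination
  \<open>W\<^sub>0\<^sub>1 - W\<^sub>2\<^sub>3\<close> is the one-form \<open>a\<close>.

  For \<open>A = \<Sum>\<Psi>\<^sub>k w\<^sub>k\<close> with \<open>w\<^sub>k\<close> of charge \<open>k\<close> one has \<open>\<nabla>A = \<Sum>\<theta>\<^sub>k w\<^sub>k\<close> with
  \<open>\<theta>\<^sub>k = (d + \<i>ka)\<Psi>\<^sub>k\<close>, so \<open>\<delta>A\<close> is a contraction of \<open>\<theta>\<close> with \<open>w\<close>, and \<open>d\<delta>A\<close> a contraction of
  \<open>Q = (\<nabla> + \<i>ka)\<theta>\<close> with \<open>w\<close>.  By the quaternion relations of the \<open>w\<^sub>k\<close> its projection only sees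
  the trace of \<open>Q\<close>, which is the charged wave operator, and the antisymmetric part of \<open>Q\<close>, which is
  \<open>\<i>k\<Psi>\<cdot>da\<close>.  The first Bianchi identity forces \<open>da\<close> to be of type (1,1) with
  \<open>s = 2((da)\<^sub>0\<^sub>1 - (da)\<^sub>2\<^sub>3)\<close>, and this is the potential term.  Finally \<open>dA\<close> is the dual of \<open>\<delta>A\<close>, so
  \<open>\<delta>dA\<close> is minus the dual of \<open>d\<delta>A\<close>, whence \<open>2P\<^sub>+d\<delta>A = \<Delta>\<^sub>H A\<close>.
\<close>

text \<open>The explicit Kerr functions enter only through first derivatives of the coframe:
  Cartan's first structure equation is checked in \<open>torsion_Wc\<close>, where it becomes a list
  of polynomial identities, and no curvature component is ever evaluated. Curvature is controlled by
  its symmetries alone. Two objects are given by definitions remote from the frame: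
  \<open>Gam\<close>, built from derivatives of \<open>gmet\<close> and a matrix inverse, and
  \<open>aform\<close>, a definite description. Antisymmetry and vanishing torsion of
  \<open>W\<close> pin down the first, a nonzero component of \<Omega>^+ the second. Since
  \<open>pd\<close> differentiates along coordinate lines only, even the symmetry of second
  derivatives is derived from the mean value theorem. The factor i in h^0 has a price and a gain:
  everything is complex, but upper and lower frame indices need no distinction.\<close>

section \<open>Partial derivatives\<close>

lemma sum4: "sum f (UNIV :: 4 set) = f 0 + f 1 + f 2 + f 3"
proof -
  \<comment> \<open>The numerals 4 and 0 coincide in the type \<open>4\<close>; \<open>sum_4\<close>
    enumerates the indices as 1, 2, 3, 4, whereas the coordinates are numbered 0, 1, 2, 3.\<close>
  have "f 4 = f 0" by (rule arg_cong[of _ _ f]) simp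
  then show ?thesis by (simp add: sum_4 ac_simps)
qed

lemma all4: "(\<forall>i::4. P i) \<longleftrightarrow> P 0 \<and> P 1 \<and> P 2 \<and> P 3"
proof -
  have "P 4 = P 0" by (rule arg_cong[of _ _ P]) simp
  then show ?thesis by (auto simp: forall_4)
qed

definition has_pd :: "(pt \<Rightarrow> complex) \<Rightarrow> complex \<Rightarrow> 4 \<Rightarrow> pt \<Rightarrow> bool" where
  "has_pd f D i x \<longleftrightarrow> ((\<lambda>h. f (x + h *\<^sub>R axis i 1)) has_vector_derivative D) (at 0)"

definition pdiff :: "(pt \<Rightarrow> complex) \<Rightarrow> 4 \<Rightarrow> pt \<Rightarrow> bool" where
  "pdiff f i x \<longleftrightarrow> (\<lambda>h. f (x + h *\<^sub>R axis i 1)) differentiable (at 0)"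

lemma pdiff_has_pd: "pdiff f i x \<Longrightarrow> has_pd f (pd i f x) i x"
  by (simp add: pdiff_def has_pd_def pd_def vector_derivative_works)

lemma has_pd_pdiff: "has_pd f D i x \<Longrightarrow> pdiff f i x"
  unfolding pdiff_def has_pd_def by (metis differentiableI_vector)

lemma has_pd_pd: "has_pd f D i x \<Longrightarrow> pd i f x = D"
  by (simp add: has_pd_def pd_def vector_derivative_at)

lemma has_pd_const: "has_pd (\<lambda>y. c) 0 i x"
  by (simp add: has_pd_def)

lemma has_pd_add: "has_pd f D i x \<Longrightarrow> has_pd g D' i x \<Longrightarrow> has_pd (\<lambda>y. f y + g y) (D + D') i x"
  unfolding has_pd_def by (rule has_vector_derivative_add)

lemma has_pd_mult:
  "has_pd f D i x \<Longrightarrow> has_pd g D' i x \<Longrightarrow> has_pd (\<lambda>y. f y * g y) (f x * D' + D * g x) i x"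
  unfolding has_pd_def using has_vector_derivative_mult by fastforce

lemma has_pd_coord: "has_pd (\<lambda>y. complex_of_real (y $ j)) (if i = j then 1 else 0) i x"
proof -
  have "((\<lambda>h. complex_of_real (x $ j) + complex_of_real h * (if i = j then 1 else 0))
      has_vector_derivative (if i = j then 1 else 0)) (at 0)"
    by (auto intro!: derivative_eq_intros)
  moreover have "(\<lambda>h. complex_of_real ((x + h *\<^sub>R axis i 1) $ j))
      = (\<lambda>h. complex_of_real (x $ j) + complex_of_real h * (if i = j then 1 else 0))"
    by (auto simp: axis_def)
  ultimately show ?thesis unfolding has_pd_def by simp
qed

lemma eventually_line:
  fixes x :: pt
  assumes "open U" "x \<in> U"
  shows "\<forall>\<^sub>F h in nhds 0. x + h *\<^sub>R axis i 1 \<in> U"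
proof -
  have "((\<lambda>h. x + h *\<^sub>R axis i 1) \<longlongrightarrow> x + 0 *\<^sub>R axis i 1) (nhds (0::real))"
    by (intro tendsto_intros filterlim_ident)
  then show ?thesis using assms by (intro topological_tendstoD) auto
qed

lemma has_pd_transform:
  assumes "open U" "x \<in> U" "\<And>y. y \<in> U \<Longrightarrow> f y = g y" "has_pd f D i x"
  shows "has_pd g D i x"
proof -
  have ev: "\<forall>\<^sub>F h in nhds 0. f (x + h *\<^sub>R axis i 1) = g (x + h *\<^sub>R axis i 1)"
    using eventually_line[OF assms(1,2), of i] by eventually_elim (use assms(3) in auto)
  then obtain S where S: "open S" "0 \<in> S" "\<And>h. h \<in> S \<Longrightarrow> f (x + h *\<^sub>R axis i 1) = g (x + h *\<^sub>R axis i 1)"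
    unfolding eventually_nhds by blast
  show ?thesis using assms(4) unfolding has_pd_def
    by (rule has_vector_derivative_transform_within_open[OF _ S(1,2)]) (use S(3) in auto)
qed

text \<open>This covers points where the derivative fails to exist: \<open>vector_derivative\<close>
  is a choice over a predicate that both functions satisfy for the same values.\<close>

lemma pd_cong:
  assumes "open U" "x \<in> U" "\<And>y. y \<in> U \<Longrightarrow> f y = g y"
  shows "pd i f x = pd i g x"
proof -
  have "has_pd f D i x \<longleftrightarrow> has_pd g D i x" for D
    proof
    show "has_pd f D i x \<Longrightarrow> has_pd g D i x"
      by (rule has_pd_transform[OF assms(1,2)]) (rule assms(3))
    show "has_pd g D i x \<Longrightarrow> has_pd f D i x"
      by (rule has_pd_transform[OF assms(1,2)]) (rule assms(3)[symmetric])
  qed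
  then show ?thesis unfolding pd_def vector_derivative_def has_pd_def by simp
qed

lemma pdiff_cong:
  assumes "open U" "x \<in> U" "\<And>y. y \<in> U \<Longrightarrow> f y = g y" "pdiff f i x"
  shows "pdiff g i x"
  by (rule has_pd_pdiff, rule has_pd_transform[OF assms(1,2,3) pdiff_has_pd[OF assms(4)]]) simp_all

lemma pdiff_const: "pdiff (\<lambda>y. c) i x"
  using has_pd_const has_pd_pdiff by blast

lemma pdiff_add: "pdiff f i x \<Longrightarrow> pdiff g i x \<Longrightarrow> pdiff (\<lambda>y. f y + g y) i x"
  using has_pd_add has_pd_pdiff pdiff_has_pd by blast

lemma pdiff_mult: "pdiff f i x \<Longrightarrow> pdiff g i x \<Longrightarrow> pdiff (\<lambda>y. f y * g y) i x"
  using has_pd_mult has_pd_pdiff pdiff_has_pd by blast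

lemma pd_const: "pd i (\<lambda>y. c) x = 0"
  using has_pd_const has_pd_pd by blast

lemma pd_add: "pdiff f i x \<Longrightarrow> pdiff g i x \<Longrightarrow> pd i (\<lambda>y. f y + g y) x = pd i f x + pd i g x"
  by (intro has_pd_pd has_pd_add pdiff_has_pd)

lemma pd_mult:
  "pdiff f i x \<Longrightarrow> pdiff g i x \<Longrightarrow> pd i (\<lambda>y. f y * g y) x = f x * pd i g x + pd i f x * g x"
  by (intro has_pd_pd has_pd_mult pdiff_has_pd)

lemma pdiff_cmult: "pdiff f i x \<Longrightarrow> pdiff (\<lambda>y. c * f y) i x"
  by (intro pdiff_mult pdiff_const)

lemma pd_cmult: "pdiff f i x \<Longrightarrow> pd i (\<lambda>y. c * f y) x = c * pd i f x"
  using pd_mult[OF pdiff_const, of f i x c] by (simp add: pd_const)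

lemma pdiff_minus: "pdiff f i x \<Longrightarrow> pdiff (\<lambda>y. - f y) i x"
  using pdiff_cmult[of f i x "-1"] by simp

lemma pd_minus: "pdiff f i x \<Longrightarrow> pd i (\<lambda>y. - f y) x = - pd i f x"
  using pd_cmult[of f i x "-1"] by simp

lemma pd_diff: "pdiff f i x \<Longrightarrow> pdiff g i x \<Longrightarrow> pd i (\<lambda>y. f y - g y) x = pd i f x - pd i g x"
  using pd_add[of f i x "\<lambda>y. - g y"] by (simp add: pdiff_minus pd_minus)

lemma pdiff_sum:
  "finite I \<Longrightarrow> (\<And>k. k \<in> I \<Longrightarrow> pdiff (f k) i x) \<Longrightarrow> pdiff (\<lambda>y. \<Sum>k\<in>I. f k y) i x"
  by (induction I rule: finite_induct) (auto intro: pdiff_const pdiff_add)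

lemma pd_sum:
  "finite I \<Longrightarrow> (\<And>k. k \<in> I \<Longrightarrow> pdiff (f k) i x) \<Longrightarrow>
    pd i (\<lambda>y. \<Sum>k\<in>I. f k y) x = (\<Sum>k\<in>I. pd i (f k) x)"
  by (induction I rule: finite_induct) (auto simp: pd_const pd_add pdiff_sum)

text \<open>Continuity is demanded at every level because partial derivatives along lines do not
  imply it. The recursion removes the innermost derivative, which is what the product and quotient
  rules act on.\<close>

fun Ck :: "nat \<Rightarrow> pt set \<Rightarrow> (pt \<Rightarrow> complex) \<Rightarrow> bool" where
  "Ck 0 U f \<longleftrightarrow> continuous_on U f"
| "Ck (Suc k) U f \<longleftrightarrow> continuous_on U f \<and> (\<forall>x\<in>U. \<forall>i. pdiff f i x) \<and> (\<forall>i. Ck k U (pd i f))"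

lemma smooth_fn_pd:
  assumes "smooth_fn U f"
  shows "smooth_fn U (pd i f)"
proof -
  have *: "iter_pd js (pd i f) = iter_pd (js @ [i]) f" for js
    by (induction js) auto
  show ?thesis using assms unfolding smooth_fn_def * by blast
qed

lemma smooth_fn_Ck: "smooth_fn U f \<Longrightarrow> Ck k U f"
proof (induction k arbitrary: f)
  case 0
  then have "continuous_on U (iter_pd [] f)" unfolding smooth_fn_def by blast
  then show ?case by simp
next
  case (Suc k)
  have "continuous_on U (iter_pd [] f)"
    "\<forall>x\<in>U. \<forall>i. (\<lambda>h. iter_pd [] f (x + h *\<^sub>R axis i 1)) differentiable (at 0)"
    using Suc.prems unfolding smooth_fn_def by blast+
  with Suc.IH[OF smooth_fn_pd[OF Suc.prems]] show ?case
    by (simp add: pdiff_def)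
qed

lemma Ck_continuous: "Ck k U f \<Longrightarrow> continuous_on U f"
  by (cases k) auto

lemma Ck_pdiff: "Ck k U f \<Longrightarrow> k > 0 \<Longrightarrow> x \<in> U \<Longrightarrow> pdiff f i x"
  by (cases k) auto

lemma Ck_pd: "Ck (Suc k) U f \<Longrightarrow> Ck k U (pd i f)"
  by simp

lemma Ck_Suc: "Ck (Suc k) U f \<Longrightarrow> Ck k U f"
proof (induction k arbitrary: f)
  case (Suc k)
  from Suc.prems have "Ck k U (pd i f)" for i
    using Suc.IH[of "pd i f"] by simp
  with Suc.prems show ?case by simp
qed simp

text \<open>The differentiation rules identify \<open>pd i\<close> of a compound function only at
  points of \<open>U\<close>, so every induction on \<open>k\<close> has to replace it by a formula
  that agrees with it there.\<close>

lemma Ck_cong: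
  assumes "open U" "\<And>x. x \<in> U \<Longrightarrow> f x = g x" "Ck k U f"
  shows "Ck k U g"
  using assms(2,3)
proof (induction k arbitrary: f g)
  case 0
  then show ?case using continuous_on_cong by force
next
  case (Suc k)
  have "continuous_on U g" using Suc.prems continuous_on_cong[of U U f g] by simp
  moreover have "pdiff g i x" if "x \<in> U" for x i
    using pdiff_cong[OF assms(1) that Suc.prems(1)] Suc.prems(2) that by simp
  moreover have "Ck k U (pd i g)" for i
  proof (rule Suc.IH)
    show "pd i f x = pd i g x" if "x \<in> U" for x
      using assms(1) that Suc.prems(1) by (rule pd_cong)
    show "Ck k U (pd i f)" using Suc.prems(2) by simp
  qed
  ultimately show ?case by simp
qed

lemma Ck_const: "Ck k U (\<lambda>x. c)"
proof (induction k arbitrary: c)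
  case (Suc k)
  have "pd i (\<lambda>x. c) = (\<lambda>x. 0)" for i by (auto simp: pd_const)
  with Suc show ?case by (auto simp: pdiff_const)
qed auto

lemma Ck_coord: "Ck k U (\<lambda>x. complex_of_real (x $ j))"
proof (cases k)
  case 0
  then show ?thesis by (auto intro!: continuous_intros)
next
  case (Suc n)
  have "pd i (\<lambda>x. complex_of_real (x $ j)) = (\<lambda>x. if i = j then 1 else 0)" for i
    using has_pd_pd[OF has_pd_coord] by blast
  with Suc show ?thesis
    by (auto intro!: continuous_intros has_pd_pdiff[OF has_pd_coord] Ck_const)
qed

lemma Ck_add: "open U \<Longrightarrow> Ck k U f \<Longrightarrow> Ck k U g \<Longrightarrow> Ck k U (\<lambda>x. f x + g x)"
proof (induction k arbitrary: f g)
  case (Suc k)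
  have "Ck k U (pd i (\<lambda>x. f x + g x))" for i
    by (rule Ck_cong[OF Suc.prems(1) _ Suc.IH[OF Suc.prems(1), of "pd i f" "pd i g"]])
      (use Suc.prems in \<open>auto simp: pd_add\<close>)
  with Suc.prems show ?case by (auto intro!: continuous_on_add pdiff_add)
qed (auto intro!: continuous_on_add)

lemma Ck_mult: "open U \<Longrightarrow> Ck k U f \<Longrightarrow> Ck k U g \<Longrightarrow> Ck k U (\<lambda>x. f x * g x)"
proof (induction k arbitrary: f g)
  case (Suc k)
  note le = Ck_Suc[OF Suc.prems(2)] Ck_Suc[OF Suc.prems(3)]
  have "Ck k U (pd i (\<lambda>x. f x * g x))" for i
    by (rule Ck_cong[OF Suc.prems(1) _ Ck_add[OF Suc.prems(1)
            Suc.IH[OF Suc.prems(1), of f "pd i g"] Suc.IH[OF Suc.prems(1), of "pd i f" g]]])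
      (use Suc.prems le in \<open>auto simp: pd_mult\<close>)
  with Suc.prems show ?case by (auto intro!: continuous_on_mult pdiff_mult)
qed (auto intro!: continuous_on_mult)

lemma Ck_uminus: "open U \<Longrightarrow> Ck k U f \<Longrightarrow> Ck k U (\<lambda>x. - f x)"
  using Ck_mult[of U k "\<lambda>x. -1" f] by (simp add: Ck_const)

lemma Ck_diff: "open U \<Longrightarrow> Ck k U f \<Longrightarrow> Ck k U g \<Longrightarrow> Ck k U (\<lambda>x. f x - g x)"
  using Ck_add[of U k f "\<lambda>x. - g x"] by (simp add: Ck_uminus)

lemma Ck_power: "open U \<Longrightarrow> Ck k U f \<Longrightarrow> Ck k U (\<lambda>x. f x ^ n)"
  by (induction n) (simp_all add: Ck_const Ck_mult)

lemma Ck_sum: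
  "open U \<Longrightarrow> finite I \<Longrightarrow> (\<And>j. j \<in> I \<Longrightarrow> Ck k U (f j)) \<Longrightarrow> Ck k U (\<lambda>x. \<Sum>j\<in>I. f j x)"
  by (rotate_tac 1, induction I rule: finite_induct) (simp_all add: Ck_const Ck_add)

lemma has_pd_inverse:
  assumes "has_pd f D i x" "f x \<noteq> 0"
  shows "has_pd (\<lambda>y. inverse (f y)) (- (inverse (f x) * D * inverse (f x))) i x"
proof -
  have "((\<lambda>h. f (x + h *\<^sub>R axis i 1)) has_derivative (\<lambda>h. h *\<^sub>R D)) (at 0)"
    using assms(1) by (simp add: has_pd_def has_vector_derivative_def)
  from Deriv.has_derivative_inverse[OF _ this] assms(2)
  have "((\<lambda>h. inverse (f (x + h *\<^sub>R axis i 1))) has_derivative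
      (\<lambda>h. - (inverse (f x) * (h *\<^sub>R D) * inverse (f x)))) (at 0)"
    by simp
  then show ?thesis by (simp add: has_pd_def has_vector_derivative_def scaleR_conv_of_real ac_simps)
qed

lemma Ck_inverse:
  "open U \<Longrightarrow> (\<And>x. x \<in> U \<Longrightarrow> f x \<noteq> 0) \<Longrightarrow> Ck k U f \<Longrightarrow> Ck k U (\<lambda>x. inverse (f x))"
proof (induction k)
  case 0
  then show ?case by (simp add: continuous_on_inverse)
next
  case (Suc k)
  have hp: "has_pd (\<lambda>y. inverse (f y)) (- (inverse (f x) * pd i f x * inverse (f x))) i x" if "x \<in> U" for x i
    using Suc.prems that by (auto intro!: has_pd_inverse pdiff_has_pd)
  have IH: "Ck k U (\<lambda>x. inverse (f x))"
    using Suc.IH Suc.prems Ck_Suc by blast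
  have "Ck k U (pd i (\<lambda>y. inverse (f y)))" for i
    by (rule Ck_cong[OF Suc.prems(1), of "\<lambda>x. - (inverse (f x) * pd i f x * inverse (f x))"])
      (use has_pd_pd[OF hp] Suc.prems IH in \<open>auto intro!: Ck_uminus Ck_mult\<close>)
  with Suc.prems has_pd_pdiff[OF hp] show ?case by (auto intro!: continuous_on_inverse)
qed

lemma Ck_divide:
  "open U \<Longrightarrow> (\<And>x. x \<in> U \<Longrightarrow> g x \<noteq> 0) \<Longrightarrow> Ck k U f \<Longrightarrow> Ck k U g \<Longrightarrow> Ck k U (\<lambda>x. f x / g x)"
  unfolding divide_inverse using Ck_mult[of U k f "\<lambda>x. inverse (g x)"] Ck_inverse[of U g k] by blast

lemma has_pd_sqrt:
  assumes "has_pd (\<lambda>y. complex_of_real (f y)) D i x" "f x > 0"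
  shows "has_pd (\<lambda>y. complex_of_real (sqrt (f y))) (D / (2 * complex_of_real (sqrt (f x)))) i x"
proof -
  have 1: "((\<lambda>h. f (x + h *\<^sub>R axis i 1)) has_vector_derivative (Re D)) (at 0)"
    using bounded_linear.has_vector_derivative[OF bounded_linear_Re assms(1)[unfolded has_pd_def]] by simp
  \<comment> \<open>\<open>D\<close> is a complex number; it is real because the imaginary part of a
    real-valued function is constantly zero. Only then does the real chain rule for the square root
    apply.\<close>
  have "((\<lambda>h. Im (complex_of_real (f (x + h *\<^sub>R axis i 1)))) has_vector_derivative (Im D)) (at 0)"
    using bounded_linear.has_vector_derivative[OF bounded_linear_Im assms(1)[unfolded has_pd_def]] .
  then have "Im D = 0"
    using vector_derivative_unique_at[of "\<lambda>h. 0" "Im D" 0 0] by simp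
  then have D: "D = complex_of_real (Re D)" by (simp add: complex_eq_iff)
  from 1 have "((\<lambda>h. f (x + h *\<^sub>R axis i 1)) has_real_derivative (Re D)) (at 0)"
    by (simp add: has_real_derivative_iff_has_vector_derivative)
  then have "((\<lambda>h. sqrt (f (x + h *\<^sub>R axis i 1))) has_real_derivative (inverse (sqrt (f x)) / 2 * Re D)) (at 0)"
    using DERIV_chain2[OF DERIV_real_sqrt, of "\<lambda>h. f (x + h *\<^sub>R axis i 1)" 0 "Re D" UNIV] assms(2) by simp
  then have "((\<lambda>h. complex_of_real (sqrt (f (x + h *\<^sub>R axis i 1)))) has_vector_derivative
      complex_of_real (inverse (sqrt (f x)) / 2 * Re D)) (at 0)"
    by (intro has_vector_derivative_of_real) (simp add: has_real_derivative_iff_has_vector_derivative)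
  moreover have "complex_of_real (inverse (sqrt (f x)) / 2 * Re D) = D / (2 * complex_of_real (sqrt (f x)))"
    by (subst (2) D) (simp add: field_simps)
  ultimately show ?thesis unfolding has_pd_def by (simp only:)
qed

lemma Ck_sqrt:
  "open U \<Longrightarrow> (\<And>x. x \<in> U \<Longrightarrow> f x > 0) \<Longrightarrow> Ck k U (\<lambda>x. complex_of_real (f x)) \<Longrightarrow>
    Ck k U (\<lambda>x. complex_of_real (sqrt (f x)))"
proof (induction k)
  case 0
  then have "continuous_on U (\<lambda>x. Re (complex_of_real (f x)))"
    by (intro continuous_on_Re) simp
  then show ?case by (simp add: continuous_on_of_real continuous_on_real_sqrt)
next
  case (Suc k)
  have hp: "has_pd (\<lambda>y. complex_of_real (sqrt (f y)))
      (pd i (\<lambda>x. complex_of_real (f x)) x / (2 * complex_of_real (sqrt (f x)))) i x" if "x \<in> U" for x i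
    using Suc.prems that by (auto intro!: has_pd_sqrt pdiff_has_pd)
  have IH: "Ck k U (\<lambda>x. complex_of_real (sqrt (f x)))"
    using Suc.IH Suc.prems Ck_Suc by blast
  have "Ck k U (\<lambda>x. pd i (\<lambda>x. complex_of_real (f x)) x / (2 * complex_of_real (sqrt (f x))))" for i
    by (rule Ck_divide[OF Suc.prems(1) _ _ Ck_mult[OF Suc.prems(1) Ck_const IH]])
      (use Suc.prems in \<open>auto dest!: Suc.prems(2)\<close>)
  from Ck_cong[OF Suc.prems(1) has_pd_pd[OF hp, symmetric] this]
  have "Ck k U (pd i (\<lambda>y. complex_of_real (sqrt (f y))))" for i .
  with has_pd_pdiff[OF hp] Ck_continuous[OF IH] show ?case by auto
qed

section \<open>Symmetry of second partial derivatives\<close>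

lemma mixed_difference:
  fixes F Fs Fst :: "real \<Rightarrow> real \<Rightarrow> real"
  assumes "h > 0"
    and "\<And>s t. 0 \<le> s \<Longrightarrow> s \<le> h \<Longrightarrow> 0 \<le> t \<Longrightarrow> t \<le> h \<Longrightarrow> ((\<lambda>s. F s t) has_real_derivative Fs s t) (at s)"
    and "\<And>s t. 0 \<le> s \<Longrightarrow> s \<le> h \<Longrightarrow> 0 \<le> t \<Longrightarrow> t \<le> h \<Longrightarrow> ((\<lambda>t. Fs s t) has_real_derivative Fst s t) (at t)"
  shows "\<exists>s t. 0 < s \<and> s < h \<and> 0 < t \<and> t < h \<and> F h h - F h 0 - F 0 h + F 0 0 = h * h * Fst s t"
proof -
  \<comment> \<open>The mean value theorem is applied first in \<open>s\<close> to the difference of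
    the two sections \<open>t = h\<close> and \<open>t = 0\<close>, then in \<open>t\<close> to the
    resulting first derivative.\<close>
  have "\<exists>s>0. s < h \<and> (F h h - F h 0) - (F 0 h - F 0 0) = (h - 0) * (Fs s h - Fs s 0)"
    using assms by (intro MVT2) (auto intro!: DERIV_diff)
  then obtain s where s: "0 < s" "s < h" "(F h h - F h 0) - (F 0 h - F 0 0) = h * (Fs s h - Fs s 0)"
    by auto
  have "\<exists>t>0. t < h \<and> Fs s h - Fs s 0 = (h - 0) * Fst s t"
    using assms s by (intro MVT2) auto
  then obtain t where "0 < t" "t < h" "Fs s h - Fs s 0 = h * Fst s t" by auto
  with s show ?thesis by (intro exI[of _ s] exI[of _ t]) (simp add: algebra_simps)
qed

lemma has_pd_along:
  assumes "has_pd f D i (x + s *\<^sub>R axis i 1)"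
  shows "((\<lambda>s. f (x + s *\<^sub>R axis i 1)) has_vector_derivative D) (at s)"
proof -
  have "((\<lambda>h. f (x + (s + h) *\<^sub>R axis i 1)) has_vector_derivative D) (at 0)"
    using assms by (simp add: has_pd_def algebra_simps)
  moreover have "((\<lambda>u::real. u - s) has_vector_derivative 1) (at s)"
    by (auto intro!: derivative_eq_intros)
  ultimately have "(((\<lambda>h. f (x + (s + h) *\<^sub>R axis i 1)) \<circ> (\<lambda>u. u - s)) has_vector_derivative (1 *\<^sub>R D)) (at s)"
    by (intro vector_diff_chain_at) auto
  then show ?thesis by (simp add: o_def)
qed

lemma pd_commute_component:
  fixes L :: "complex \<Rightarrow> real"
  assumes L: "bounded_linear L" and U: "open U" "x \<in> U" and f: "Ck 2 U f"
  shows "L (pd i (pd j f) x) = L (pd j (pd i f) x)"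
proof (rule ccontr)
  \<comment> \<open>Half the gap: if each mixed derivative stays within \<open>e\<close> of its
    value at \<open>x\<close>, the two cannot take a common value nearby.\<close>
  define e where "e = \<bar>L (pd i (pd j f) x) - L (pd j (pd i f) x)\<bar> / 2"
  assume "L (pd i (pd j f) x) \<noteq> L (pd j (pd i f) x)"
  then have e: "e > 0" by (simp add: e_def)
  have f1: "Ck (Suc (Suc 0)) U f" using f by (simp add: numeral_2_eq_2)
  have cont: "continuous_on U (\<lambda>y. L (pd i' (pd j' f) y))" for i' j'
    using f1 by (intro bounded_linear.continuous_on[OF L]) simp
  have near: "\<exists>d>0. ball x d \<subseteq> U \<and> (\<forall>y\<in>ball x d. \<bar>L (pd i' (pd j' f) y) - L (pd i' (pd j' f) x)\<bar> < e)" for i' j'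
  proof -
    obtain d1 where "d1 > 0" "\<And>y. y \<in> U \<Longrightarrow> dist y x < d1 \<Longrightarrow> dist (L (pd i' (pd j' f) y)) (L (pd i' (pd j' f) x)) < e"
      using cont[of i' j'] e U unfolding continuous_on_iff by meson
    moreover obtain d2 where "d2 > 0" "ball x d2 \<subseteq> U"
      using U openE by blast
    ultimately show ?thesis
      by (intro exI[of _ "min d1 d2"]) (auto simp: dist_real_def dist_commute subset_eq)
  qed
  obtain d1 where d1: "d1 > 0" "ball x d1 \<subseteq> U"
    "\<And>y. y \<in> ball x d1 \<Longrightarrow> \<bar>L (pd i (pd j f) y) - L (pd i (pd j f) x)\<bar> < e"
    using near by blast
  obtain d2 where d2: "d2 > 0" "\<And>y. y \<in> ball x d2 \<Longrightarrow> \<bar>L (pd j (pd i f) y) - L (pd j (pd i f) x)\<bar> < e"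
    using near by blast
  \<comment> \<open>Two steps of length at most \<open>h\<close> along the axes then stay strictly
    inside both balls.\<close>
  define h where "h = min d1 d2 / 3"
  have h: "h > 0" using d1 d2 by (simp add: h_def)
  define p where "p = (\<lambda>(k::4) (l::4) (s::real) (t::real). x + s *\<^sub>R axis k (1::real) + t *\<^sub>R axis l 1)"
  have near_x: "p k l s t \<in> ball x d1 \<and> p k l s t \<in> ball x d2"
    if "0 \<le> s" "s \<le> h" "0 \<le> t" "t \<le> h" for k l s t
  proof -
    have "dist x (p k l s t) = norm (s *\<^sub>R axis k (1::real) + t *\<^sub>R axis l 1 :: pt)"
      unfolding p_def dist_norm by (metis add.assoc add_diff_cancel_left' norm_minus_commute)
    also have "\<dots> \<le> \<bar>s\<bar> + \<bar>t\<bar>"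
      using norm_triangle_ineq[of "s *\<^sub>R axis k (1::real) :: pt" "t *\<^sub>R axis l 1"] by simp
    also have "\<dots> < min d1 d2" using that h by (simp add: h_def)
    finally show ?thesis by simp
  qed
  have key: "\<exists>s t. 0 < s \<and> s < h \<and> 0 < t \<and> t < h \<and>
      L (f (p k l h h)) - L (f (p k l h 0)) - L (f (p k l 0 h)) + L (f (p k l 0 0))
        = h * h * L (pd l (pd k f) (p k l s t))" for k l
  proof (rule mixed_difference[OF h, where Fs = "\<lambda>s t. L (pd k f (p k l s t))"])
    fix s t assume st: "0 \<le> s" "s \<le> h" "0 \<le> t" "t \<le> h"
    have pU: "p k l s t \<in> U" using near_x[OF st] d1 by blast
    have p': "p k l s t = (x + t *\<^sub>R axis l 1) + s *\<^sub>R axis k 1" for s t by (simp add: p_def algebra_simps)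
    have "has_pd f (pd k f (p k l s t)) k (p k l s t)"
      using f1 pU by (intro pdiff_has_pd) simp
    then show "((\<lambda>s. L (f (p k l s t))) has_real_derivative L (pd k f (p k l s t))) (at s)"
      unfolding has_real_derivative_iff_has_vector_derivative p'
      by (intro bounded_linear.has_vector_derivative[OF L] has_pd_along)
    have p'': "p k l s t = (x + s *\<^sub>R axis k 1) + t *\<^sub>R axis l 1" for s t by (simp add: p_def algebra_simps)
    have "has_pd (pd k f) (pd l (pd k f) (p k l s t)) l (p k l s t)"
      using f1 pU by (intro pdiff_has_pd) simp
    then show "((\<lambda>t. L (pd k f (p k l s t))) has_real_derivative L (pd l (pd k f) (p k l s t))) (at t)"
      unfolding has_real_derivative_iff_has_vector_derivative p''
      by (intro bounded_linear.has_vector_derivative[OF L] has_pd_along)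
  qed
  obtain s t where st: "0 < s" "s < h" "0 < t" "t < h"
    "L (f (p i j h h)) - L (f (p i j h 0)) - L (f (p i j 0 h)) + L (f (p i j 0 0))
        = h * h * L (pd j (pd i f) (p i j s t))" using key by blast
  obtain s' t' where st': "0 < s'" "s' < h" "0 < t'" "t' < h"
    "L (f (p j i h h)) - L (f (p j i h 0)) - L (f (p j i 0 h)) + L (f (p j i 0 0))
        = h * h * L (pd i (pd j f) (p j i s' t'))" using key by blast
  \<comment> \<open>The second difference over the square is symmetric in the two axes, so both
    mixed derivatives take the same value, at possibly different points of the square.\<close>
  have sw: "p j i u v = p i j v u" for u v by (simp add: p_def algebra_simps)
  have "h * h * L (pd j (pd i f) (p i j s t)) = h * h * L (pd i (pd j f) (p j i s' t'))"
    using st(5) st'(5) unfolding sw by linarith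
  then have "L (pd j (pd i f) (p i j s t)) = L (pd i (pd j f) (p j i s' t'))"
    using h by simp
  moreover have "\<bar>L (pd j (pd i f) (p i j s t)) - L (pd j (pd i f) x)\<bar> < e"
    using near_x[of s t i j] st d2 by auto
  moreover have "\<bar>L (pd i (pd j f) (p j i s' t')) - L (pd i (pd j f) x)\<bar> < e"
    using near_x[of s' t' j i] st' d1 by auto
  moreover have "\<bar>u - v\<bar> < \<bar>v - w\<bar> / 2 \<Longrightarrow> \<bar>u - w\<bar> < \<bar>v - w\<bar> / 2 \<Longrightarrow> False" for u v w :: real
    using abs_triangle_ineq4[of "u - w" "u - v"] by simp
  ultimately show False unfolding e_def by metis
qed

lemma pd_commute:
  assumes "open U" "x \<in> U" "Ck 2 U f"
  shows "pd i (pd j f) x = pd j (pd i f) x"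
  using pd_commute_component[OF bounded_linear_Re assms] pd_commute_component[OF bounded_linear_Im assms]
  by (simp add: complex_eq_iff)

section \<open>The Levi-Civita connection in a coframe\<close>

lemma sum_swap3:
  "(\<Sum>a\<in>A. \<Sum>b\<in>B. \<Sum>c\<in>C. F a b c) = (\<Sum>c\<in>C. \<Sum>a\<in>A. \<Sum>b\<in>B. F a b c)"
  for F :: "_ \<Rightarrow> _ \<Rightarrow> _ \<Rightarrow> 'a::comm_monoid_add"
proof -
  have "(\<Sum>a\<in>A. \<Sum>b\<in>B. \<Sum>c\<in>C. F a b c) = (\<Sum>a\<in>A. \<Sum>c\<in>C. \<Sum>b\<in>B. F a b c)"
    by (rule sum.cong[OF refl], rule sum.swap)
  also have "\<dots> = (\<Sum>c\<in>C. \<Sum>a\<in>A. \<Sum>b\<in>B. F a b c)" by (rule sum.swap)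
  finally show ?thesis .
qed

lemma sum_swap4:
  "(\<Sum>a\<in>A. \<Sum>b\<in>B. \<Sum>c\<in>C. \<Sum>d\<in>D. F a b c d) = (\<Sum>c\<in>C. \<Sum>d\<in>D. \<Sum>a\<in>A. \<Sum>b\<in>B. F a b c d)"
  for F :: "_ \<Rightarrow> _ \<Rightarrow> _ \<Rightarrow> _ \<Rightarrow> 'a::comm_monoid_add"
proof -
  have "(\<Sum>a\<in>A. \<Sum>b\<in>B. \<Sum>c\<in>C. \<Sum>d\<in>D. F a b c d) = (\<Sum>c\<in>C. \<Sum>a\<in>A. \<Sum>b\<in>B. \<Sum>d\<in>D. F a b c d)"
    by (rule sum_swap3)
  also have "\<dots> = (\<Sum>c\<in>C. \<Sum>d\<in>D. \<Sum>a\<in>A. \<Sum>b\<in>B. F a b c d)"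
    by (rule sum.cong[OF refl], rule sum_swap3)
  finally show ?thesis .
qed

text \<open>\<open>matrix_inv\<close> is a choice among two-sided inverses, of which there is at
  most one.\<close>

lemma matrix_inv_eqI:
  fixes A B :: "'a::semiring_1^'n^'n"
  assumes "A ** B = mat 1" "B ** A = mat 1"
  shows "matrix_inv A = B"
proof -
  have "A ** matrix_inv A = mat 1 \<and> matrix_inv A ** A = mat 1"
    unfolding matrix_inv_def by (rule someI[of _ B]) (use assms in simp)
  then have "matrix_inv A = (B ** A) ** matrix_inv A" using assms by simp
  also have "\<dots> = B"
    using \<open>A ** matrix_inv A = mat 1 \<and> _\<close> by (simp add: matrix_mul_assoc[symmetric])
  finally show ?thesis .
qed

lemma sum_mult_delta [simp]:
  fixes X :: "4 \<Rightarrow> 'a::semiring_1"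
  shows "(\<Sum>a\<in>UNIV. X a * (if a = b then 1 else 0)) = X b"
    and "(\<Sum>a\<in>UNIV. X a * (if b = a then 1 else 0)) = X b"
  by (simp_all add: if_distrib cong: if_cong)

text \<open>Two frame expansions contracted over a coordinate index produce the frame pairing as
  inner sum, which duality then collapses to a Kronecker delta.\<close>

lemma sum_contract:
  fixes f k :: "4 \<Rightarrow> 'a::comm_semiring_1" and g' l' :: "4 \<Rightarrow> 4 \<Rightarrow> 'a"
  shows "(\<Sum>s\<in>UNIV. (\<Sum>a\<in>UNIV. f a * g' a s) * (\<Sum>b\<in>UNIV. k b * l' b s))
    = (\<Sum>a\<in>UNIV. \<Sum>b\<in>UNIV. f a * k b * (\<Sum>s\<in>UNIV. g' a s * l' b s))"
proof -
  have "(\<Sum>s\<in>UNIV. (\<Sum>a\<in>UNIV. f a * g' a s) * (\<Sum>b\<in>UNIV. k b * l' b s))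
     = (\<Sum>s\<in>UNIV. \<Sum>a\<in>UNIV. \<Sum>b\<in>UNIV. f a * g' a s * (k b * l' b s))"
    by (simp add: sum_product)
  also have "\<dots> = (\<Sum>a\<in>UNIV. \<Sum>s\<in>UNIV. \<Sum>b\<in>UNIV. f a * g' a s * (k b * l' b s))"
    by (rule sum.swap)
  also have "\<dots> = (\<Sum>a\<in>UNIV. \<Sum>b\<in>UNIV. \<Sum>s\<in>UNIV. f a * g' a s * (k b * l' b s))"
    by (rule sum.cong[OF refl], rule sum.swap)
  finally show ?thesis by (simp add: sum_distrib_left ac_simps)
qed

text \<open>\<open>h a m\<close> and \<open>E a m\<close> are the \<open>m\<close>-th coordinate components of the coframe and of its dual frame,
  \<open>W m a b\<close> those of the connection forms.\<close>
locale adapted_frame =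
  fixes M am :: real and h E :: "4 \<Rightarrow> 4 \<Rightarrow> pt \<Rightarrow> complex" and W :: "4 \<Rightarrow> 4 \<Rightarrow> 4 \<Rightarrow> pt \<Rightarrow> complex"
    and U :: "pt set"
  defines "U \<equiv> kerr_dom M am"
  assumes open_U: "open U"
    and hE: "x \<in> U \<Longrightarrow> (\<Sum>a\<in>UNIV. h a m x * E a n x) = (if m = n then 1 else 0)"
    and Eh: "x \<in> U \<Longrightarrow> (\<Sum>m\<in>UNIV. h a m x * E b m x) = (if a = b then 1 else 0)"
    and h_C2: "Ck 2 U (h a m)"
    and E_C2: "Ck 2 U (E a m)"
    and W_C1: "Ck 1 U (W m a b)"
    and W_antisym: "x \<in> U \<Longrightarrow> W m a b x = - W m b a x"
    and torsion: "x \<in> U \<Longrightarrow> pd m (h a n) x + (\<Sum>b\<in>UNIV. W m a b x * h b n x)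
        = pd n (h a m) x + (\<Sum>b\<in>UNIV. W n a b x * h b m x)"
    and metric: "x \<in> U \<Longrightarrow> gmet M am x m n = (\<Sum>a\<in>UNIV. h a m x * h a n x)"
    and W02: "x \<in> U \<Longrightarrow> W m 0 2 x = W m 3 1 x"
    and W03: "x \<in> U \<Longrightarrow> W m 0 3 x = W m 1 2 x"
begin

lemma pdiff_h: "x \<in> U \<Longrightarrow> pdiff (h a m) i x"
  using Ck_pdiff[OF h_C2] by simp

lemma pdiff_E: "x \<in> U \<Longrightarrow> pdiff (E a m) i x"
  using Ck_pdiff[OF E_C2] by simp

lemma pdiff_W: "x \<in> U \<Longrightarrow> pdiff (W k a b) i x"
  using Ck_pdiff[OF W_C1] by simp

lemma W_diag: "x \<in> U \<Longrightarrow> W m a a x = 0"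
  using W_antisym[of x m a a] by simp

lemma contract_h:
  assumes "x \<in> U"
  shows "(\<Sum>m\<in>UNIV. E b m x * (\<Sum>a\<in>UNIV. X a * h a m x)) = X b"
proof -
  have "(\<Sum>m\<in>UNIV. E b m x * (\<Sum>a\<in>UNIV. X a * h a m x))
      = (\<Sum>a\<in>UNIV. X a * (\<Sum>m\<in>UNIV. h a m x * E b m x))"
    unfolding sum_distrib_left by (subst sum.swap) (simp add: ac_simps)
  then show ?thesis by (simp add: Eh[OF assms])
qed

lemma contract_E:
  assumes "x \<in> U"
  shows "(\<Sum>m\<in>UNIV. h b m x * (\<Sum>a\<in>UNIV. X a * E a m x)) = X b"
proof -
  have "(\<Sum>m\<in>UNIV. h b m x * (\<Sum>a\<in>UNIV. X a * E a m x))
      = (\<Sum>a\<in>UNIV. X a * (\<Sum>m\<in>UNIV. h b m x * E a m x))"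
    unfolding sum_distrib_left by (subst sum.swap) (simp add: ac_simps)
  then show ?thesis by (simp add: Eh[OF assms])
qed

lemma expand_h:
  assumes "x \<in> U"
  shows "X m = (\<Sum>a\<in>UNIV. (\<Sum>n\<in>UNIV. E a n x * X n) * h a m x)"
proof -
  have "(\<Sum>a\<in>UNIV. (\<Sum>n\<in>UNIV. E a n x * X n) * h a m x)
      = (\<Sum>n\<in>UNIV. X n * (\<Sum>a\<in>UNIV. h a m x * E a n x))"
    unfolding sum_distrib_left sum_distrib_right by (subst sum.swap) (simp add: ac_simps)
  then show ?thesis by (simp add: hE[OF assms])
qed

lemma ginv_frame:
  assumes "x \<in> U"
  shows "ginv M am x m n = (\<Sum>a\<in>UNIV. E a m x * E a n x)"
proof -
  have gE: "(\<Sum>s\<in>UNIV. gmet M am x m s * (\<Sum>a\<in>UNIV. E a s x * E a n x)) = (if m = n then 1 else 0)" for m n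
  proof -
    have "(\<Sum>s\<in>UNIV. gmet M am x m s * (\<Sum>a\<in>UNIV. E a s x * E a n x))
        = (\<Sum>s\<in>UNIV. (\<Sum>a\<in>UNIV. h a m x * h a s x) * (\<Sum>a\<in>UNIV. E a n x * E a s x))"
      by (simp add: metric[OF assms] ac_simps)
    also have "\<dots> = (\<Sum>a\<in>UNIV. h a m x * E a n x)"
      unfolding sum_contract by (simp add: Eh[OF assms])
    finally show ?thesis by (simp add: hE[OF assms])
  qed
  have gmet_sym: "gmet M am x m n = gmet M am x n m" for m n
    by (simp add: metric[OF assms] ac_simps)
  let ?A = "\<chi> i j. gmet M am x i j" and ?B = "\<chi> i j. \<Sum>a\<in>UNIV. E a i x * E a j x"
  have AB: "?A ** ?B = mat 1"
    by (simp add: matrix_matrix_mult_def mat_def vec_eq_iff gE)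
  have "transpose ?A = ?A" "transpose ?B = ?B"
    using gmet_sym by (simp_all add: transpose_def vec_eq_iff ac_simps)
  then have "?B ** ?A = transpose (?A ** ?B)" by (simp add: matrix_transpose_mul)
  with AB have "?B ** ?A = mat 1" by (simp add: transpose_mat)
  from matrix_inv_eqI[OF AB this] show ?thesis by (simp add: ginv_def)
qed

text \<open>The inverse metric is the sum of \<open>E a\<close> tensor \<open>E a\<close>, so
  contraction with it is a trace over frame indices. Every divergence below reaches the frame this
  way.\<close>

lemma ginv_trace:
  assumes "x \<in> U"
  shows "(\<Sum>m\<in>UNIV. \<Sum>n\<in>UNIV. ginv M am x m n * (\<Sum>a\<in>UNIV. X n a * h a m x))
    = (\<Sum>a\<in>UNIV. \<Sum>n\<in>UNIV. E a n x * X n a)"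
proof -
  have "(\<Sum>m\<in>UNIV. \<Sum>n\<in>UNIV. ginv M am x m n * (\<Sum>a\<in>UNIV. X n a * h a m x))
     = (\<Sum>n\<in>UNIV. \<Sum>m\<in>UNIV. (\<Sum>b\<in>UNIV. E b n x * E b m x) * (\<Sum>a\<in>UNIV. X n a * h a m x))"
    by (subst sum.swap) (simp add: ginv_frame[OF assms] ac_simps)
  also have "\<dots> = (\<Sum>n\<in>UNIV. \<Sum>a\<in>UNIV. E a n x * X n a)"
    unfolding sum_contract using Eh[OF assms] by (simp add: mult.commute[of "E _ _ x" "h _ _ x"] eq_commute[of _ "_::4"])
  also have "\<dots> = (\<Sum>a\<in>UNIV. \<Sum>n\<in>UNIV. E a n x * X n a)" by (rule sum.swap)
  finally show ?thesis .
qed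

text \<open>The derivative of h^a corrected only in its frame index. Vanishing torsion is its
  symmetry in \<open>m n\<close>, and \<open>Gam_h\<close> identifies it with the Christoffel symbol
  whose upper index is converted to the frame.\<close>

definition K :: "4 \<Rightarrow> 4 \<Rightarrow> 4 \<Rightarrow> pt \<Rightarrow> complex" where
  "K a m n x = pd m (h a n) x + (\<Sum>b\<in>UNIV. W m a b x * h b n x)"

lemma K_sym: "x \<in> U \<Longrightarrow> K a m n x = K a n m x"
  unfolding K_def by (rule torsion)

text \<open>The connection terms hidden in \<open>K\<close> cancel in pairs by antisymmetry of
  \<open>W\<close>; this is metric compatibility.\<close>

lemma pd_gmet:
  assumes "x \<in> U"
  shows "pd m (\<lambda>y. gmet M am y s n) x = (\<Sum>a\<in>UNIV. h a s x * K a m n x + K a m s x * h a n x)"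
proof -
  have "pd m (\<lambda>y. gmet M am y s n) x = pd m (\<lambda>y. \<Sum>a\<in>UNIV. h a s y * h a n y) x"
    by (rule pd_cong[OF open_U assms]) (rule metric)
  also have "\<dots> = (\<Sum>a\<in>UNIV. h a s x * pd m (h a n) x + pd m (h a s) x * h a n x)"
    using assms by (subst pd_sum) (auto simp: pd_mult pdiff_h pdiff_mult)
  also have "\<dots> = (\<Sum>a\<in>UNIV. h a s x * K a m n x + K a m s x * h a n x)"
    using W_antisym[OF assms, of m 1 0] W_antisym[OF assms, of m 2 0] W_antisym[OF assms, of m 3 0]
      W_antisym[OF assms, of m 2 1] W_antisym[OF assms, of m 3 1] W_antisym[OF assms, of m 3 2]
    by (simp add: K_def sum4 W_diag[OF assms] algebra_simps)
  finally show ?thesis .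
qed

text \<open>In the Koszul combination of metric derivatives, symmetry of \<open>K\<close> cancels
  four of the six terms and doubles the rest.\<close>

lemma Gam_frame:
  assumes "x \<in> U"
  shows "Gam M am x l m n = (\<Sum>a\<in>UNIV. E a l x * K a m n x)"
proof -
  have br: "pd m (\<lambda>y. gmet M am y s n) x + pd n (\<lambda>y. gmet M am y s m) x - pd s (\<lambda>y. gmet M am y m n) x
      = 2 * (\<Sum>a\<in>UNIV. K a m n x * h a s x)" for s
    unfolding pd_gmet[OF assms] K_sym[OF assms, of _ n m] K_sym[OF assms, of _ s n] K_sym[OF assms, of _ s m]
    by (simp add: sum_distrib_left sum.distrib[symmetric] sum_subtractf[symmetric] algebra_simps)
  have "Gam M am x l m n = (\<Sum>s\<in>UNIV. (\<Sum>a\<in>UNIV. E a l x * E a s x) * (\<Sum>a\<in>UNIV. K a m n x * h a s x))"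
    unfolding Gam_def br by (simp add: ginv_frame[OF assms] sum_distrib_left)
  also have "\<dots> = (\<Sum>a\<in>UNIV. E a l x * K a m n x)"
    unfolding sum_contract using Eh[OF assms] by (simp add: mult.commute[of "E _ _ x" "h _ _ x"] eq_commute[of _ "_::4"])
  finally show ?thesis .
qed

lemma Gam_sym: "x \<in> U \<Longrightarrow> Gam M am x l m n = Gam M am x l n m"
  by (simp add: Gam_frame K_sym[of x _ m n])

lemma Gam_h:
  assumes "x \<in> U"
  shows "(\<Sum>l\<in>UNIV. Gam M am x l m n * h a l x) = K a m n x"
  using contract_E[OF assms, of a "\<lambda>b. K b m n x"] by (simp add: Gam_frame[OF assms] ac_simps)

lemma Gam_h_sum:
  assumes "x \<in> U"
  shows "(\<Sum>l\<in>UNIV. Gam M am x l m n * (\<Sum>a\<in>UNIV. X a * h a l x)) = (\<Sum>a\<in>UNIV. X a * K a m n x)"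
proof -
  have "(\<Sum>l\<in>UNIV. Gam M am x l m n * (\<Sum>a\<in>UNIV. X a * h a l x))
      = (\<Sum>a\<in>UNIV. X a * (\<Sum>l\<in>UNIV. Gam M am x l m n * h a l x))"
    unfolding sum_distrib_left by (subst sum.swap) (simp add: ac_simps)
  then show ?thesis by (simp add: Gam_h[OF assms])
qed

text \<open>This is \<nabla>h^a = - W_ab h^b contracted with \<open>X\<close>; antisymmetry of
  \<open>W\<close> moves the rotation from the coframe to the coefficients.\<close>

lemma rotate_W:
  assumes "x \<in> U"
  shows "(\<Sum>a\<in>UNIV. X a * pd m (h a n) x) - (\<Sum>a\<in>UNIV. X a * K a m n x)
    = (\<Sum>a\<in>UNIV. (\<Sum>b\<in>UNIV. W m a b x * X b) * h a n x)"
proof -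
  have "(\<Sum>a\<in>UNIV. X a * pd m (h a n) x) - (\<Sum>a\<in>UNIV. X a * K a m n x)
      = - (\<Sum>a\<in>UNIV. \<Sum>b\<in>UNIV. X a * W m a b x * h b n x)"
    by (simp add: K_def sum_subtractf[symmetric] sum_negf[symmetric] sum_distrib_left algebra_simps)
  also have "\<dots> = - (\<Sum>b\<in>UNIV. \<Sum>a\<in>UNIV. X a * W m a b x * h b n x)"
    by (subst sum.swap) simp
  also have "\<dots> = (\<Sum>b\<in>UNIV. \<Sum>a\<in>UNIV. X a * W m b a x * h b n x)"
  proof -
    have "X a * W m a b x * h b n x = - (X a * W m b a x * h b n x)" for a b
      using W_antisym[OF assms, of m a b] by simp
    then show ?thesis by (simp only: sum_negf minus_minus)
  qed
  finally show ?thesis by (simp add: sum_distrib_right sum_distrib_left ac_simps)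
qed

section \<open>Covariant derivatives in frame components\<close>

definition D1 :: "(4 \<Rightarrow> pt \<Rightarrow> complex) \<Rightarrow> 4 \<Rightarrow> 4 \<Rightarrow> pt \<Rightarrow> complex" where
  "D1 t m a x = pd m (t a) x + (\<Sum>b\<in>UNIV. W m a b x * t b x)"

text \<open>The direction \<open>m\<close> of differentiation stays a coordinate index. Each frame
  slot is rotated by the same \<open>W\<close>, because the frame metric is the identity.\<close>

definition D2 :: "(4 \<Rightarrow> 4 \<Rightarrow> pt \<Rightarrow> complex) \<Rightarrow> 4 \<Rightarrow> 4 \<Rightarrow> 4 \<Rightarrow> pt \<Rightarrow> complex" where
  "D2 t m a b x = pd m (t a b) x + (\<Sum>d\<in>UNIV. W m a d x * t d b x) + (\<Sum>d\<in>UNIV. W m b d x * t a d x)"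

definition D3 :: "(4 \<Rightarrow> 4 \<Rightarrow> 4 \<Rightarrow> pt \<Rightarrow> complex) \<Rightarrow> 4 \<Rightarrow> 4 \<Rightarrow> 4 \<Rightarrow> 4 \<Rightarrow> pt \<Rightarrow> complex" where
  "D3 t m a b c x = pd m (t a b c) x + (\<Sum>d\<in>UNIV. W m a d x * t d b c x)
     + (\<Sum>d\<in>UNIV. W m b d x * t a d c x) + (\<Sum>d\<in>UNIV. W m c d x * t a b d x)"

lemma cov1_frame:
  assumes x: "x \<in> U" and th: "\<And>y n. y \<in> U \<Longrightarrow> th y n = (\<Sum>a\<in>UNIV. t a y * h a n y)"
    and t: "\<And>a. pdiff (t a) m x"
  shows "cov1 M am th x m n = (\<Sum>a\<in>UNIV. D1 t m a x * h a n x)"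
proof -
  have "pd m (\<lambda>y. th y n) x = pd m (\<lambda>y. \<Sum>a\<in>UNIV. t a y * h a n y) x"
    by (rule pd_cong[OF open_U x]) (rule th)
  also have "\<dots> = (\<Sum>a\<in>UNIV. t a x * pd m (h a n) x) + (\<Sum>a\<in>UNIV. pd m (t a) x * h a n x)"
    using x t by (subst pd_sum) (auto simp: pd_mult pdiff_h pdiff_mult sum.distrib)
  finally have "cov1 M am th x m n = (\<Sum>a\<in>UNIV. pd m (t a) x * h a n x) +
      ((\<Sum>a\<in>UNIV. t a x * pd m (h a n) x) - (\<Sum>a\<in>UNIV. t a x * K a m n x))"
    by (simp add: cov1_def th[OF x] Gam_h_sum[OF x])
  then show ?thesis
    unfolding rotate_W[OF x] by (simp add: D1_def sum.distrib distrib_right)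
qed

lemma cov2_frame:
  assumes x: "x \<in> U"
    and B: "\<And>y r s. y \<in> U \<Longrightarrow> B y r s = (\<Sum>a\<in>UNIV. \<Sum>b\<in>UNIV. t a b y * h a r y * h b s y)"
    and t: "\<And>a b. pdiff (t a b) m x"
  shows "cov2 M am B x m r s = (\<Sum>a\<in>UNIV. \<Sum>b\<in>UNIV. D2 t m a b x * h a r x * h b s x)"
proof -
  \<comment> \<open>With one slot held fixed the tensor is a one-form in the other, with
    coefficients \<open>X\<close> or \<open>Y\<close>, so \<open>rotate_W\<close> can be used slot
    by slot.\<close>
  define X where "X a = (\<Sum>b\<in>UNIV. t a b x * h b s x)" for a
  define Y where "Y b = (\<Sum>a\<in>UNIV. t a b x * h a r x)" for b
  have "pd m (\<lambda>y. B y r s) x = pd m (\<lambda>y. \<Sum>a\<in>UNIV. \<Sum>b\<in>UNIV. t a b y * h a r y * h b s y) x"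
    by (rule pd_cong[OF open_U x]) (rule B)
  also have "\<dots> = (\<Sum>a\<in>UNIV. \<Sum>b\<in>UNIV. pd m (\<lambda>y. t a b y * h a r y * h b s y) x)"
    using x t by (simp add: pd_sum pdiff_sum pdiff_h pdiff_mult)
  also have "\<dots> = (\<Sum>a\<in>UNIV. \<Sum>b\<in>UNIV. pd m (t a b) x * h a r x * h b s x)
     + (\<Sum>a\<in>UNIV. \<Sum>b\<in>UNIV. t a b x * h b s x * pd m (h a r) x)
     + (\<Sum>a\<in>UNIV. \<Sum>b\<in>UNIV. t a b x * h a r x * pd m (h b s) x)"
    using x t by (simp add: pd_mult pdiff_h pdiff_mult sum.distrib[symmetric] algebra_simps)
  also have "(\<Sum>a\<in>UNIV. \<Sum>b\<in>UNIV. t a b x * h a r x * pd m (h b s) x)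
     = (\<Sum>b\<in>UNIV. \<Sum>a\<in>UNIV. t a b x * h a r x * pd m (h b s) x)"
    by (rule sum.swap)
  finally have pdB: "pd m (\<lambda>y. B y r s) x = (\<Sum>a\<in>UNIV. \<Sum>b\<in>UNIV. pd m (t a b) x * h a r x * h b s x)
     + (\<Sum>a\<in>UNIV. X a * pd m (h a r) x) + (\<Sum>b\<in>UNIV. Y b * pd m (h b s) x)"
    by (simp add: X_def Y_def sum_distrib_right)
  have B1: "B x l s = (\<Sum>a\<in>UNIV. X a * h a l x)" for l
    unfolding B[OF x] by (simp add: X_def sum_distrib_right sum_distrib_left ac_simps)
  have B2: "B x r l = (\<Sum>b\<in>UNIV. Y b * h b l x)" for l
    unfolding B[OF x] by (subst sum.swap) (simp add: Y_def sum_distrib_right sum_distrib_left ac_simps)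
  have "cov2 M am B x m r s = (\<Sum>a\<in>UNIV. \<Sum>b\<in>UNIV. pd m (t a b) x * h a r x * h b s x)
     + ((\<Sum>a\<in>UNIV. X a * pd m (h a r) x) - (\<Sum>a\<in>UNIV. X a * K a m r x))
     + ((\<Sum>b\<in>UNIV. Y b * pd m (h b s) x) - (\<Sum>b\<in>UNIV. Y b * K b m s x))"
    unfolding cov2_def pdB B1 B2 sum.distrib Gam_h_sum[OF x] by simp
  also have "\<dots> = (\<Sum>a\<in>UNIV. \<Sum>b\<in>UNIV. pd m (t a b) x * h a r x * h b s x)
     + (\<Sum>a\<in>UNIV. \<Sum>b\<in>UNIV. (\<Sum>d\<in>UNIV. W m a d x * t d b x) * h a r x * h b s x)
     + (\<Sum>a\<in>UNIV. \<Sum>b\<in>UNIV. (\<Sum>d\<in>UNIV. W m b d x * t a d x) * h a r x * h b s x)"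
  proof -
    have 1: "(\<Sum>b\<in>UNIV. W m a b x * X b) * h a r x
        = (\<Sum>b\<in>UNIV. (\<Sum>d\<in>UNIV. W m a d x * t d b x) * h a r x * h b s x)" for a
      unfolding X_def sum_distrib_left sum_distrib_right by (subst sum.swap) (simp add: ac_simps)
    have 2: "(\<Sum>d\<in>UNIV. W m b d x * Y d) * h b s x
        = (\<Sum>a\<in>UNIV. (\<Sum>d\<in>UNIV. W m b d x * t a d x) * h a r x * h b s x)" for b
      unfolding Y_def sum_distrib_left sum_distrib_right by (subst sum.swap) (simp add: ac_simps)
    show ?thesis
      unfolding rotate_W[OF x] 1 2 by (subst (4) sum.swap) simp
  qed
  finally show ?thesis by (simp add: D2_def sum.distrib distrib_right)
qed

lemma cov3_frame:
  assumes x: "x \<in> U"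
    and T: "\<And>y r s q. y \<in> U \<Longrightarrow> T y r s q = (\<Sum>a\<in>UNIV. \<Sum>b\<in>UNIV. \<Sum>c\<in>UNIV. t a b c y * h a r y * h b s y * h c q y)"
    and t: "\<And>a b c. pdiff (t a b c) m x"
  shows "cov3 M am T x m r s q = (\<Sum>a\<in>UNIV. \<Sum>b\<in>UNIV. \<Sum>c\<in>UNIV. D3 t m a b c x * h a r x * h b s x * h c q x)"
proof -
  define X where "X a = (\<Sum>b\<in>UNIV. \<Sum>c\<in>UNIV. t a b c x * h b s x * h c q x)" for a
  define Y where "Y b = (\<Sum>a\<in>UNIV. \<Sum>c\<in>UNIV. t a b c x * h a r x * h c q x)" for b
  define Z where "Z c = (\<Sum>a\<in>UNIV. \<Sum>b\<in>UNIV. t a b c x * h a r x * h b s x)" for c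
  have X: "(\<Sum>a\<in>UNIV. X a * F a) = (\<Sum>a\<in>UNIV. \<Sum>b\<in>UNIV. \<Sum>c\<in>UNIV. t a b c x * h b s x * h c q x * F a)" for F
    by (simp add: X_def sum_distrib_right)
  have Y: "(\<Sum>b\<in>UNIV. Y b * F b) = (\<Sum>a\<in>UNIV. \<Sum>b\<in>UNIV. \<Sum>c\<in>UNIV. t a b c x * h a r x * h c q x * F b)" for F
    unfolding Y_def sum_distrib_right by (rule sum.swap)
  have Z: "(\<Sum>c\<in>UNIV. Z c * F c) = (\<Sum>a\<in>UNIV. \<Sum>b\<in>UNIV. \<Sum>c\<in>UNIV. t a b c x * h a r x * h b s x * F c)" for F
    unfolding Z_def sum_distrib_right by (rule sum_swap3[symmetric])
  have "pd m (\<lambda>y. T y r s q) x = pd m (\<lambda>y. \<Sum>a\<in>UNIV. \<Sum>b\<in>UNIV. \<Sum>c\<in>UNIV. t a b c y * h a r y * h b s y * h c q y) x"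
    by (rule pd_cong[OF open_U x]) (rule T)
  also have "\<dots> = (\<Sum>a\<in>UNIV. \<Sum>b\<in>UNIV. \<Sum>c\<in>UNIV. pd m (\<lambda>y. t a b c y * h a r y * h b s y * h c q y) x)"
    using x t by (simp add: pd_sum pdiff_sum pdiff_h pdiff_mult)
  also have "\<dots> = (\<Sum>a\<in>UNIV. \<Sum>b\<in>UNIV. \<Sum>c\<in>UNIV. pd m (t a b c) x * h a r x * h b s x * h c q x)
     + (\<Sum>a\<in>UNIV. X a * pd m (h a r) x) + (\<Sum>b\<in>UNIV. Y b * pd m (h b s) x) + (\<Sum>c\<in>UNIV. Z c * pd m (h c q) x)"
    unfolding X Y Z using x t by (simp add: pd_mult pdiff_h pdiff_mult sum.distrib[symmetric] algebra_simps)
  finally have pdT: "pd m (\<lambda>y. T y r s q) x = (\<Sum>a\<in>UNIV. \<Sum>b\<in>UNIV. \<Sum>c\<in>UNIV. pd m (t a b c) x * h a r x * h b s x * h c q x)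
     + (\<Sum>a\<in>UNIV. X a * pd m (h a r) x) + (\<Sum>b\<in>UNIV. Y b * pd m (h b s) x) + (\<Sum>c\<in>UNIV. Z c * pd m (h c q) x)" .
  have T1: "T x l s q = (\<Sum>a\<in>UNIV. X a * h a l x)" for l
    unfolding T[OF x] X by (simp add: ac_simps)
  have T2: "T x r l q = (\<Sum>b\<in>UNIV. Y b * h b l x)" for l
    unfolding T[OF x] Y by (simp add: ac_simps)
  have T3: "T x r s l = (\<Sum>c\<in>UNIV. Z c * h c l x)" for l
    unfolding T[OF x] Z by (simp add: ac_simps)
  have "cov3 M am T x m r s q = (\<Sum>a\<in>UNIV. \<Sum>b\<in>UNIV. \<Sum>c\<in>UNIV. pd m (t a b c) x * h a r x * h b s x * h c q x)
     + ((\<Sum>a\<in>UNIV. X a * pd m (h a r) x) - (\<Sum>a\<in>UNIV. X a * K a m r x))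
     + ((\<Sum>b\<in>UNIV. Y b * pd m (h b s) x) - (\<Sum>b\<in>UNIV. Y b * K b m s x))
     + ((\<Sum>c\<in>UNIV. Z c * pd m (h c q) x) - (\<Sum>c\<in>UNIV. Z c * K c m q x))"
    unfolding cov3_def pdT T1 T2 T3 sum.distrib Gam_h_sum[OF x] by simp
  also have "\<dots> = (\<Sum>a\<in>UNIV. \<Sum>b\<in>UNIV. \<Sum>c\<in>UNIV. pd m (t a b c) x * h a r x * h b s x * h c q x)
     + (\<Sum>a\<in>UNIV. \<Sum>b\<in>UNIV. \<Sum>c\<in>UNIV. (\<Sum>d\<in>UNIV. W m a d x * t d b c x) * h a r x * h b s x * h c q x)
     + (\<Sum>a\<in>UNIV. \<Sum>b\<in>UNIV. \<Sum>c\<in>UNIV. (\<Sum>d\<in>UNIV. W m b d x * t a d c x) * h a r x * h b s x * h c q x)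
     + (\<Sum>a\<in>UNIV. \<Sum>b\<in>UNIV. \<Sum>c\<in>UNIV. (\<Sum>d\<in>UNIV. W m c d x * t a b d x) * h a r x * h b s x * h c q x)"
  proof -
    have 1: "(\<Sum>d\<in>UNIV. W m a d x * X d) * h a r x
        = (\<Sum>b\<in>UNIV. \<Sum>c\<in>UNIV. (\<Sum>d\<in>UNIV. W m a d x * t d b c x) * h a r x * h b s x * h c q x)" for a
      unfolding X_def sum_distrib_left sum_distrib_right by (subst sum_swap3[symmetric]) (simp add: ac_simps)
    have 2: "(\<Sum>d\<in>UNIV. W m b d x * Y d) * h b s x
        = (\<Sum>a\<in>UNIV. \<Sum>c\<in>UNIV. (\<Sum>d\<in>UNIV. W m b d x * t a d c x) * h a r x * h b s x * h c q x)" for b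
      unfolding Y_def sum_distrib_left sum_distrib_right by (subst sum_swap3[symmetric]) (simp add: ac_simps)
    have 3: "(\<Sum>d\<in>UNIV. W m c d x * Z d) * h c q x
        = (\<Sum>a\<in>UNIV. \<Sum>b\<in>UNIV. (\<Sum>d\<in>UNIV. W m c d x * t a b d x) * h a r x * h b s x * h c q x)" for c
      unfolding Z_def sum_distrib_left sum_distrib_right by (subst sum_swap3[symmetric]) (simp add: ac_simps)
    have p2: "(\<Sum>b\<in>UNIV. (\<Sum>d\<in>UNIV. W m b d x * Y d) * h b s x) = (\<Sum>a\<in>UNIV. \<Sum>b\<in>UNIV. \<Sum>c\<in>UNIV. (\<Sum>d\<in>UNIV. W m b d x * t a d c x) * h a r x * h b s x * h c q x)"
      unfolding 2 by (rule sum.swap)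
    have p3: "(\<Sum>c\<in>UNIV. (\<Sum>d\<in>UNIV. W m c d x * Z d) * h c q x) = (\<Sum>a\<in>UNIV. \<Sum>b\<in>UNIV. \<Sum>c\<in>UNIV. (\<Sum>d\<in>UNIV. W m c d x * t a b d x) * h a r x * h b s x * h c q x)"
      unfolding 3 by (rule sum_swap3[symmetric])
    show ?thesis unfolding rotate_W[OF x] p2 p3 unfolding 1 ..
  qed
  finally show ?thesis by (simp add: D3_def sum.distrib distrib_right)
qed

lemma d1_cov1: "x \<in> U \<Longrightarrow> d1 th x m n = cov1 M am th x m n - cov1 M am th x n m"
  by (simp add: d1_def cov1_def Gam_sym[of x _ n m])

text \<open>By symmetry of \<open>Gam\<close> in its lower indices each connection term cancels
  against one from another cyclic position, after an exchange of the two slots of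
  \<open>B\<close>.\<close>

lemma d2_cov2:
  assumes x: "x \<in> U" and B: "\<And>r s. B x r s = - B x s r"
  shows "d2 B x a b c = cov2 M am B x a b c + cov2 M am B x b c a + cov2 M am B x c a b"
proof -
  have "(\<Sum>l\<in>UNIV. Gam M am x l a b * B x l c + Gam M am x l a c * B x b l)
      + (\<Sum>l\<in>UNIV. Gam M am x l b c * B x l a + Gam M am x l b a * B x c l)
      + (\<Sum>l\<in>UNIV. Gam M am x l c a * B x l b + Gam M am x l c b * B x a l) = 0"
    unfolding sum.distrib[symmetric] Gam_sym[OF x, of _ b a] Gam_sym[OF x, of _ c a] Gam_sym[OF x, of _ c b]
      B[of b] B[of c] B[of a] by (simp add: algebra_simps)
  then show ?thesis by (simp add: d2_def cov2_def algebra_simps)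
qed

subsection \<open>Curvature\<close>

lemma contract_h2:
  assumes "x \<in> U"
  shows "(\<Sum>m\<in>UNIV. \<Sum>n\<in>UNIV. E a m x * E b n x * (\<Sum>c\<in>UNIV. \<Sum>d\<in>UNIV. t c d * h c m x * h d n x)) = t a b"
proof -
  have "(\<Sum>n\<in>UNIV. E a m x * E b n x * (\<Sum>c\<in>UNIV. \<Sum>d\<in>UNIV. t c d * h c m x * h d n x))
      = E a m x * (\<Sum>c\<in>UNIV. t c b * h c m x)" for m
  proof -
    have "(\<Sum>n\<in>UNIV. E a m x * E b n x * (\<Sum>c\<in>UNIV. \<Sum>d\<in>UNIV. t c d * h c m x * h d n x))
        = E a m x * (\<Sum>n\<in>UNIV. E b n x * (\<Sum>d\<in>UNIV. (\<Sum>c\<in>UNIV. t c d * h c m x) * h d n x))"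
      unfolding sum_distrib_left sum_distrib_right
      by (rule sum.cong[OF refl], subst sum.swap) (simp add: ac_simps)
    then show ?thesis by (simp only: contract_h[OF assms])
  qed
  then show ?thesis by (simp add: contract_h[OF assms])
qed

lemma expand_h2:
  assumes "x \<in> U"
  shows "X m n = (\<Sum>a\<in>UNIV. \<Sum>b\<in>UNIV. (\<Sum>r\<in>UNIV. \<Sum>s\<in>UNIV. E a r x * E b s x * X r s) * h a m x * h b n x)"
proof -
  have "X m n = (\<Sum>a\<in>UNIV. (\<Sum>r\<in>UNIV. E a r x * X r n) * h a m x)"
    by (rule expand_h[OF assms])
  also have "\<dots> = (\<Sum>a\<in>UNIV. (\<Sum>r\<in>UNIV. E a r x * (\<Sum>b\<in>UNIV. (\<Sum>s\<in>UNIV. E b s x * X r s) * h b n x)) * h a m x)"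
    by (subst expand_h[OF assms, of "X _" n]) simp
  also have "\<dots> = (\<Sum>a\<in>UNIV. \<Sum>r\<in>UNIV. \<Sum>b\<in>UNIV. (\<Sum>s\<in>UNIV. E a r x * E b s x * X r s) * h a m x * h b n x)"
    by (simp add: sum_distrib_left sum_distrib_right ac_simps)
  also have "\<dots> = (\<Sum>a\<in>UNIV. \<Sum>b\<in>UNIV. \<Sum>r\<in>UNIV. (\<Sum>s\<in>UNIV. E a r x * E b s x * X r s) * h a m x * h b n x)"
    by (rule sum.cong[OF refl], rule sum.swap)
  finally show ?thesis by (simp add: sum_distrib_right)
qed

lemma K_C1: "Ck 1 U (K a m n)"
proof -
  have "Ck 1 U (pd m (h a n))" using h_C2[of a n] by (intro Ck_pd) (simp add: numeral_2_eq_2)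
  moreover have "Ck 1 U (h b n)" for b using h_C2[of b n] Ck_Suc[of 1 U "h b n"] by (simp add: numeral_2_eq_2)
  ultimately have "Ck 1 U (\<lambda>x. pd m (h a n) x + (\<Sum>b\<in>UNIV. W m a b x * h b n x))"
    by (intro Ck_add Ck_sum Ck_mult open_U W_C1) auto
  then show ?thesis unfolding K_def[abs_def] .
qed

text \<open>Cartan's curvature two-form dW + W \<and> W, with form indices \<open>m n\<close> and
  frame indices \<open>a b\<close>.\<close>

definition F :: "4 \<Rightarrow> 4 \<Rightarrow> 4 \<Rightarrow> 4 \<Rightarrow> pt \<Rightarrow> complex" where
  "F m n a b x = pd m (W n a b) x - pd n (W m a b) x
     + (\<Sum>c\<in>UNIV. W m a c x * W n c b x - W n a c x * W m c b x)"

lemma pd_W_antisym: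
  assumes "x \<in> U"
  shows "pd m (W n a b) x = - pd m (W n b a) x"
proof -
  have "pd m (W n a b) x = pd m (\<lambda>y. - W n b a y) x"
    by (rule pd_cong[OF open_U assms]) (rule W_antisym)
  then show ?thesis using pd_minus[OF pdiff_W[OF assms]] by simp
qed

lemma F_antisym:
  assumes "x \<in> U"
  shows "F m n a b x = - F m n b a x"
proof -
  have "W m a c x * W n c b x - W n a c x * W m c b x = - (W m b c x * W n c a x - W n b c x * W m c a x)" for c
    using W_antisym[OF assms, of m a c] W_antisym[OF assms, of n c b] W_antisym[OF assms, of n a c]
      W_antisym[OF assms, of m c b] by simp
  then have "(\<Sum>c\<in>UNIV. W m a c x * W n c b x - W n a c x * W m c b x)
      = - (\<Sum>c\<in>UNIV. W m b c x * W n c a x - W n b c x * W m c a x)"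
    by (simp only: sum_negf)
  then show ?thesis
    unfolding F_def pd_W_antisym[OF assms, of m n a b] pd_W_antisym[OF assms, of n m a b] by simp
qed

lemma F_antisym_form: "F m n a b x = - F n m a b x"
  by (simp add: F_def sum_subtractf)

text \<open>Differentiating the completeness relation \<open>hE\<close> trades the derivative of
  \<open>E\<close> for that of \<open>h\<close>, which \<open>K\<close> splits into a frame rotation
  and a Christoffel part.\<close>

lemma pd_E:
  assumes x: "x \<in> U"
  shows "pd m (E a r) x = (\<Sum>b\<in>UNIV. W m b a x * E b r x) - (\<Sum>l\<in>UNIV. Gam M am x r m l * E a l x)"
proof -
  have 0: "(\<Sum>b\<in>UNIV. pd m (E b r) x * h b s x) = - (\<Sum>b\<in>UNIV. E b r x * pd m (h b s) x)" for s
  proof -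
    have "pd m (\<lambda>y. \<Sum>b\<in>UNIV. h b s y * E b r y) x = pd m (\<lambda>y. if s = r then 1 else 0) x"
      by (rule pd_cong[OF open_U x]) (rule hE)
    moreover have "pd m (\<lambda>y. \<Sum>b\<in>UNIV. h b s y * E b r y) x
        = (\<Sum>b\<in>UNIV. pd m (E b r) x * h b s x) + (\<Sum>b\<in>UNIV. E b r x * pd m (h b s) x)"
      using x by (subst pd_sum) (auto simp: pd_mult pdiff_h pdiff_E pdiff_mult sum.distrib ac_simps)
    ultimately show ?thesis by (simp add: pd_const eq_neg_iff_add_eq_0)
  qed
  have "pd m (E a r) x = (\<Sum>s\<in>UNIV. E a s x * (\<Sum>b\<in>UNIV. pd m (E b r) x * h b s x))"
    by (rule contract_h[OF x, symmetric])
  also have "\<dots> = (\<Sum>s\<in>UNIV. E a s x * (\<Sum>b\<in>UNIV. E b r x * (\<Sum>c\<in>UNIV. W m b c x * h c s x)))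
      - (\<Sum>s\<in>UNIV. E a s x * (\<Sum>b\<in>UNIV. E b r x * K b m s x))"
  proof -
    have "(\<Sum>b\<in>UNIV. E b r x * K b m s x) = (\<Sum>b\<in>UNIV. E b r x * pd m (h b s) x)
        + (\<Sum>b\<in>UNIV. E b r x * (\<Sum>c\<in>UNIV. W m b c x * h c s x))" for s
      by (simp add: K_def distrib_left sum.distrib)
    then show ?thesis unfolding 0 by (simp add: distrib_left sum.distrib sum_negf)
  qed
  finally have *: "pd m (E a r) x = (\<Sum>s\<in>UNIV. E a s x * (\<Sum>b\<in>UNIV. E b r x * (\<Sum>c\<in>UNIV. W m b c x * h c s x)))
      - (\<Sum>s\<in>UNIV. E a s x * (\<Sum>b\<in>UNIV. E b r x * K b m s x))" .
  have "(\<Sum>b\<in>UNIV. E b r x * (\<Sum>c\<in>UNIV. W m b c x * h c s x))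
      = (\<Sum>c\<in>UNIV. (\<Sum>b\<in>UNIV. W m b c x * E b r x) * h c s x)" for s
    unfolding sum_distrib_left sum_distrib_right by (subst sum.swap) (simp add: ac_simps)
  then show ?thesis
    unfolding * by (simp only: contract_h[OF x]) (simp add: Gam_frame[OF x] ac_simps)
qed

text \<open>The quadratic term of \<open>Riem\<close> is exactly what cancels the Christoffel part
  of \<open>pd_E\<close>, leaving the frame-covariant derivative of \<open>K\<close>.\<close>

lemma pd_Gam:
  assumes x: "x \<in> U"
  shows "pd m (\<lambda>y. Gam M am y r n s) x + (\<Sum>l\<in>UNIV. Gam M am x r m l * Gam M am x l n s)
    = (\<Sum>a\<in>UNIV. E a r x * (pd m (K a n s) x + (\<Sum>b\<in>UNIV. W m a b x * K b n s x)))"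
proof -
  have pdK: "pdiff (K a n s) m x" for a using Ck_pdiff[OF K_C1 _ x] by simp
  have "pd m (\<lambda>y. Gam M am y r n s) x = pd m (\<lambda>y. \<Sum>a\<in>UNIV. E a r y * K a n s y) x"
    by (rule pd_cong[OF open_U x]) (rule Gam_frame)
  also have "\<dots> = (\<Sum>a\<in>UNIV. E a r x * pd m (K a n s) x) + (\<Sum>a\<in>UNIV. pd m (E a r) x * K a n s x)"
    using x by (subst pd_sum) (auto simp: pd_mult pdiff_E pdK pdiff_mult sum.distrib)
  also have "(\<Sum>a\<in>UNIV. pd m (E a r) x * K a n s x)
     = (\<Sum>a\<in>UNIV. \<Sum>b\<in>UNIV. W m b a x * E b r x * K a n s x)
       - (\<Sum>a\<in>UNIV. \<Sum>l\<in>UNIV. Gam M am x r m l * E a l x * K a n s x)"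
    unfolding pd_E[OF x] by (simp add: left_diff_distrib sum_subtractf sum_distrib_right)
  also have "(\<Sum>a\<in>UNIV. \<Sum>l\<in>UNIV. Gam M am x r m l * E a l x * K a n s x)
     = (\<Sum>l\<in>UNIV. Gam M am x r m l * Gam M am x l n s)"
    unfolding Gam_frame[OF x, of _ n s] sum_distrib_left by (subst sum.swap) (simp add: ac_simps)
  also have "(\<Sum>a\<in>UNIV. \<Sum>b\<in>UNIV. W m b a x * E b r x * K a n s x)
     = (\<Sum>b\<in>UNIV. E b r x * (\<Sum>a\<in>UNIV. W m b a x * K a n s x))"
    unfolding sum_distrib_left by (subst sum.swap) (simp add: ac_simps)
  finally show ?thesis by (simp add: distrib_left sum.distrib)
qed

lemma pd_K:
  assumes x: "x \<in> U"
  shows "pd m (K a n s) x = pd m (pd n (h a s)) x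
    + (\<Sum>b\<in>UNIV. W n a b x * pd m (h b s) x) + (\<Sum>b\<in>UNIV. pd m (W n a b) x * h b s x)"
proof -
  have "pdiff (pd n (h a s)) m x" using h_C2[of a s] x by (simp add: numeral_2_eq_2)
  then show ?thesis
    unfolding K_def[abs_def] using x
    by (simp add: pd_add pd_sum pd_mult pdiff_sum pdiff_mult pdiff_W pdiff_h sum.distrib)
qed

lemma Riem_frame:
  assumes x: "x \<in> U"
  shows "Riem M am x r s m n = (\<Sum>a\<in>UNIV. E a r x * (\<Sum>b\<in>UNIV. F m n a b x * h b s x))"
proof -
  \<comment> \<open>After antisymmetrisation the second derivatives of \<open>h\<close> cancel, the
    products of \<open>W\<close> with first derivatives of \<open>h\<close> cancel in pairs, and
    \<open>F\<close> applied to \<open>h\<close> is left.\<close>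
  have key: "(pd m (K a n s) x + (\<Sum>b\<in>UNIV. W m a b x * K b n s x))
     - (pd n (K a m s) x + (\<Sum>b\<in>UNIV. W n a b x * K b m s x)) = (\<Sum>b\<in>UNIV. F m n a b x * h b s x)" for a
  proof -
    have WW: "(\<Sum>b\<in>UNIV. W m a b x * K b n s x) = (\<Sum>b\<in>UNIV. W m a b x * pd n (h b s) x)
        + (\<Sum>b\<in>UNIV. (\<Sum>c\<in>UNIV. W m a c x * W n c b x) * h b s x)" for m n
    proof -
      have "(\<Sum>b\<in>UNIV. W m a b x * (\<Sum>c\<in>UNIV. W n b c x * h c s x))
          = (\<Sum>b\<in>UNIV. (\<Sum>c\<in>UNIV. W m a c x * W n c b x) * h b s x)"
        unfolding sum_distrib_left sum_distrib_right by (subst sum.swap) (simp add: ac_simps)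
      then show ?thesis by (simp add: K_def distrib_left sum.distrib)
    qed
    have "pd m (pd n (h a s)) x = pd n (pd m (h a s)) x"
      by (rule pd_commute[OF open_U x h_C2])
    then show ?thesis unfolding pd_K[OF x] WW
      by (simp add: F_def sum_subtractf sum.distrib algebra_simps)
  qed
  have "Riem M am x r s m n
     = (pd m (\<lambda>y. Gam M am y r n s) x + (\<Sum>l\<in>UNIV. Gam M am x r m l * Gam M am x l n s))
     - (pd n (\<lambda>y. Gam M am y r m s) x + (\<Sum>l\<in>UNIV. Gam M am x r n l * Gam M am x l m s))"
    by (simp add: Riem_def sum_subtractf)
  then show ?thesis unfolding pd_Gam[OF x] key[symmetric]
    by (simp add: right_diff_distrib sum_subtractf)
qed

text \<open>The cyclic sum cancels term by term once the lower indices of \<open>Gam\<close> are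
  exchanged, also under the derivative, where openness of \<open>U\<close> makes the exchange
  legitimate.\<close>

lemma Riem_bianchi:
  assumes x: "x \<in> U"
  shows "Riem M am x r s m n + Riem M am x r m n s + Riem M am x r n s m = 0"
proof -
  have "pd i (\<lambda>y. Gam M am y r j k) x = pd i (\<lambda>y. Gam M am y r k j) x" for i j k
    by (rule pd_cong[OF open_U x]) (rule Gam_sym)
  note s1 = this[of m s n] this[of n s m] this[of s n m]
  note s2 = Gam_sym[OF x, of _ s n] Gam_sym[OF x, of _ s m] Gam_sym[OF x, of _ n m]
  show ?thesis unfolding Riem_def s1 s2 sum_subtractf by simp
qed

definition Fe :: "4 \<Rightarrow> 4 \<Rightarrow> 4 \<Rightarrow> 4 \<Rightarrow> pt \<Rightarrow> complex" where
  "Fe c d a b x = (\<Sum>m\<in>UNIV. \<Sum>n\<in>UNIV. E c m x * E d n x * F m n a b x)"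

lemma Fe_antisym:
  assumes "x \<in> U"
  shows "Fe c d a b x = - Fe c d b a x"
  unfolding Fe_def by (simp add: F_antisym[OF assms, of _ _ a b] sum_negf)

lemma Fe_antisym_form: "Fe c d a b x = - Fe d c a b x"
proof -
  have "E c m x * E d n x * F m n a b x = - (E d n x * E c m x * F n m a b x)" for m n
    by (subst F_antisym_form) (simp add: ac_simps)
  then have "Fe c d a b x = (\<Sum>m\<in>UNIV. \<Sum>n\<in>UNIV. - (E d n x * E c m x * F n m a b x))"
    unfolding Fe_def by (simp only:)
  also have "\<dots> = (\<Sum>n\<in>UNIV. \<Sum>m\<in>UNIV. - (E d n x * E c m x * F n m a b x))" by (rule sum.swap)
  finally show ?thesis by (simp add: Fe_def sum_negf)
qed

lemma Fe_bianchi: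
  assumes x: "x \<in> U"
  shows "Fe c d a b x + Fe d b a c x + Fe b c a d x = 0"
proof -
  define G where "G a s m n = (\<Sum>b\<in>UNIV. F m n a b x * h b s x)" for a s m n
  \<comment> \<open>\<open>Riem\<close> carries its frame index through \<open>E\<close>;
    contraction with \<open>h\<close> strips it off, so the cyclic identity holds for each frame
    index separately.\<close>
  have cyc: "G a s m n + G a m n s + G a n s m = 0" for s m n
  proof -
    have RG: "Riem M am x r s m n = (\<Sum>a\<in>UNIV. E a r x * G a s m n)" for r s m n
      by (simp add: Riem_frame[OF x] G_def)
    have "(\<Sum>a\<in>UNIV. (G a s m n + G a m n s + G a n s m) * E a r x) = 0" for r
      using Riem_bianchi[OF x, of r s m n]
      by (simp add: RG distrib_left sum.distrib mult.commute)
    then show ?thesis using contract_E[OF x, of a "\<lambda>a. G a s m n + G a m n s + G a n s m"] by simp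
  qed
  have 1: "(\<Sum>m\<in>UNIV. \<Sum>n\<in>UNIV. \<Sum>s\<in>UNIV. E c m x * E d n x * E b s x * G a s m n) = Fe c d a b x"
  proof -
    have "(\<Sum>s\<in>UNIV. E c m x * E d n x * E b s x * G a s m n) = E c m x * E d n x * F m n a b x" for m n
      using contract_h[OF x, of b "\<lambda>b. F m n a b x"]
      by (simp add: G_def sum_distrib_left[symmetric] mult.assoc)
    then show ?thesis by (simp add: Fe_def)
  qed
  have 2: "(\<Sum>m\<in>UNIV. \<Sum>n\<in>UNIV. \<Sum>s\<in>UNIV. E c m x * E d n x * E b s x * G a m n s) = Fe d b a c x"
  proof -
    have "(\<Sum>m\<in>UNIV. E d n x * E b s x * E c m x * G a m n s) = E d n x * E b s x * F n s a c x" for n s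
      using contract_h[OF x, of c "\<lambda>b. F n s a b x"]
      by (simp add: G_def sum_distrib_left[symmetric] mult.assoc)
    moreover have "(\<Sum>m\<in>UNIV. \<Sum>n\<in>UNIV. \<Sum>s\<in>UNIV. E c m x * E d n x * E b s x * G a m n s)
      = (\<Sum>n\<in>UNIV. \<Sum>s\<in>UNIV. \<Sum>m\<in>UNIV. E d n x * E b s x * E c m x * G a m n s)"
      by (subst (2) sum_swap3) (simp add: ac_simps)
    ultimately show ?thesis by (simp add: Fe_def)
  qed
  have 3: "(\<Sum>m\<in>UNIV. \<Sum>n\<in>UNIV. \<Sum>s\<in>UNIV. E c m x * E d n x * E b s x * G a n s m) = Fe b c a d x"
  proof -
    have "(\<Sum>n\<in>UNIV. E b s x * E c m x * E d n x * G a n s m) = E b s x * E c m x * F s m a d x" for s m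
      using contract_h[OF x, of d "\<lambda>b. F s m a b x"]
      by (simp add: G_def sum_distrib_left[symmetric] mult.assoc)
    moreover have "(\<Sum>m\<in>UNIV. \<Sum>n\<in>UNIV. \<Sum>s\<in>UNIV. E c m x * E d n x * E b s x * G a n s m)
      = (\<Sum>s\<in>UNIV. \<Sum>m\<in>UNIV. \<Sum>n\<in>UNIV. E b s x * E c m x * E d n x * G a n s m)"
      by (subst sum_swap3) (simp add: ac_simps)
    ultimately show ?thesis by (simp add: Fe_def)
  qed
  have "(\<Sum>m\<in>UNIV. \<Sum>n\<in>UNIV. \<Sum>s\<in>UNIV. E c m x * E d n x * E b s x * (G a s m n + G a m n s + G a n s m)) = 0"
    by (simp add: cyc)
  then show ?thesis unfolding 1[symmetric] 2[symmetric] 3[symmetric]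
    by (simp add: distrib_left sum.distrib)
qed

lemma scal_frame:
  assumes x: "x \<in> U"
  shows "scal M am x = (\<Sum>a\<in>UNIV. \<Sum>b\<in>UNIV. Fe a b a b x)"
proof -
  have Ric: "Ric M am x s n = (\<Sum>b\<in>UNIV. (\<Sum>r\<in>UNIV. \<Sum>a\<in>UNIV. E a r x * F r n a b x) * h b s x)" for s n
  proof -
    have "Ric M am x s n = (\<Sum>r\<in>UNIV. \<Sum>a\<in>UNIV. \<Sum>b\<in>UNIV. E a r x * F r n a b x * h b s x)"
      by (simp add: Ric_def Riem_frame[OF x] sum_distrib_left ac_simps)
    also have "\<dots> = (\<Sum>b\<in>UNIV. \<Sum>r\<in>UNIV. \<Sum>a\<in>UNIV. E a r x * F r n a b x * h b s x)"
      by (rule sum_swap3)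
    finally show ?thesis by (simp add: sum_distrib_right)
  qed
  have "scal M am x = (\<Sum>b\<in>UNIV. \<Sum>n\<in>UNIV. \<Sum>r\<in>UNIV. \<Sum>a\<in>UNIV. E b n x * (E a r x * F r n a b x))"
    unfolding scal_def Ric ginv_trace[OF x] by (simp add: sum_distrib_left)
  also have "\<dots> = (\<Sum>b\<in>UNIV. \<Sum>a\<in>UNIV. \<Sum>n\<in>UNIV. \<Sum>r\<in>UNIV. E b n x * (E a r x * F r n a b x))"
    by (rule sum.cong[OF refl], rule sum_swap3)
  also have "\<dots> = (\<Sum>b\<in>UNIV. \<Sum>a\<in>UNIV. \<Sum>r\<in>UNIV. \<Sum>n\<in>UNIV. E b n x * (E a r x * F r n a b x))"
    by (rule sum.cong[OF refl], rule sum.cong[OF refl], rule sum.swap)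
  also have "\<dots> = (\<Sum>a\<in>UNIV. \<Sum>b\<in>UNIV. \<Sum>r\<in>UNIV. \<Sum>n\<in>UNIV. E b n x * (E a r x * F r n a b x))"
    by (rule sum.swap)
  finally show ?thesis by (simp add: Fe_def ac_simps)
qed

definition xi :: "4 \<Rightarrow> pt \<Rightarrow> complex" where
  "xi m x = W m 0 1 x - W m 2 3 x"

definition dxi :: "4 \<Rightarrow> 4 \<Rightarrow> pt \<Rightarrow> complex" where
  "dxi a b x = (\<Sum>m\<in>UNIV. \<Sum>n\<in>UNIV. E a m x * E b n x * (pd m (xi n) x - pd n (xi m) x))"

lemma xi_C1: "Ck 1 U (xi m)"
  unfolding xi_def[abs_def] by (intro Ck_diff open_U W_C1)

text \<open>Rewrite rules that reduce all sixteen entries of \<open>W m\<close> to the four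
  independent ones: 01, 02, 03 and 23.\<close>

lemma W_normal:
  assumes "x \<in> U"
  shows "W m 1 0 x = - W m 0 1 x" "W m 2 0 x = - W m 0 2 x" "W m 3 0 x = - W m 0 3 x"
    "W m 1 2 x = W m 0 3 x" "W m 2 1 x = - W m 0 3 x" "W m 3 1 x = W m 0 2 x" "W m 1 3 x = - W m 0 2 x"
    "W m 3 2 x = - W m 2 3 x" "W m a a x = 0"
  using W_antisym[OF assms] W02[OF assms] W03[OF assms] W_diag[OF assms]
  by (metis, metis, metis, metis, metis, metis, metis, metis, metis)

text \<open>The two relations on \<open>W\<close> say that only one component of the anti-self-dual
  half of the connection survives. That half is then abelian, so the quadratic terms drop out of its
  curvature, which is the exterior derivative of \<open>xi\<close>.\<close>

lemma F_kaehler: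
  assumes x: "x \<in> U"
  shows "F m n 0 2 x = F m n 3 1 x" "F m n 0 3 x = F m n 1 2 x"
    "F m n 0 1 x - F m n 2 3 x = pd m (xi n) x - pd n (xi m) x"
proof -
  have "pd i (W j 0 2) x = pd i (W j 3 1) x" "pd i (W j 0 3) x = pd i (W j 1 2) x" for i j
    using W02 W03 by (auto intro!: pd_cong[OF open_U x])
  note p = this
  have q: "pd i (xi j) x = pd i (W j 0 1) x - pd i (W j 2 3) x" for i j
    unfolding xi_def[abs_def] by (rule pd_diff[OF pdiff_W[OF x] pdiff_W[OF x]])
  show "F m n 0 2 x = F m n 3 1 x" "F m n 0 3 x = F m n 1 2 x"
    unfolding F_def p sum4 W_normal[OF x] by (simp_all add: algebra_simps)
  show "F m n 0 1 x - F m n 2 3 x = pd m (xi n) x - pd n (xi m) x"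
    unfolding F_def q sum4 W_normal[OF x] by (simp add: algebra_simps)
qed

lemma Fe_kaehler:
  assumes x: "x \<in> U"
  shows "Fe c d 0 2 x = Fe c d 3 1 x" "Fe c d 0 3 x = Fe c d 1 2 x" "Fe c d 0 1 x = Fe c d 2 3 x + dxi c d x"
  unfolding Fe_def dxi_def F_kaehler(1,2)[OF x] F_kaehler(3)[OF x, symmetric]
  by (simp_all add: sum.distrib[symmetric] algebra_simps)

text \<open>The classical combination of four Bianchi identities. All relations are linear, so
  linear arithmetic on real and imaginary parts finds it.\<close>

lemma curvature_pair_symmetry:
  fixes R :: "4 \<Rightarrow> 4 \<Rightarrow> 4 \<Rightarrow> 4 \<Rightarrow> complex"
  assumes "\<And>a b c d. R c d a b = - R c d b a" "\<And>a b c d. R c d a b = - R d c a b"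
    and "\<And>a b c d. R c d a b + R d b a c + R b c a d = 0"
  shows "R a b c d = R c d a b"
  using assms(1)[of c d a b] assms(1)[of a b c d] assms(1)[of b c a d] assms(1)[of a d b c]
    assms(1)[of a c b d] assms(1)[of b d a c]
    assms(2)[of c d a b] assms(2)[of a b c d] assms(2)[of b c a d] assms(2)[of a d b c]
    assms(2)[of a c b d] assms(2)[of b d a c] assms(2)[of c d b a] assms(2)[of a b d c] assms(2)[of b c d a] assms(2)[of a d c b]
    assms(2)[of a c d b] assms(2)[of b d c a]
    assms(3)[of c d a b] assms(3)[of d a b c] assms(3)[of a b c d] assms(3)[of b c d a]
  unfolding complex_eq_iff by (simp; linarith)

text \<open>By \<open>Fe_kaehler\<close> the form \<open>dxi\<close> is a difference of curvature
  components whose second pair is 01 or 23. Pair symmetry turns these into first pairs, and then the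
  relations 02 = 31 and 03 = 12 apply to the other pair.\<close>

lemma dxi_type:
  assumes x: "x \<in> U"
  shows "dxi 0 2 x = dxi 3 1 x" "dxi 0 3 x = dxi 1 2 x" "scal M am x = 2 * (dxi 0 1 x - dxi 2 3 x)"
proof -
  have sym: "Fe a b c d x = Fe c d a b x" for a b c d
    by (rule curvature_pair_symmetry[of "\<lambda>a b c d. Fe a b c d x"])
      (rule Fe_antisym[OF x] Fe_antisym_form Fe_bianchi[OF x])+
  note k = Fe_kaehler[OF x]
  have d0: "Fe a b c c x = 0" "Fe c c a b x = 0" for a b c
    using Fe_antisym[OF x, of a b c c] Fe_antisym_form[of c c a b x] by simp_all
  show "dxi 0 2 x = dxi 3 1 x"
    using k(3)[of 0 2] k(3)[of 3 1] k(1)[of 0 1] k(1)[of 2 3] sym[of 0 1 0 2] sym[of 0 1 3 1] sym[of 2 3 0 2] sym[of 2 3 3 1]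
    by (metis add_left_cancel)
  show "dxi 0 3 x = dxi 1 2 x"
    using k(3)[of 0 3] k(3)[of 1 2] k(2)[of 0 1] k(2)[of 2 3] sym[of 0 1 0 3] sym[of 0 1 1 2] sym[of 2 3 0 3] sym[of 2 3 1 2]
    by (metis add_left_cancel)
  have sw: "Fe a b a b x = Fe b a b a x" for a b
    using Fe_antisym[OF x, of a b a b] Fe_antisym_form[of a b b a x] by simp
  have "scal M am x = 2 * (Fe 0 1 0 1 x + Fe 2 3 2 3 x + Fe 0 2 0 2 x + Fe 3 1 3 1 x + Fe 0 3 0 3 x + Fe 1 2 1 2 x)"
    unfolding scal_frame[OF x] sum4 d0 sw[of 1 0] sw[of 2 0] sw[of 3 0] sw[of 2 1] sw[of 1 3] sw[of 3 2] by simp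
  also have "Fe 0 1 0 1 x = Fe 2 3 0 1 x + dxi 0 1 x" using k(3)[of 0 1] sym[of 0 1 2 3] by simp
  also have "Fe 2 3 2 3 x = Fe 2 3 0 1 x - dxi 2 3 x" using k(3)[of 2 3] by simp
  also have "Fe 0 2 0 2 x = Fe 3 1 0 2 x" using k(1)[of 0 2] sym[of 0 2 3 1] by simp
  also have "Fe 3 1 3 1 x = Fe 3 1 0 2 x" using k(1)[of 3 1] by simp
  also have "Fe 0 3 0 3 x = Fe 1 2 0 3 x" using k(2)[of 0 3] sym[of 0 3 1 2] by simp
  also have "Fe 1 2 1 2 x = Fe 1 2 0 3 x" using k(2)[of 1 2] by simp
  \<comment> \<open>The three curvature components left over form one cyclic sum, which the first
    Bianchi identity annihilates.\<close>
  finally have "scal M am x = 2 * (dxi 0 1 x - dxi 2 3 x) + 4 * (Fe 2 3 0 1 x + Fe 3 1 0 2 x + Fe 1 2 0 3 x)"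
    by (simp add: algebra_simps)
  then show "scal M am x = 2 * (dxi 0 1 x - dxi 2 3 x)"
    using Fe_bianchi[OF x, of 2 3 0 1] by simp
qed

end

section \<open>Anti-self-dual matrices and charged sections\<close>

definition cyc3 :: "4 \<Rightarrow> 4 \<Rightarrow> 4 \<Rightarrow> complex" where
  "cyc3 a b c = (if (a, b, c) \<in> {(1, 2, 3), (2, 3, 1), (3, 1, 2)} then 1
     else if (a, b, c) \<in> {(1, 3, 2), (3, 2, 1), (2, 1, 3)} then -1 else 0)"

text \<open>The Levi-Civita symbol with \<open>eps 0 1 2 3 = 1\<close>, expanded along the position
  of the index 0. Four indices without a 0 must repeat, hence the final 0.\<close>

definition eps :: "4 \<Rightarrow> 4 \<Rightarrow> 4 \<Rightarrow> 4 \<Rightarrow> complex" where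
  "eps a b c d = (if a = 0 then cyc3 b c d else if b = 0 then - cyc3 a c d
     else if c = 0 then cyc3 a b d else if d = 0 then - cyc3 a b c else 0)"

definition dual :: "(4 \<Rightarrow> 4 \<Rightarrow> complex) \<Rightarrow> 4 \<Rightarrow> 4 \<Rightarrow> complex" where
  "dual t a b = (1/2) * (\<Sum>c\<in>UNIV. \<Sum>d\<in>UNIV. eps a b c d * t c d)"

text \<open>Antisymmetry together with the (-1)-eigenvalue equation of \<open>dual\<close>, written
  out on the three independent pairs.\<close>

definition asd :: "(4 \<Rightarrow> 4 \<Rightarrow> complex) \<Rightarrow> bool" where
  "asd w \<longleftrightarrow> (\<forall>a b. w a b = - w b a) \<and> w 2 3 = - w 0 1 \<and> w 3 1 = - w 0 2 \<and> w 1 2 = - w 0 3"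

definition w1 :: "4 \<Rightarrow> 4 \<Rightarrow> complex" where
  "w1 a b = (if (a, b) = (0, 1) \<or> (a, b) = (3, 2) then 1 else if (a, b) = (1, 0) \<or> (a, b) = (2, 3) then -1 else 0)"

definition w2 :: "4 \<Rightarrow> 4 \<Rightarrow> complex" where
  "w2 a b = (if (a, b) = (0, 2) \<or> (a, b) = (1, 3) then 1 else if (a, b) = (2, 0) \<or> (a, b) = (3, 1) then -1 else 0)"

definition w3 :: "4 \<Rightarrow> 4 \<Rightarrow> complex" where
  "w3 a b = (if (a, b) = (0, 3) \<or> (a, b) = (2, 1) then 1 else if (a, b) = (3, 0) \<or> (a, b) = (1, 2) then -1 else 0)"

definition wp :: "4 \<Rightarrow> 4 \<Rightarrow> complex" where
  "wp a b = (w2 a b + \<i> * w3 a b) / complex_of_real (sqrt 2)"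

definition wm :: "4 \<Rightarrow> 4 \<Rightarrow> complex" where
  "wm a b = (w2 a b - \<i> * w3 a b) / complex_of_real (sqrt 2)"

lemma asd_w: "asd w1" "asd wp" "asd wm"
  unfolding asd_def all4 by (simp_all add: w1_def wp_def wm_def w2_def w3_def)

lemma asd_normal:
  assumes "asd w"
  shows "w 1 0 = - w 0 1" "w 2 0 = - w 0 2" "w 3 0 = - w 0 3" "w 2 3 = - w 0 1" "w 3 2 = w 0 1"
    "w 3 1 = - w 0 2" "w 1 3 = w 0 2" "w 1 2 = - w 0 3" "w 2 1 = w 0 3" "w a a = 0"
proof -
  have a: "w a b = - w b a" for a b using assms unfolding asd_def by blast
  show "w 1 0 = - w 0 1" "w 2 0 = - w 0 2" "w 3 0 = - w 0 3" by (rule a)+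
  show r: "w 2 3 = - w 0 1" "w 3 1 = - w 0 2" "w 1 2 = - w 0 3"
    using assms unfolding asd_def by blast+
  show "w 3 2 = w 0 1" "w 1 3 = w 0 2" "w 2 1 = w 0 3" using a[of 3 2] a[of 1 3] a[of 2 1] r by simp_all
  show "w a a = 0" using a[of a a] by simp
qed

text \<open>For an anti-self-dual \<open>w\<close> the three-form v \<and> w is determined by the
  contraction of \<open>v\<close> with \<open>w\<close>. This turns exterior derivatives into
  codifferentials.\<close>

lemma asd_cyclic:
  assumes "asd w"
  shows "v a * w b c + v b * w c a + v c * w a b = (\<Sum>d\<in>UNIV. eps a b c d * (- (\<Sum>e\<in>UNIV. v e * w e d)))"
proof -
  have "\<forall>a b c. v a * w b c + v b * w c a + v c * w a b = (\<Sum>d\<in>UNIV. eps a b c d * (- (\<Sum>e\<in>UNIV. v e * w e d)))"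
    unfolding all4 by (simp add: sum4 eps_def cyc3_def asd_normal[OF assms])
  then show ?thesis by blast
qed

text \<open>An antisymmetric \<open>A\<close> is an infinitesimal rotation and annihilates the
  volume form; the term of the fourth slot stands on the right. Hence \<open>eps\<close> is parallel
  for any metric connection.\<close>

lemma eps_invariant:
  assumes A: "\<And>a b. A a b = - A b a"
  shows "(\<Sum>d\<in>UNIV. A a d * (\<Sum>e\<in>UNIV. eps d b c e * v e)) + (\<Sum>d\<in>UNIV. A b d * (\<Sum>e\<in>UNIV. eps a d c e * v e))
      + (\<Sum>d\<in>UNIV. A c d * (\<Sum>e\<in>UNIV. eps a b d e * v e))
    = (\<Sum>d\<in>UNIV. eps a b c d * (\<Sum>e\<in>UNIV. A d e * v e))"
proof -
  have diag: "A a a = 0" for a using A[of a a] by simp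
  note A' = A[of 1 0] A[of 2 0] A[of 3 0] A[of 2 1] A[of 3 1] A[of 3 2] diag
  have "\<forall>a b c. (\<Sum>d\<in>UNIV. A a d * (\<Sum>e\<in>UNIV. eps d b c e * v e)) + (\<Sum>d\<in>UNIV. A b d * (\<Sum>e\<in>UNIV. eps a d c e * v e))
      + (\<Sum>d\<in>UNIV. A c d * (\<Sum>e\<in>UNIV. eps a b d e * v e))
    = (\<Sum>d\<in>UNIV. eps a b c d * (\<Sum>e\<in>UNIV. A d e * v e))"
    unfolding all4 by (simp add: sum4 eps_def cyc3_def A' algebra_simps)
  then show ?thesis by blast
qed

section \<open>Gauge-covariant derivatives of charged functions\<close>

context adapted_frame
begin

text \<open>The form \<open>\<Sum>w\<^sub>a\<^sub>b h\<^sup>a h\<^sup>b\<close> satisfies \<open>\<nabla>w = \<i>k a w\<close>.\<close>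
definition charged :: "complex \<Rightarrow> (4 \<Rightarrow> 4 \<Rightarrow> complex) \<Rightarrow> bool" where
  "charged k w \<longleftrightarrow> (\<forall>x\<in>U. \<forall>m a b. (\<Sum>d\<in>UNIV. W m a d x * w d b) + (\<Sum>d\<in>UNIV. W m b d x * w a d)
     = \<i> * k * xi m x * w a b)"

text \<open>The equation (\<nabla> + i a) \<Omega>^+ = 0 gives \<Omega>^+ the charge -1, which is
  why its coefficient \<Phi>^- is acted on by the operator with k = -1.\<close>

lemma charged_w: "charged 0 w1" "charged (-1) wp" "charged 1 wm"
proof -
  show "charged 0 w1"
    unfolding charged_def all4 by (simp add: sum4 w1_def W_normal xi_def)
  show "charged (-1) wp"
    unfolding charged_def all4 by (simp add: sum4 wp_def w2_def w3_def W_normal xi_def field_simps)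
  show "charged 1 wm"
    unfolding charged_def all4 by (simp add: sum4 wm_def w2_def w3_def W_normal xi_def field_simps)
qed

definition theta :: "complex \<Rightarrow> (pt \<Rightarrow> complex) \<Rightarrow> 4 \<Rightarrow> pt \<Rightarrow> complex" where
  "theta k \<Psi> m x = pd m \<Psi> x + \<i> * k * xi m x * \<Psi> x"

definition thf :: "complex \<Rightarrow> (pt \<Rightarrow> complex) \<Rightarrow> 4 \<Rightarrow> pt \<Rightarrow> complex" where
  "thf k \<Psi> a x = (\<Sum>m\<in>UNIV. E a m x * theta k \<Psi> m x)"

definition Q :: "complex \<Rightarrow> (pt \<Rightarrow> complex) \<Rightarrow> 4 \<Rightarrow> 4 \<Rightarrow> pt \<Rightarrow> complex" where
  "Q k \<Psi> m a x = D1 (thf k \<Psi>) m a x + \<i> * k * xi m x * thf k \<Psi> a x"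

definition Qf :: "complex \<Rightarrow> (pt \<Rightarrow> complex) \<Rightarrow> 4 \<Rightarrow> 4 \<Rightarrow> pt \<Rightarrow> complex" where
  "Qf k \<Psi> a b x = (\<Sum>m\<in>UNIV. E a m x * Q k \<Psi> m b x)"

lemma theta_C1:
  assumes "Ck 2 U \<Psi>"
  shows "Ck 1 U (theta k \<Psi> m)"
proof -
  have "Ck 1 U (pd m \<Psi>)" "Ck 1 U \<Psi>"
    using assms Ck_Suc[of 1 U \<Psi>] by (simp_all add: numeral_2_eq_2)
  then have "Ck 1 U (\<lambda>x. pd m \<Psi> x + \<i> * k * xi m x * \<Psi> x)"
    by (intro Ck_add[OF open_U] Ck_mult[OF open_U] Ck_const xi_C1)
  then show ?thesis unfolding theta_def[abs_def] .
qed

lemma thf_C1: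
  assumes "Ck 2 U \<Psi>"
  shows "Ck 1 U (thf k \<Psi> a)"
proof -
  have "Ck 1 U (E a m)" for m using E_C2[of a m] Ck_Suc[of 1 U "E a m"] by (simp add: numeral_2_eq_2)
  then have "Ck 1 U (\<lambda>x. \<Sum>m\<in>UNIV. E a m x * theta k \<Psi> m x)"
    using theta_C1[OF assms] by (intro Ck_sum[OF open_U] Ck_mult[OF open_U]) auto
  then show ?thesis unfolding thf_def[abs_def] .
qed

lemma pdiff_thf: "Ck 2 U \<Psi> \<Longrightarrow> x \<in> U \<Longrightarrow> pdiff (thf k \<Psi> a) m x"
  using Ck_pdiff[OF thf_C1] by simp

lemma theta_expand: "x \<in> U \<Longrightarrow> theta k \<Psi> m x = (\<Sum>a\<in>UNIV. thf k \<Psi> a x * h a m x)"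
  unfolding thf_def by (rule expand_h)

lemma d1_frame:
  assumes x: "x \<in> U" and th: "\<And>y n. y \<in> U \<Longrightarrow> th y n = (\<Sum>a\<in>UNIV. t a y * h a n y)"
    and t: "\<And>a m. pdiff (t a) m x"
  shows "d1 th x m n = (\<Sum>a\<in>UNIV. \<Sum>b\<in>UNIV.
    ((\<Sum>l\<in>UNIV. E a l x * D1 t l b x) - (\<Sum>l\<in>UNIV. E b l x * D1 t l a x)) * h a m x * h b n x)"
proof -
  have c: "cov1 M am th x m n = (\<Sum>a\<in>UNIV. \<Sum>b\<in>UNIV. (\<Sum>l\<in>UNIV. E a l x * D1 t l b x) * h a m x * h b n x)" for m n
  proof -
    have "cov1 M am th x m n = (\<Sum>b\<in>UNIV. D1 t m b x * h b n x)"
      by (rule cov1_frame[OF x th t])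
    also have "\<dots> = (\<Sum>b\<in>UNIV. \<Sum>a\<in>UNIV. (\<Sum>l\<in>UNIV. E a l x * D1 t l b x) * h a m x * h b n x)"
      by (subst expand_h[OF x, of "\<lambda>m. D1 t m _ x" m]) (simp add: sum_distrib_right)
    finally show ?thesis by (subst sum.swap)
  qed
  have "cov1 M am th x n m = (\<Sum>a\<in>UNIV. \<Sum>b\<in>UNIV. (\<Sum>l\<in>UNIV. E b l x * D1 t l a x) * h a m x * h b n x)"
    unfolding c by (subst sum.swap) (simp add: ac_simps)
  then show ?thesis unfolding d1_cov1[OF x] c
    by (simp add: sum_subtractf left_diff_distrib)
qed

text \<open>The Levi-Civita part is torsion-free and partial derivatives commute, so the commutator
  of two gauge-covariant derivatives is only the curvature of the line bundle.\<close>

lemma Qf_commutator: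
  assumes x: "x \<in> U" and P: "Ck 2 U \<Psi>"
  shows "Qf k \<Psi> a b x - Qf k \<Psi> b a x = \<i> * k * dxi a b x * \<Psi> x"
proof -
  define v where "v y n = theta k \<Psi> n y" for y n
  define xf where "xf a = (\<Sum>m\<in>UNIV. E a m x * xi m x)" for a
  let ?D = "\<lambda>a b. \<Sum>l\<in>UNIV. E a l x * D1 (thf k \<Psi>) l b x"
  have Qf: "Qf k \<Psi> a b x = ?D a b + \<i> * k * xf a * thf k \<Psi> b x" for a b
    by (simp add: Qf_def Q_def xf_def distrib_left sum.distrib sum_distrib_left sum_distrib_right ac_simps)
  have P1: "Ck 1 U \<Psi>" using P Ck_Suc[of 1 U \<Psi>] by (simp add: numeral_2_eq_2)
  have p: "pdiff \<Psi> i x" "pdiff (xi j) i x" "pdiff (pd j \<Psi>) i x" for i j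
    using Ck_pdiff[OF P1 _ x] Ck_pdiff[OF xi_C1 _ x] P x by (simp_all add: numeral_2_eq_2)
  have pv: "pd m (\<lambda>y. v y n) x = pd m (pd n \<Psi>) x + \<i> * k * (xi n x * pd m \<Psi> x + pd m (xi n) x * \<Psi> x)" for m n
    unfolding v_def theta_def mult.assoc by (simp add: p pd_add pd_mult pdiff_mult pd_cmult pdiff_cmult)
  \<comment> \<open>The terms with \<open>xi\<close> times \<open>theta\<close> are those that
    \<open>Qf\<close> contributes with the opposite sign; they cancel in the last step.\<close>
  have d: "d1 v x m n = \<i> * k * (pd m (xi n) x - pd n (xi m) x) * \<Psi> x
      + \<i> * k * (xi n x * theta k \<Psi> m x - xi m x * theta k \<Psi> n x)" for m n
    unfolding d1_def pv pd_commute[OF open_U x P, of m n] theta_def by (simp add: algebra_simps)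
  have dv: "d1 v x m n = (\<Sum>a\<in>UNIV. \<Sum>b\<in>UNIV. (?D a b - ?D b a) * h a m x * h b n x)" for m n
  proof (rule d1_frame[OF x _ pdiff_thf[OF P x]])
    show "v y n = (\<Sum>a\<in>UNIV. thf k \<Psi> a y * h a n y)" if "y \<in> U" for y n
      unfolding v_def by (rule theta_expand[OF that])
  qed
  have "?D a b - ?D b a = (\<Sum>m\<in>UNIV. \<Sum>n\<in>UNIV. E a m x * E b n x * d1 v x m n)"
    unfolding dv by (rule contract_h2[OF x, symmetric])
  also have "\<dots> = \<i> * k * dxi a b x * \<Psi> x + \<i> * k * (xf b * thf k \<Psi> a x - xf a * thf k \<Psi> b x)"
  proof -
    have "(\<Sum>m\<in>UNIV. \<Sum>n\<in>UNIV. E a m x * E b n x * (\<i> * k * (pd m (xi n) x - pd n (xi m) x) * \<Psi> x))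
       = \<i> * k * dxi a b x * \<Psi> x"
      by (simp add: dxi_def sum_distrib_left sum_distrib_right ac_simps)
    moreover have "(\<Sum>m\<in>UNIV. \<Sum>n\<in>UNIV. E a m x * E b n x * (\<i> * k * (xi n x * theta k \<Psi> m x)))
       = \<i> * k * (xf b * thf k \<Psi> a x)"
      unfolding xf_def thf_def sum_product unfolding sum_distrib_left by (subst sum.swap) (simp add: ac_simps)
    moreover have "(\<Sum>m\<in>UNIV. \<Sum>n\<in>UNIV. E a m x * E b n x * (\<i> * k * (xi m x * theta k \<Psi> n x)))
       = \<i> * k * (xf a * thf k \<Psi> b x)"
      unfolding xf_def thf_def sum_product unfolding sum_distrib_left by (simp add: ac_simps)
    ultimately show ?thesis unfolding d
      by (simp add: distrib_left right_diff_distrib sum.distrib sum_subtractf)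
  qed
  finally show ?thesis unfolding Qf by (simp add: algebra_simps)
qed

text \<open>The one-form \<open>v\<close> is tied to \<open>theta\<close> only on \<open>U\<close>:
  in \<open>Ok\<close> it contains \<open>aform\<close>, whose value is known only there.\<close>

lemma trace_Qf:
  assumes x: "x \<in> U" and P: "Ck 2 U \<Psi>" and v: "\<And>y n. y \<in> U \<Longrightarrow> v y n = theta k \<Psi> n y"
  shows "(\<Sum>l\<in>UNIV. \<Sum>m\<in>UNIV. ginv M am x l m * (cov1 M am v x m l + \<i> * k * xi m x * v x l))
    = (\<Sum>a\<in>UNIV. Qf k \<Psi> a a x)"
proof -
  have v': "v y n = (\<Sum>a\<in>UNIV. thf k \<Psi> a y * h a n y)" if "y \<in> U" for y n
    using v[OF that] theta_expand[OF that] by simp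
  have c: "cov1 M am v x m l = (\<Sum>a\<in>UNIV. D1 (thf k \<Psi>) m a x * h a l x)" for m l
    by (rule cov1_frame[OF x v' pdiff_thf[OF P x]])
  have "cov1 M am v x m l + \<i> * k * xi m x * v x l = (\<Sum>a\<in>UNIV. Q k \<Psi> m a x * h a l x)" for m l
    unfolding c v'[OF x]
    by (simp add: Q_def distrib_left sum.distrib sum_distrib_left mult.commute mult.left_commute)
  then show ?thesis by (simp add: ginv_trace[OF x] Qf_def)
qed

text \<open>Since \<open>w\<close> is parallel up to its charge, contraction with \<open>w\<close>
  commutes with covariant differentiation once the charge term is added to the derivative of
  \<open>v\<close>.\<close>

lemma gauge_transfer:
  assumes x: "x \<in> U" and w: "charged k w"
  shows "(\<Sum>c\<in>UNIV. W m b c x * (\<Sum>a\<in>UNIV. v a * w a c))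
    = (\<Sum>a\<in>UNIV. ((\<Sum>d\<in>UNIV. W m a d x * v d) + \<i> * k * xi m x * v a) * w a b)"
proof -
  have w': "(\<Sum>c\<in>UNIV. W m b c x * w a c) = \<i> * k * xi m x * w a b - (\<Sum>d\<in>UNIV. W m a d x * w d b)" for a
  proof -
    have "(\<Sum>d\<in>UNIV. W m a d x * w d b) + (\<Sum>d\<in>UNIV. W m b d x * w a d) = \<i> * k * xi m x * w a b"
      using w x unfolding charged_def by blast
    then show ?thesis by (simp add: eq_diff_eq add.commute)
  qed
  have "(\<Sum>c\<in>UNIV. W m b c x * (\<Sum>a\<in>UNIV. v a * w a c)) = (\<Sum>a\<in>UNIV. v a * (\<Sum>c\<in>UNIV. W m b c x * w a c))"
    unfolding sum_distrib_left by (subst sum.swap) (simp add: ac_simps)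
  also have "\<dots> = (\<Sum>a\<in>UNIV. \<i> * k * xi m x * v a * w a b) - (\<Sum>a\<in>UNIV. \<Sum>d\<in>UNIV. v a * W m a d x * w d b)"
    unfolding w' by (simp add: right_diff_distrib sum_subtractf sum_distrib_left ac_simps)
  also have "(\<Sum>a\<in>UNIV. \<Sum>d\<in>UNIV. v a * W m a d x * w d b) = - (\<Sum>d\<in>UNIV. (\<Sum>a\<in>UNIV. W m d a x * v a) * w d b)"
  proof -
    have "v a * W m a d x * w d b = - (W m d a x * v a * w d b)" for a d
      using W_antisym[OF x, of m a d] by simp
    then have "(\<Sum>a\<in>UNIV. \<Sum>d\<in>UNIV. v a * W m a d x * w d b) = (\<Sum>a\<in>UNIV. \<Sum>d\<in>UNIV. - (W m d a x * v a * w d b))"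
      by (simp only:)
    also have "\<dots> = (\<Sum>d\<in>UNIV. \<Sum>a\<in>UNIV. - (W m d a x * v a * w d b))" by (rule sum.swap)
    finally show ?thesis by (simp add: sum_negf sum_distrib_right)
  qed
  finally show ?thesis by (simp add: distrib_right sum.distrib)
qed

lemma del2_frame:
  assumes x: "x \<in> U"
    and B: "\<And>y r s. y \<in> U \<Longrightarrow> B y r s = (\<Sum>a\<in>UNIV. \<Sum>b\<in>UNIV. t a b y * h a r y * h b s y)"
    and t: "\<And>a b m. pdiff (t a b) m x"
  shows "del2 M am B x n = (\<Sum>b\<in>UNIV. (- (\<Sum>a\<in>UNIV. \<Sum>m\<in>UNIV. E a m x * D2 t m a b x)) * h b n x)"
proof -
  have c: "cov2 M am B x l m n = (\<Sum>a\<in>UNIV. \<Sum>b\<in>UNIV. D2 t l a b x * h a m x * h b n x)" for l m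
    by (rule cov2_frame[OF x B t])
  have "cov2 M am B x l m n = (\<Sum>a\<in>UNIV. (\<Sum>b\<in>UNIV. D2 t l a b x * h b n x) * h a m x)" for l m
    unfolding c by (simp add: sum_distrib_right sum_distrib_left ac_simps)
  then have "del2 M am B x n = - (\<Sum>a\<in>UNIV. \<Sum>m\<in>UNIV. E a m x * (\<Sum>b\<in>UNIV. D2 t m a b x * h b n x))"
    by (simp only: del2_def ginv_trace[OF x])
  also have "\<dots> = - (\<Sum>a\<in>UNIV. \<Sum>m\<in>UNIV. \<Sum>b\<in>UNIV. E a m x * D2 t m a b x * h b n x)"
    by (simp add: sum_distrib_left ac_simps)
  also have "\<dots> = - (\<Sum>b\<in>UNIV. \<Sum>a\<in>UNIV. \<Sum>m\<in>UNIV. E a m x * D2 t m a b x * h b n x)"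
    by (subst sum_swap3) simp
  finally show ?thesis by (simp add: sum_distrib_right sum_negf)
qed

end

section \<open>Codifferential, exterior derivative and Laplacian of a sum of charged forms\<close>

locale charged_sum = adapted_frame +
  fixes J :: "nat set" and k :: "nat \<Rightarrow> complex" and w :: "nat \<Rightarrow> 4 \<Rightarrow> 4 \<Rightarrow> complex"
    and \<Psi> :: "nat \<Rightarrow> pt \<Rightarrow> complex" and B :: "pt \<Rightarrow> 4 \<Rightarrow> 4 \<Rightarrow> complex"
  assumes fin: "finite J"
    and w_charged: "j \<in> J \<Longrightarrow> charged (k j) (w j)"
    and w_asd: "j \<in> J \<Longrightarrow> asd (w j)"
    and \<Psi>_C2: "Ck 2 U (\<Psi> j)"
    and B_sum: "y \<in> U \<Longrightarrow> B y r s = (\<Sum>a\<in>UNIV. \<Sum>b\<in>UNIV. (\<Sum>j\<in>J. \<Psi> j y * w j a b) * h a r y * h b s y)"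
begin

definition beta :: "4 \<Rightarrow> pt \<Rightarrow> complex" where
  "beta b y = - (\<Sum>j\<in>J. \<Sum>a\<in>UNIV. thf (k j) (\<Psi> j) a y * w j a b)"

lemma D2_sum:
  assumes y: "y \<in> U"
  shows "D2 (\<lambda>a b y. \<Sum>j\<in>J. \<Psi> j y * w j a b) m a b y = (\<Sum>j\<in>J. theta (k j) (\<Psi> j) m y * w j a b)"
proof -
  have p: "pdiff (\<Psi> j) m y" for j using Ck_pdiff[OF \<Psi>_C2 _ y] by simp
  have "D2 (\<lambda>a b y. \<Sum>j\<in>J. \<Psi> j y * w j a b) m a b y
     = (\<Sum>j\<in>J. pd m (\<Psi> j) y * w j a b)
      + (\<Sum>j\<in>J. \<Psi> j y * ((\<Sum>d\<in>UNIV. W m a d y * w j d b) + (\<Sum>d\<in>UNIV. W m b d y * w j a d)))"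
  proof -
    have 1: "pd m (\<lambda>y. \<Sum>j\<in>J. \<Psi> j y * w j a b) y = (\<Sum>j\<in>J. pd m (\<Psi> j) y * w j a b)"
      using p by (simp add: pd_sum fin pdiff_mult pdiff_const pd_mult pd_const)
    have 2: "(\<Sum>d\<in>UNIV. W m a d y * (\<Sum>j\<in>J. \<Psi> j y * w j d b)) = (\<Sum>j\<in>J. \<Psi> j y * (\<Sum>d\<in>UNIV. W m a d y * w j d b))"
      unfolding sum_distrib_left by (subst sum.swap) (simp add: ac_simps)
    have 3: "(\<Sum>d\<in>UNIV. W m b d y * (\<Sum>j\<in>J. \<Psi> j y * w j a d)) = (\<Sum>j\<in>J. \<Psi> j y * (\<Sum>d\<in>UNIV. W m b d y * w j a d))"
      unfolding sum_distrib_left by (subst sum.swap) (simp add: ac_simps)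
    show ?thesis unfolding D2_def 1 2 3 by (simp add: distrib_left sum.distrib)
  qed
  also have "(\<Sum>j\<in>J. \<Psi> j y * ((\<Sum>d\<in>UNIV. W m a d y * w j d b) + (\<Sum>d\<in>UNIV. W m b d y * w j a d)))
      = (\<Sum>j\<in>J. \<i> * k j * xi m y * \<Psi> j y * w j a b)"
    using w_charged y by (intro sum.cong refl) (simp add: charged_def)
  finally show ?thesis by (simp add: theta_def distrib_right sum.distrib)
qed

lemma pdiff_coeff: "y \<in> U \<Longrightarrow> pdiff (\<lambda>y. \<Sum>j\<in>J. \<Psi> j y * w j a b) m y"
  using Ck_pdiff[OF \<Psi>_C2] fin by (intro pdiff_sum pdiff_mult pdiff_const) auto

lemma del2_beta:
  assumes y: "y \<in> U"
  shows "del2 M am B y n = (\<Sum>b\<in>UNIV. beta b y * h b n y)"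
proof -
  have "(\<Sum>a\<in>UNIV. \<Sum>m\<in>UNIV. E a m y * (\<Sum>j\<in>J. theta (k j) (\<Psi> j) m y * w j a b)) = - beta b y" for b
  proof -
    have "(\<Sum>a\<in>UNIV. \<Sum>m\<in>UNIV. E a m y * (\<Sum>j\<in>J. theta (k j) (\<Psi> j) m y * w j a b))
        = (\<Sum>a\<in>UNIV. \<Sum>m\<in>UNIV. \<Sum>j\<in>J. E a m y * theta (k j) (\<Psi> j) m y * w j a b)"
      by (simp add: sum_distrib_left ac_simps)
    also have "\<dots> = (\<Sum>j\<in>J. \<Sum>a\<in>UNIV. \<Sum>m\<in>UNIV. E a m y * theta (k j) (\<Psi> j) m y * w j a b)"
      by (rule sum_swap3)
    finally show ?thesis by (simp add: beta_def thf_def sum_distrib_right)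
  qed
  moreover have "del2 M am B y n = (\<Sum>b\<in>UNIV. (- (\<Sum>a\<in>UNIV. \<Sum>m\<in>UNIV.
      E a m y * D2 (\<lambda>a b y. \<Sum>j\<in>J. \<Psi> j y * w j a b) m a b y)) * h b n y)"
    by (rule del2_frame[OF y B_sum pdiff_coeff[OF y]])
  ultimately show ?thesis unfolding D2_sum[OF y] by simp
qed

lemma pdiff_beta: "y \<in> U \<Longrightarrow> pdiff (beta b) m y"
  unfolding beta_def[abs_def] using pdiff_thf[OF \<Psi>_C2] fin
  by (intro pdiff_minus pdiff_sum pdiff_mult pdiff_const) auto

lemma D1_beta:
  assumes x: "x \<in> U"
  shows "D1 beta m b x = - (\<Sum>j\<in>J. \<Sum>a\<in>UNIV. Q (k j) (\<Psi> j) m a x * w j a b)"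
proof -
  have p: "pdiff (thf (k j) (\<Psi> j) a) m x" for j a by (rule pdiff_thf[OF \<Psi>_C2 x])
  have 1: "pd m (beta b) x = - (\<Sum>j\<in>J. \<Sum>a\<in>UNIV. pd m (thf (k j) (\<Psi> j) a) x * w j a b)"
    unfolding beta_def[abs_def]
    by (simp add: pd_minus pd_sum fin pdiff_sum pdiff_mult pdiff_const pd_mult pd_const p)
  have "(\<Sum>c\<in>UNIV. W m b c x * beta c x)
     = - (\<Sum>j\<in>J. \<Sum>c\<in>UNIV. W m b c x * (\<Sum>a\<in>UNIV. thf (k j) (\<Psi> j) a x * w j a c))"
    unfolding beta_def by (subst sum.swap) (simp add: sum_distrib_left sum_negf)
  also have "\<dots> = - (\<Sum>j\<in>J. \<Sum>a\<in>UNIV. ((\<Sum>d\<in>UNIV. W m a d x * thf (k j) (\<Psi> j) d x)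
      + \<i> * k j * xi m x * thf (k j) (\<Psi> j) a x) * w j a b)"
    using gauge_transfer[OF x w_charged] by simp
  finally show ?thesis unfolding D1_def[of beta] 1
    by (simp add: Q_def D1_def distrib_right sum.distrib)
qed

definition G :: "4 \<Rightarrow> 4 \<Rightarrow> pt \<Rightarrow> complex" where
  "G a b x = - (\<Sum>j\<in>J. \<Sum>c\<in>UNIV. Qf (k j) (\<Psi> j) a c x * w j c b)"

lemma frame_D1_beta:
  assumes x: "x \<in> U"
  shows "(\<Sum>l\<in>UNIV. E a l x * D1 beta l b x) = G a b x"
proof -
  have "(\<Sum>l\<in>UNIV. E a l x * D1 beta l b x)
      = - (\<Sum>l\<in>UNIV. \<Sum>j\<in>J. \<Sum>c\<in>UNIV. E a l x * Q (k j) (\<Psi> j) l c x * w j c b)"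
    unfolding D1_beta[OF x] by (simp add: sum_distrib_left sum_negf ac_simps)
  also have "\<dots> = - (\<Sum>j\<in>J. \<Sum>c\<in>UNIV. \<Sum>l\<in>UNIV. E a l x * Q (k j) (\<Psi> j) l c x * w j c b)"
    by (subst (2) sum_swap3) simp
  finally show ?thesis by (simp add: G_def Qf_def sum_distrib_right)
qed

lemma d1_del2:
  assumes x: "x \<in> U"
  shows "d1 (del2 M am B) x m n = (\<Sum>a\<in>UNIV. \<Sum>b\<in>UNIV. (G a b x - G b a x) * h a m x * h b n x)"
  unfolding frame_D1_beta[OF x, symmetric] by (rule d1_frame[OF x del2_beta pdiff_beta[OF x]])

text \<open>Each summand has covariant derivative \<open>theta\<close> tensor \<open>w\<close>,
  hence exterior derivative theta \<and> w, and \<open>asd_cyclic\<close> rewrites this by the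
  codifferential. So the exterior derivative of \<open>B\<close> is the dual of
  \<open>beta\<close>.\<close>

lemma d2_beta:
  assumes y: "y \<in> U"
  shows "d2 B y r s q = (\<Sum>a\<in>UNIV. \<Sum>b\<in>UNIV. \<Sum>c\<in>UNIV. (\<Sum>d\<in>UNIV. eps a b c d * beta d y) * h a r y * h b s y * h c q y)"
proof -
  define S where "S a b c = (\<Sum>j\<in>J. thf (k j) (\<Psi> j) a y * w j b c)" for a b c
  have anti: "B y r s = - B y s r" for r s
  proof -
    have w: "\<Psi> j y * w j a b = - (\<Psi> j y * w j b a)" if "j \<in> J" for j a b
    proof -
      have "w j a b = - w j b a" using w_asd[OF that] unfolding asd_def by blast
      then show ?thesis by simp
    qed
    have "(\<Sum>j\<in>J. \<Psi> j y * w j a b) * h a r y * h b s y = - ((\<Sum>j\<in>J. \<Psi> j y * w j b a) * h b s y * h a r y)" for a b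
    proof -
      have "(\<Sum>j\<in>J. \<Psi> j y * w j a b) = (\<Sum>j\<in>J. - (\<Psi> j y * w j b a))"
        by (rule sum.cong[OF refl w])
      also have "\<dots> = - (\<Sum>j\<in>J. \<Psi> j y * w j b a)" by (rule sum_negf)
      finally show ?thesis by simp
    qed
    then have "B y r s = (\<Sum>a\<in>UNIV. \<Sum>b\<in>UNIV. - ((\<Sum>j\<in>J. \<Psi> j y * w j b a) * h b s y * h a r y))"
      unfolding B_sum[OF y] by (simp only:)
    also have "\<dots> = (\<Sum>b\<in>UNIV. \<Sum>a\<in>UNIV. - ((\<Sum>j\<in>J. \<Psi> j y * w j b a) * h b s y * h a r y))"
      by (rule sum.swap)
    finally show ?thesis unfolding B_sum[OF y] by (simp add: sum_negf)
  qed
  have c: "cov2 M am B y r s q = (\<Sum>a\<in>UNIV. \<Sum>b\<in>UNIV. \<Sum>c\<in>UNIV. S a b c * h a r y * h b s y * h c q y)" for r s q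
  proof -
    have D: "D2 (\<lambda>a b y. \<Sum>j\<in>J. \<Psi> j y * w j a b) r b c y = (\<Sum>a\<in>UNIV. S a b c * h a r y)" for b c
      unfolding D2_sum[OF y] S_def theta_expand[OF y] sum_distrib_right
      by (subst sum.swap) (simp add: ac_simps)
    have "cov2 M am B y r s q = (\<Sum>b\<in>UNIV. \<Sum>c\<in>UNIV. \<Sum>a\<in>UNIV. S a b c * h a r y * h b s y * h c q y)"
    proof -
      have "cov2 M am B y r s q = (\<Sum>b\<in>UNIV. \<Sum>c\<in>UNIV. D2 (\<lambda>a b y. \<Sum>j\<in>J. \<Psi> j y * w j a b) r b c y * h b s y * h c q y)"
        by (rule cov2_frame[OF y B_sum pdiff_coeff[OF y]])
      then show ?thesis unfolding D by (simp add: sum_distrib_right)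
    qed
    then show ?thesis by (subst (asm) sum_swap3)
  qed
  have "d2 B y r s q = (\<Sum>a\<in>UNIV. \<Sum>b\<in>UNIV. \<Sum>c\<in>UNIV. (S a b c + S b c a + S c a b) * h a r y * h b s y * h c q y)"
  proof -
    have 2: "cov2 M am B y s q r = (\<Sum>a\<in>UNIV. \<Sum>b\<in>UNIV. \<Sum>c\<in>UNIV. S b c a * h a r y * h b s y * h c q y)"
      unfolding c by (subst sum_swap3) (simp add: ac_simps)
    have 3: "cov2 M am B y q r s = (\<Sum>a\<in>UNIV. \<Sum>b\<in>UNIV. \<Sum>c\<in>UNIV. S c a b * h a r y * h b s y * h c q y)"
      unfolding c by (subst (2) sum_swap3) (simp add: ac_simps)
    show ?thesis unfolding d2_cov2[of y B, OF y anti] c[of r s q] 2 3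
      by (simp add: sum.distrib distrib_right)
  qed
  moreover have "S a b c + S b c a + S c a b = (\<Sum>d\<in>UNIV. eps a b c d * beta d y)" for a b c
  proof -
    have "S a b c + S b c a + S c a b = (\<Sum>j\<in>J. \<Sum>d\<in>UNIV. eps a b c d * (- (\<Sum>e\<in>UNIV. thf (k j) (\<Psi> j) e y * w j e d)))"
      unfolding S_def sum.distrib[symmetric] by (intro sum.cong refl asd_cyclic w_asd)
    also have "\<dots> = (\<Sum>d\<in>UNIV. \<Sum>j\<in>J. eps a b c d * (- (\<Sum>e\<in>UNIV. thf (k j) (\<Psi> j) e y * w j e d)))"
      by (rule sum.swap)
    finally show ?thesis by (simp add: beta_def sum_distrib_left sum_negf)
  qed
  ultimately show ?thesis by (simp only:)
qed

text \<open>Because \<open>eps\<close> is parallel, the divergence of the dual of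
  \<open>beta\<close> is the dual of the gradient of \<open>beta\<close>, and only the antisymmetric
  part of that gradient survives.\<close>

lemma del3_d2:
  assumes x: "x \<in> U"
  shows "del3 M am (d2 B) x m n = (\<Sum>a\<in>UNIV. \<Sum>b\<in>UNIV. (- dual (\<lambda>a b. G a b x - G b a x) a b) * h a m x * h b n x)"
proof -
  let ?t = "\<lambda>a b c y. \<Sum>d\<in>UNIV. eps a b c d * beta d y"
  have p: "pdiff (?t a b c) m x" for a b c m
    using pdiff_beta[OF x] by (intro pdiff_sum pdiff_mult pdiff_const) auto
  have D: "D3 ?t l a b c x = (\<Sum>d\<in>UNIV. eps a b c d * D1 beta l d x)" for l a b c
  proof -
    have "pd l (?t a b c) x = (\<Sum>d\<in>UNIV. eps a b c d * pd l (beta d) x)"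
      by (simp add: pd_sum pdiff_mult pdiff_const pd_mult pd_const pdiff_beta[OF x])
    then show ?thesis
      using eps_invariant[of "\<lambda>a b. W l a b x" a b c "\<lambda>d. beta d x", OF W_antisym[OF x]]
      by (simp add: D3_def D1_def distrib_left sum.distrib add.assoc)
  qed
  have c: "cov3 M am (d2 B) x l r m n = (\<Sum>a\<in>UNIV. \<Sum>b\<in>UNIV. \<Sum>c\<in>UNIV. D3 ?t l a b c x * h a r x * h b m x * h c n x)" for l r
    by (rule cov3_frame[OF x d2_beta p])
  have "cov3 M am (d2 B) x l r m n = (\<Sum>a\<in>UNIV. (\<Sum>b\<in>UNIV. \<Sum>c\<in>UNIV. D3 ?t l a b c x * h b m x * h c n x) * h a r x)" for l r
    unfolding c by (simp add: sum_distrib_right sum_distrib_left ac_simps)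
  then have "del3 M am (d2 B) x m n
     = - (\<Sum>a\<in>UNIV. \<Sum>l\<in>UNIV. E a l x * (\<Sum>b\<in>UNIV. \<Sum>c\<in>UNIV. D3 ?t l a b c x * h b m x * h c n x))"
    by (simp only: del3_def ginv_trace[OF x])
  also have "\<dots> = - (\<Sum>a\<in>UNIV. \<Sum>b\<in>UNIV. \<Sum>c\<in>UNIV. (\<Sum>d\<in>UNIV. eps a b c d * G a d x) * h b m x * h c n x)"
  proof -
    have "(\<Sum>l\<in>UNIV. E a l x * (\<Sum>b\<in>UNIV. \<Sum>c\<in>UNIV. D3 ?t l a b c x * h b m x * h c n x))
       = (\<Sum>b\<in>UNIV. \<Sum>c\<in>UNIV. (\<Sum>d\<in>UNIV. eps a b c d * G a d x) * h b m x * h c n x)" for a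
    proof -
      have e: "(\<Sum>l\<in>UNIV. E a l x * D3 ?t l a b c x) = (\<Sum>d\<in>UNIV. eps a b c d * G a d x)" for b c
        unfolding D frame_D1_beta[OF x, symmetric] sum_distrib_left by (subst sum.swap) (simp add: ac_simps)
      have "(\<Sum>l\<in>UNIV. E a l x * (\<Sum>b\<in>UNIV. \<Sum>c\<in>UNIV. D3 ?t l a b c x * h b m x * h c n x))
         = (\<Sum>l\<in>UNIV. \<Sum>b\<in>UNIV. \<Sum>c\<in>UNIV. E a l x * D3 ?t l a b c x * h b m x * h c n x)"
        by (simp only: sum_distrib_left mult.assoc)
      also have "\<dots> = (\<Sum>b\<in>UNIV. \<Sum>c\<in>UNIV. \<Sum>l\<in>UNIV. E a l x * D3 ?t l a b c x * h b m x * h c n x)"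
        by (subst (2) sum_swap3) simp
      finally show ?thesis by (simp only: e[symmetric] sum_distrib_right)
    qed
    then show ?thesis by simp
  qed
  also have "\<dots> = - (\<Sum>b\<in>UNIV. \<Sum>c\<in>UNIV. (\<Sum>a\<in>UNIV. \<Sum>d\<in>UNIV. eps a b c d * G a d x) * h b m x * h c n x)"
    unfolding sum_distrib_right neg_equal_iff_equal by (rule sum_swap3[symmetric])
  finally have "del3 M am (d2 B) x m n
     = - (\<Sum>b\<in>UNIV. \<Sum>c\<in>UNIV. (\<Sum>a\<in>UNIV. \<Sum>d\<in>UNIV. eps a b c d * G a d x) * h b m x * h c n x)" .
  \<comment> \<open>Moving the index \<open>a\<close> past \<open>b\<close> and \<open>c\<close> is
    an even permutation; the factor 1/2 in \<open>dual\<close> is made up for by the two terms of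
    the antisymmetrisation.\<close>
  moreover have "(\<Sum>a\<in>UNIV. \<Sum>d\<in>UNIV. eps a b c d * G a d x) = dual (\<lambda>a b. G a b x - G b a x) b c" for b c
  proof -
    have "\<forall>b c. (\<Sum>a\<in>UNIV. \<Sum>d\<in>UNIV. eps a b c d * g a d) = dual (\<lambda>a b. g a b - g b a) b c" for g :: "4 \<Rightarrow> 4 \<Rightarrow> complex"
      unfolding all4 by (simp add: dual_def sum4 eps_def cyc3_def)
    from this[of "\<lambda>a b. G a b x"] show ?thesis by blast
  qed
  ultimately show ?thesis by (simp add: sum_negf)
qed

end

section \<open>Algebra of the anti-self-dual projection\<close>

lemma asd_lincomb:
  assumes "asd u" "asd v" "asd w"
  shows "asd (\<lambda>a b. p * u a b + q * v a b + r * w a b)"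
  unfolding asd_def
proof (intro conjI allI)
  fix a b
  have "u a b = - u b a" "v a b = - v b a" "w a b = - w b a"
    using assms unfolding asd_def by blast+
  then show "p * u a b + q * v a b + r * w a b = - (p * u b a + q * v b a + r * w b a)" by simp
qed (simp_all add: asd_normal[OF assms(1)] asd_normal[OF assms(2)] asd_normal[OF assms(3)])

lemma dual_asd:
  assumes "asd w"
  shows "dual w a b = - w a b"
proof -
  have "\<forall>a b. dual w a b = - w a b"
    unfolding all4 by (simp add: dual_def sum4 eps_def cyc3_def asd_normal[OF assms])
  then show ?thesis by blast
qed

lemma asd_dual_part:
  assumes t: "\<And>a b. t a b = - t b a"
  shows "asd (\<lambda>a b. (t a b - dual t a b) / 2)"
proof -
  have diag: "t a a = 0" for a using t[of a a] by simp
  note t' = t[of 1 0] t[of 2 0] t[of 3 0] t[of 2 1] t[of 1 3] t[of 3 2] diag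
  show ?thesis
    unfolding asd_def all4 by (simp add: dual_def sum4 eps_def cyc3_def t' field_simps)
qed

text \<open>In the basis \<open>w1\<close>, \<open>w2\<close>, \<open>w3\<close> the coefficients
  are the entries 01, 02, 03; the complex ones come from solving for \<open>w2\<close> and
  \<open>w3\<close> in terms of \<open>wp\<close> and \<open>wm\<close>.\<close>

lemma asd_expand:
  assumes "asd u"
  shows "u a b = u 0 1 * w1 a b + ((u 0 2 - \<i> * u 0 3) / complex_of_real (sqrt 2)) * wp a b
    + ((u 0 2 + \<i> * u 0 3) / complex_of_real (sqrt 2)) * wm a b"
proof -
  have s2: "complex_of_real (sqrt 2) * complex_of_real (sqrt 2) = 2"
    by (simp flip: of_real_mult)
  have "(p / complex_of_real (sqrt 2)) * (q / complex_of_real (sqrt 2)) = p * q / 2" for p q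
    using s2 by simp
  \<comment> \<open>Two factors 1/sqrt 2 are merged into 1/2 beforehand, so that the case check
    contains no square root.\<close>
  then have r: "(p / complex_of_real (sqrt 2)) * ((c + d) / complex_of_real (sqrt 2)) = p * (c + d) / 2"
    "(p / complex_of_real (sqrt 2)) * ((c - d) / complex_of_real (sqrt 2)) = p * (c - d) / 2" for p c d
    by blast+
  have "\<forall>a b. u a b = u 0 1 * w1 a b + (u 0 2 - \<i> * u 0 3) * (w2 a b + \<i> * w3 a b) / 2
    + (u 0 2 + \<i> * u 0 3) * (w2 a b - \<i> * w3 a b) / 2"
    unfolding all4 by (simp add: w1_def w2_def w3_def asd_normal[OF assms] field_simps)
  then show ?thesis unfolding wp_def wm_def r by blast
qed

text \<open>The contribution of one charged summand to d\<delta>A, with \<open>q\<close> its second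
  gauge-covariant derivative. For antisymmetric \<open>w\<close> it is minus the anticommutator of
  \<open>w\<close> with the symmetric part of \<open>q\<close> and minus the commutator with the
  antisymmetric part.\<close>

definition rot :: "(4 \<Rightarrow> 4 \<Rightarrow> complex) \<Rightarrow> (4 \<Rightarrow> 4 \<Rightarrow> complex) \<Rightarrow> 4 \<Rightarrow> 4 \<Rightarrow> complex" where
  "rot q w a b = - (\<Sum>c\<in>UNIV. q a c * w c b) + (\<Sum>c\<in>UNIV. q b c * w c a)"

text \<open>The anticommutator of a trace-free symmetric matrix with an anti-self-dual one is
  self-dual, so only the trace of \<open>q\<close> passes the projection.\<close>

lemma asd_rot_w1:
  assumes q: "\<And>a b. q a b = q b a"
  shows "rot q w1 a b - dual (rot q w1) a b = - (\<Sum>c\<in>UNIV. q c c) * w1 a b"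
proof -
  note q' = q[of 1 0] q[of 2 0] q[of 3 0] q[of 2 1] q[of 1 3] q[of 3 2]
  have "\<forall>a b. rot q w1 a b - dual (rot q w1) a b = - (\<Sum>c\<in>UNIV. q c c) * w1 a b"
    unfolding all4 by (simp add: rot_def dual_def sum4 eps_def cyc3_def w1_def q' algebra_simps)
  then show ?thesis by blast
qed

text \<open>\<open>e = 1\<close> gives \<open>wp\<close> and \<open>e = -1\<close> gives
  \<open>wm\<close>, with charge \<open>- e\<close>. Beyond the trace, the commutator with
  \<open>f\<close> contributes. The self-dual part of \<open>f\<close> commutes with
  \<open>w\<close>, the type conditions reduce the rest to a multiple of \<open>w1\<close>, and w2 +
  i e w3 is an eigenvector of the commutator with \<open>w1\<close>. Its eigenvalue is proportional
  to \<open>e\<close>, so with the factor \<open>e\<close> in \<open>q\<close> the potential does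
  not depend on the sign.\<close>

lemma asd_rot_wpm:
  fixes c e P :: complex and q f :: "4 \<Rightarrow> 4 \<Rightarrow> complex"
  assumes q: "\<And>a b. q a b - q b a = - \<i> * e * f a b * P"
    and f: "f 0 2 = f 3 1" "f 0 3 = f 1 2" and e: "e * e = 1"
  defines "w \<equiv> \<lambda>a b. c * (w2 a b + \<i> * e * w3 a b)"
  shows "rot q w a b - dual (rot q w) a b = (- (\<Sum>c\<in>UNIV. q c c) + (f 0 1 - f 2 3) * P) * w a b"
proof -
  have q': "q a b = q b a - \<i> * e * f a b * P" for a b
    using q[of a b] by (simp add: algebra_simps)
  have f': "f 3 1 = f 0 2" "f 1 2 = f 0 3" using f by simp_all
  note qs = q'[of 0 1] q'[of 0 2] q'[of 0 3] q'[of 1 2] q'[of 3 1] q'[of 2 3]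
  have ee: "e * (e * z) = z" for z using e by (simp add: mult.assoc[symmetric])
  have "\<forall>a b. rot q w a b - dual (rot q w) a b = (- (\<Sum>c\<in>UNIV. q c c) + (f 0 1 - f 2 3) * P) * w a b"
    unfolding all4
    by (simp add: rot_def dual_def sum4 eps_def cyc3_def w_def w2_def w3_def qs f' algebra_simps e ee)
  then show ?thesis by blast
qed

section \<open>The Weitzenboeck decomposition\<close>

locale kerr_frame = adapted_frame +
  assumes hstar_frame: "x \<in> U \<Longrightarrow> hstar M am B x m n
      = (\<Sum>a\<in>UNIV. \<Sum>b\<in>UNIV. (- \<i> * dual (\<lambda>c d. \<Sum>r\<in>UNIV. \<Sum>s\<in>UNIV. E c r x * E d s x * B x r s) a b) * h a m x * h b n x)"
    and Om_frame: "x \<in> U \<Longrightarrow> Om M am 1 x m n = (\<Sum>a\<in>UNIV. \<Sum>b\<in>UNIV. w1 a b * h a m x * h b n x)"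
      "x \<in> U \<Longrightarrow> Om M am 2 x m n = (\<Sum>a\<in>UNIV. \<Sum>b\<in>UNIV. w2 a b * h a m x * h b n x)"
      "x \<in> U \<Longrightarrow> Om M am 3 x m n = (\<Sum>a\<in>UNIV. \<Sum>b\<in>UNIV. w3 a b * h a m x * h b n x)"
begin

text \<open>The -i of \<open>hstar_frame\<close> meets the -i in the definition of
  \<open>Pplus\<close>, which leaves half of 1 - \<open>dual\<close>.\<close>

lemma Pplus_frame:
  assumes x: "x \<in> U" and B: "\<And>r s. B x r s = (\<Sum>a\<in>UNIV. \<Sum>b\<in>UNIV. t a b * h a r x * h b s x)"
  shows "Pplus M am B x m n = (\<Sum>a\<in>UNIV. \<Sum>b\<in>UNIV. ((t a b - dual t a b) / 2) * h a m x * h b n x)"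
proof -
  have "(\<lambda>c d. \<Sum>r\<in>UNIV. \<Sum>s\<in>UNIV. E c r x * E d s x * B x r s) = t"
    unfolding B by (intro ext) (rule contract_h2[OF x])
  then have "\<i> * hstar M am B x m n = (\<Sum>a\<in>UNIV. \<Sum>b\<in>UNIV. dual t a b * h a m x * h b n x)"
    by (simp add: hstar_frame[OF x] sum_distrib_left flip: mult.assoc)
  then show ?thesis unfolding Pplus_def B
    by (simp add: sum_divide_distrib sum_subtractf left_diff_distrib diff_divide_distrib)
qed

lemma form_frames:
  assumes "x \<in> U"
  shows "omega M am x m n = (\<Sum>a\<in>UNIV. \<Sum>b\<in>UNIV. w1 a b * h a m x * h b n x)"
    "Omp M am x m n = (\<Sum>a\<in>UNIV. \<Sum>b\<in>UNIV. wp a b * h a m x * h b n x)"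
    "Omm M am x m n = (\<Sum>a\<in>UNIV. \<Sum>b\<in>UNIV. wm a b * h a m x * h b n x)"
  unfolding omega_def Omp_def Omm_def Om_frame[OF assms] wp_def wm_def
  by (simp_all add: sum_distrib_left sum_divide_distrib add_divide_distrib diff_divide_distrib
      distrib_right left_diff_distrib sum.distrib sum_subtractf mult.assoc)

lemma cov2_charged:
  assumes x: "x \<in> U" and w: "charged k w"
    and B: "\<And>y m n. y \<in> U \<Longrightarrow> B y m n = (\<Sum>a\<in>UNIV. \<Sum>b\<in>UNIV. w a b * h a m y * h b n y)"
  shows "cov2 M am B x m r s = \<i> * k * xi m x * B x r s"
proof -
  have "cov2 M am B x m r s = (\<Sum>a\<in>UNIV. \<Sum>b\<in>UNIV. D2 (\<lambda>a b y. w a b) m a b x * h a r x * h b s x)"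
    by (rule cov2_frame[OF x B pdiff_const])
  moreover have "D2 (\<lambda>a b y. w a b) m a b x = \<i> * k * xi m x * w a b" for a b
    using w x unfolding D2_def charged_def by (simp add: pd_const)
  ultimately show ?thesis unfolding B[OF x] by (simp add: sum_distrib_left ac_simps)
qed

text \<open>Existence is the charge of \<open>wp\<close> and \<open>wm\<close>; uniqueness needs
  only one nonzero component of \<Omega>^+ at the point.\<close>

lemma aform_frame:
  assumes x: "x \<in> U"
  shows "aform M am x m = xi m x"
proof -
  have p: "cov2 M am (Omp M am) x m r s = \<i> * (-1) * xi m x * Omp M am x r s" for m r s
    by (rule cov2_charged[OF x charged_w(2) form_frames(2)])
  have q: "cov2 M am (Omm M am) x m r s = \<i> * 1 * xi m x * Omm M am x r s" for m r s
    by (rule cov2_charged[OF x charged_w(3) form_frames(3)])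
  have "\<exists>r s. Omp M am x r s \<noteq> 0"
  proof (rule ccontr)
    assume "\<not> ?thesis"
    then have "wp 0 2 = 0"
      using contract_h2[OF x, of 0 2 wp] unfolding form_frames(2)[OF x, symmetric] by simp
    then show False by (simp add: wp_def w2_def w3_def)
  qed
  then obtain r s where rs: "Omp M am x r s \<noteq> 0" by blast
  have "aform M am x = (\<lambda>m. xi m x)"
    unfolding aform_def
  proof (rule the_equality)
    fix v assume v: "\<forall>m r s. cov2 M am (Omp M am) x m r s + \<i> * v m * Omp M am x r s = 0 \<and>
      cov2 M am (Omm M am) x m r s - \<i> * v m * Omm M am x r s = 0"
    have "v m = xi m x" for m
    proof -
      have "\<i> * (v m - xi m x) * Omp M am x r s = 0"
      proof -
        have "cov2 M am (Omp M am) x m r s + \<i> * v m * Omp M am x r s = 0" using v by blast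
        then show ?thesis unfolding p by (simp add: algebra_simps)
      qed
      then show ?thesis using rs by simp
    qed
    then show "v = (\<lambda>m. xi m x)" by blast
  qed (simp add: p q)
  then show ?thesis by simp
qed

lemma boxneg_frame:
  assumes x: "x \<in> U" and P: "Ck 2 U \<Phi>"
  shows "boxneg M am \<Phi> x = - (\<Sum>a\<in>UNIV. Qf 0 \<Phi> a a x)"
  using trace_Qf[OF x P, of "d0 \<Phi>" 0] by (simp add: boxneg_def d0_def theta_def)

lemma Ok_frame:
  assumes x: "x \<in> U" and P: "Ck 2 U \<Psi>"
  shows "Ok M am k \<Psi> x = - (\<Sum>a\<in>UNIV. Qf (complex_of_real k) \<Psi> a a x)
    + complex_of_real ((1 + 2 * k^2) / 6) * scal M am x * \<Psi> x"
proof -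
  define v where "v y l = pd l \<Psi> y + \<i> * complex_of_real k * aform M am y l * \<Psi> y" for y l
  have "v y l = theta (complex_of_real k) \<Psi> l y" if "y \<in> U" for y l
    by (simp add: v_def theta_def aform_frame[OF that])
  from trace_Qf[OF x P this] show ?thesis
    unfolding Ok_def Let_def v_def[symmetric] aform_frame[OF x] by simp
qed

text \<open>Both parts of the theorem use this with \<open>Pplus M am B\<close> in the role of
  \<open>B\<close>; the charges 0, -1, 1 belong to \<open>w1\<close>, \<open>wp\<close>,
  \<open>wm\<close>.\<close>

lemma charged_sum_triple:
  assumes P: "Ck 2 U \<Phi>" "Ck 2 U \<Phi>m" "Ck 2 U \<Phi>p"
    and B: "\<And>y r s. y \<in> U \<Longrightarrow> B y r s = (\<Sum>a\<in>UNIV. \<Sum>b\<in>UNIV.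
      (\<Phi> y * w1 a b + \<Phi>m y * wp a b + \<Phi>p y * wm a b) * h a r y * h b s y)"
  shows "charged_sum M am h E W {0, 1, 2} (\<lambda>j. if j = 0 then 0 else if j = 1 then -1 else 1)
    (\<lambda>j. if j = 0 then w1 else if j = 1 then wp else wm) (\<lambda>j. if j = 0 then \<Phi> else if j = 1 then \<Phi>m else \<Phi>p) B"
proof (unfold_locales, fold U_def)
  show "B y r s = (\<Sum>a\<in>UNIV. \<Sum>b\<in>UNIV. (\<Sum>j\<in>{0,1,2::nat}. (if j = 0 then \<Phi> else if j = 1 then \<Phi>m else \<Phi>p) y
      * (if j = 0 then w1 else if j = 1 then wp else wm) a b) * h a r y * h b s y)" if "y \<in> U" for y r s
    using B[OF that] by (simp add: add.assoc)
qed (use P in \<open>auto simp: charged_w asd_w\<close>)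

lemma Oop_decomposition:
  assumes x: "x \<in> U" and P: "Ck 2 U \<Phi>" "Ck 2 U \<Phi>m" "Ck 2 U \<Phi>p"
  defines "B \<equiv> \<lambda>y r s. \<Phi> y * omega M am y r s + \<Phi>m y * Omp M am y r s + \<Phi>p y * Omm M am y r s"
  shows "Oop M am B x m n = boxneg M am \<Phi> x * omega M am x m n + Ok M am (-1) \<Phi>m x * Omp M am x m n
    + Ok M am 1 \<Phi>p x * Omm M am x m n"
proof -
  let ?t = "\<lambda>a b y. \<Phi> y * w1 a b + \<Phi>m y * wp a b + \<Phi>p y * wm a b"
  have B: "B y r s = (\<Sum>a\<in>UNIV. \<Sum>b\<in>UNIV. ?t a b y * h a r y * h b s y)" if "y \<in> U" for y r s
    unfolding B_def form_frames[OF that]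
    by (simp add: sum_distrib_left sum.distrib[symmetric] algebra_simps)
  have asd_t: "asd (\<lambda>a b. ?t a b y)" for y
    by (intro asd_lincomb asd_w)
  \<comment> \<open>The coefficients are already anti-self-dual, so the projection fixes the form at
    points of the domain.\<close>
  have PB: "Pplus M am B y r s = (\<Sum>a\<in>UNIV. \<Sum>b\<in>UNIV. ?t a b y * h a r y * h b s y)" if "y \<in> U" for y r s
  proof -
    have half: "(z - - z) / 2 = z" for z :: complex by simp
    show ?thesis
      unfolding Pplus_frame[of y B "\<lambda>a b. ?t a b y", OF that B[OF that]] dual_asd[OF asd_t] half ..
  qed
  interpret c: charged_sum M am h E W U "{0, 1, 2}" "\<lambda>j. if j = 0 then 0 else if j = 1 then -1 else 1"
    "\<lambda>j. if j = 0 then w1 else if j = 1 then wp else wm" "\<lambda>j. if j = 0 then \<Phi> else if j = 1 then \<Phi>m else \<Phi>p" "Pplus M am B"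
    unfolding U_def by (rule charged_sum_triple[OF P PB])
  let ?q0 = "\<lambda>a b. Qf 0 \<Phi> a b x" and ?qm = "\<lambda>a b. Qf (-1) \<Phi>m a b x" and ?qp = "\<lambda>a b. Qf 1 \<Phi>p a b x"
  let ?R = "\<lambda>a b. rot ?q0 w1 a b + rot ?qm wp a b + rot ?qp wm a b"
  have G: "c.G a b x - c.G b a x = ?R a b" for a b
    unfolding c.G_def rot_def by simp
  have "Oop M am B x m n = 2 * Pplus M am (d1 (del2 M am (Pplus M am B))) x m n"
    by (simp add: Oop_def dplus_def dplus_star_def)
  \<comment> \<open>The factor 2 in \<open>Oop\<close> absorbs the 1/2 of the outer
    projection.\<close>
  also have "\<dots> = (\<Sum>a\<in>UNIV. \<Sum>b\<in>UNIV. (?R a b - dual ?R a b) * h a m x * h b n x)"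
    unfolding Pplus_frame[of x "d1 (del2 M am (Pplus M am B))" "\<lambda>a b. c.G a b x - c.G b a x", OF x c.d1_del2[OF x]] G by (simp add: sum_distrib_left)
  also have "\<dots> = (\<Sum>a\<in>UNIV. \<Sum>b\<in>UNIV. (boxneg M am \<Phi> x * w1 a b + Ok M am (-1) \<Phi>m x * wp a b
      + Ok M am 1 \<Phi>p x * wm a b) * h a m x * h b n x)"
  proof -
    have "?R a b - dual ?R a b = boxneg M am \<Phi> x * w1 a b + Ok M am (-1) \<Phi>m x * wp a b + Ok M am 1 \<Phi>p x * wm a b" for a b
    proof -
      have "dual ?R a b = dual (rot ?q0 w1) a b + dual (rot ?qm wp) a b + dual (rot ?qp wm) a b"
        by (simp add: dual_def sum.distrib distrib_left)
      moreover have "rot ?q0 w1 a b - dual (rot ?q0 w1) a b = boxneg M am \<Phi> x * w1 a b"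
        unfolding boxneg_frame[OF x P(1)]
        by (rule asd_rot_w1) (use Qf_commutator[OF x P(1), of 0] in simp)
      moreover have "rot ?qm wp a b - dual (rot ?qm wp) a b = Ok M am (-1) \<Phi>m x * wp a b"
      proof -
        have w: "wp = (\<lambda>a b. (1 / complex_of_real (sqrt 2)) * (w2 a b + \<i> * 1 * w3 a b))"
          by (intro ext) (simp add: wp_def)
        have "rot ?qm wp a b - dual (rot ?qm wp) a b
          = (- (\<Sum>c\<in>UNIV. Qf (-1) \<Phi>m c c x) + (dxi 0 1 x - dxi 2 3 x) * \<Phi>m x) * wp a b"
          unfolding w
          by (rule asd_rot_wpm[where f = "\<lambda>a b. dxi a b x"]) (use Qf_commutator[OF x P(2), of "-1"] dxi_type[OF x] in auto)
        \<comment> \<open>At k = -1 the coefficient (1 + 2k^2)/6 is 1/2, and half the scalar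
          curvature is the combination of \<open>dxi\<close> found above.\<close>
        then show ?thesis unfolding Ok_frame[OF x P(2)] dxi_type(3)[OF x] by simp
      qed
      moreover have "rot ?qp wm a b - dual (rot ?qp wm) a b = Ok M am 1 \<Phi>p x * wm a b"
      proof -
        have w: "wm = (\<lambda>a b. (1 / complex_of_real (sqrt 2)) * (w2 a b + \<i> * (-1) * w3 a b))"
          by (intro ext) (simp add: wm_def)
        have "rot ?qp wm a b - dual (rot ?qp wm) a b
          = (- (\<Sum>c\<in>UNIV. Qf 1 \<Phi>p c c x) + (dxi 0 1 x - dxi 2 3 x) * \<Phi>p x) * wm a b"
          unfolding w
          by (rule asd_rot_wpm[where f = "\<lambda>a b. dxi a b x"]) (use Qf_commutator[OF x P(3), of 1] dxi_type[OF x] in auto)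
        then show ?thesis unfolding Ok_frame[OF x P(3)] dxi_type(3)[OF x] by simp
      qed
      ultimately show ?thesis by (simp add: algebra_simps)
    qed
    then show ?thesis by (simp only:)
  qed
  finally show ?thesis unfolding form_frames[OF x]
    by (simp add: sum_distrib_left sum.distrib[symmetric] algebra_simps)
qed

text \<open>The projection of an arbitrary two-form has frame coefficients \<open>u\<close> that are
  anti-self-dual; expanded in \<open>w1\<close>, \<open>wp\<close>, \<open>wm\<close> they make it a
  sum of three charged forms with twice differentiable coefficients.\<close>

lemma Oop_lapH:
  assumes x: "x \<in> U" and B: "\<And>r s. Ck 2 U (\<lambda>y. B y r s)" and anti: "\<And>y r s. y \<in> U \<Longrightarrow> B y r s = - B y s r"
  shows "Oop M am B x m n = lapH M am (Pplus M am B) x m n"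
proof -
  define t where "t a b y = (\<Sum>r\<in>UNIV. \<Sum>s\<in>UNIV. E a r y * E b s y * B y r s)" for a b y
  define u where "u a b y = (t a b y - dual (\<lambda>a b. t a b y) a b) / 2" for a b y
  have t_C2: "Ck 2 U (t a b)" for a b
    unfolding t_def[abs_def] using B by (intro Ck_sum[OF open_U] Ck_mult[OF open_U] E_C2) auto
  have u_C2: "Ck 2 U (u a b)" for a b
    unfolding u_def[abs_def] dual_def using t_C2
    by (intro Ck_divide[OF open_U] Ck_diff[OF open_U] Ck_mult[OF open_U] Ck_const Ck_sum[OF open_U]) auto
  have t_anti: "t a b y = - t b a y" if "y \<in> U" for a b y
  proof -
    have "E a r y * E b s y * B y r s = - (E b s y * E a r y * B y s r)" for r s
      using anti[OF that, of r s] by simp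
    then have "t a b y = (\<Sum>r\<in>UNIV. \<Sum>s\<in>UNIV. - (E b s y * E a r y * B y s r))"
      unfolding t_def by (simp only:)
    also have "\<dots> = (\<Sum>s\<in>UNIV. \<Sum>r\<in>UNIV. - (E b s y * E a r y * B y s r))" by (rule sum.swap)
    finally show ?thesis by (simp add: t_def sum_negf)
  qed
  have asd_u: "asd (\<lambda>a b. u a b y)" if "y \<in> U" for y
    unfolding u_def by (rule asd_dual_part) (rule t_anti[OF that])
  have Bt: "B y r s = (\<Sum>a\<in>UNIV. \<Sum>b\<in>UNIV. t a b y * h a r y * h b s y)" if "y \<in> U" for y r s
    unfolding t_def by (rule expand_h2[OF that])
  have PB: "Pplus M am B y r s = (\<Sum>a\<in>UNIV. \<Sum>b\<in>UNIV.
      (u 0 1 y * w1 a b + ((u 0 2 y - \<i> * u 0 3 y) / complex_of_real (sqrt 2)) * wp a b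
        + ((u 0 2 y + \<i> * u 0 3 y) / complex_of_real (sqrt 2)) * wm a b) * h a r y * h b s y)" if "y \<in> U" for y r s
    unfolding asd_expand[OF asd_u[OF that], symmetric] unfolding u_def
    by (rule Pplus_frame[of y B "\<lambda>a b. t a b y", OF that Bt[OF that]])
  have C2: "Ck 2 U (\<lambda>y. (u 0 2 y - \<i> * u 0 3 y) / complex_of_real (sqrt 2))"
    "Ck 2 U (\<lambda>y. (u 0 2 y + \<i> * u 0 3 y) / complex_of_real (sqrt 2))"
    by (intro Ck_divide[OF open_U] Ck_diff[OF open_U] Ck_add[OF open_U] Ck_mult[OF open_U] Ck_const u_C2; simp)+
  interpret c: charged_sum M am h E W U "{0, 1, 2}" "\<lambda>j. if j = 0 then 0 else if j = 1 then -1 else 1"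
    "\<lambda>j. if j = 0 then w1 else if j = 1 then wp else wm"
    "\<lambda>j. if j = 0 then u 0 1 else if j = 1 then (\<lambda>y. (u 0 2 y - \<i> * u 0 3 y) / complex_of_real (sqrt 2))
      else (\<lambda>y. (u 0 2 y + \<i> * u 0 3 y) / complex_of_real (sqrt 2))" "Pplus M am B"
    unfolding U_def by (rule charged_sum_triple[OF u_C2 C2 PB])
  have "Oop M am B x m n = 2 * Pplus M am (d1 (del2 M am (Pplus M am B))) x m n"
    by (simp add: Oop_def dplus_def dplus_star_def)
  also have "\<dots> = (\<Sum>a\<in>UNIV. \<Sum>b\<in>UNIV. (c.G a b x - c.G b a x - dual (\<lambda>a b. c.G a b x - c.G b a x) a b) * h a m x * h b n x)"
    unfolding Pplus_frame[of x "d1 (del2 M am (Pplus M am B))" "\<lambda>a b. c.G a b x - c.G b a x", OF x c.d1_del2[OF x]] by (simp add: sum_distrib_left)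
  \<comment> \<open>If \<open>t\<close> denotes the frame components of d\<delta>, those of
    \<delta>d are minus the dual of \<open>t\<close>, so twice the projection of the first is the
    sum of both.\<close>
  also have "\<dots> = lapH M am (Pplus M am B) x m n"
    unfolding lapH_def c.d1_del2[OF x] c.del3_d2[OF x]
    by (simp add: sum.distrib[symmetric] algebra_simps)
  finally show ?thesis .
qed

end

section \<open>The Kerr coframe\<close>

lemma det_4:
  "det (A :: 'a::comm_ring_1^4^4) = A$0$0 * A$1$1 * A$2$2 * A$3$3 - A$0$0 * A$1$1 * A$2$3 * A$3$2 - A$0$0 * A$1$2 * A$2$1 * A$3$3
     + A$0$0 * A$1$2 * A$2$3 * A$3$1 + A$0$0 * A$1$3 * A$2$1 * A$3$2 - A$0$0 * A$1$3 * A$2$2 * A$3$1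
     - A$0$1 * A$1$0 * A$2$2 * A$3$3 + A$0$1 * A$1$0 * A$2$3 * A$3$2 + A$0$1 * A$1$2 * A$2$0 * A$3$3
     - A$0$1 * A$1$2 * A$2$3 * A$3$0 - A$0$1 * A$1$3 * A$2$0 * A$3$2 + A$0$1 * A$1$3 * A$2$2 * A$3$0
     + A$0$2 * A$1$0 * A$2$1 * A$3$3 - A$0$2 * A$1$0 * A$2$3 * A$3$1 - A$0$2 * A$1$1 * A$2$0 * A$3$3
     + A$0$2 * A$1$1 * A$2$3 * A$3$0 + A$0$2 * A$1$3 * A$2$0 * A$3$1 - A$0$2 * A$1$3 * A$2$1 * A$3$0
     - A$0$3 * A$1$0 * A$2$1 * A$3$2 + A$0$3 * A$1$0 * A$2$2 * A$3$1 + A$0$3 * A$1$1 * A$2$0 * A$3$2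
     - A$0$3 * A$1$1 * A$2$2 * A$3$0 - A$0$3 * A$1$2 * A$2$0 * A$3$1 + A$0$3 * A$1$2 * A$2$1 * A$3$0"
proof -
  have U: "(UNIV :: 4 set) = {0, 1, 2, 3}"
    using all4[of "\<lambda>i. i \<in> {0, 1, 2, 3}"] by auto
  have f0: "finite {1::4, 2, 3}" "0 \<notin> {1::4, 2, 3}" by auto
  have f1: "finite {2::4, 3}" "1 \<notin> {2::4, 3}" by auto
  have f2: "finite {3::4}" "2 \<notin> {3::4}" by auto
  show ?thesis
    unfolding det_def U
    unfolding sum_over_permutations_insert[OF f0]
    unfolding sum_over_permutations_insert[OF f1]
    unfolding sum_over_permutations_insert[OF f2]
    unfolding permutes_sing
    by (simp add: sign_swap_id permutation_swap_id sign_compose sign_id swap_id_eq permutation_compose)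
qed

lemma det_eps:
  fixes A :: "real^4^4"
  shows "complex_of_real (det A) = (\<Sum>a\<in>UNIV. \<Sum>b\<in>UNIV. \<Sum>c\<in>UNIV. \<Sum>d\<in>UNIV.
    eps a b c d * complex_of_real (A$a$0) * complex_of_real (A$b$1) * complex_of_real (A$c$2) * complex_of_real (A$d$3))"
  unfolding det_4 by (simp add: sum4 eps_def cyc3_def algebra_simps)

text \<open>The dual vector fields of the coframe, that is, Carter's canonical tetrad. Duality rests
  on (r^2 + a^2) - a^2 (1 - q^2) = \<rho>^2.\<close>

definition evec :: "real \<Rightarrow> real \<Rightarrow> 4 \<Rightarrow> pt \<Rightarrow> 4 \<Rightarrow> real" where
  "evec M am k x m =
    (let u = sqrt (Cf M am x); v = sqrt (Df x); p = rho am x; r = x$1; q = x$2 in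
     if k = 0 then (if m = 0 then (r^2 + am^2) / (u * p) else if m = 3 then am / (u * p) else 0)
     else if k = 1 then (if m = 1 then u / p else 0)
     else if k = 2 then (if m = 2 then v / p else 0)
     else (if m = 0 then am * (1 - q^2) / (v * p) else if m = 3 then 1 / (v * p) else 0))"

text \<open>The factor \<open>\<i>\<close> on the time direction makes the frame metric Euclidean.\<close>
definition nu :: "4 \<Rightarrow> complex" where
  "nu a = (if a = 0 then \<i> else 1)"

definition hf :: "real \<Rightarrow> real \<Rightarrow> 4 \<Rightarrow> 4 \<Rightarrow> pt \<Rightarrow> complex" where
  "hf M am a m x = nu a * lamp am x * ec M am a x m"

definition Ef :: "real \<Rightarrow> real \<Rightarrow> 4 \<Rightarrow> 4 \<Rightarrow> pt \<Rightarrow> complex" where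
  "Ef M am a m x = complex_of_real (evec M am a x m) / (nu a * lamp am x)"

lemma kerr_domD:
  assumes "x \<in> kerr_dom M am"
  shows "Cf M am x > 0" "Df x > 0" "rho am x > 0" "lamp am x \<noteq> 0"
    "(rho am x)\<^sup>2 = (x$1)\<^sup>2 + am\<^sup>2 * (x$2)\<^sup>2"
proof -
  have q: "-1 < x$2" "x$2 < 1" and C: "Cf M am x > 0" and p: "rho am x \<noteq> 0"
    using assms by (auto simp: kerr_dom_def)
  show "Cf M am x > 0" by (rule C)
  have "(x$2)^2 < 1" using q by (simp add: abs_square_less_1)
  then show "Df x > 0" by (simp add: Df_def)
  show "rho am x > 0" using p unfolding rho_def by (simp add: order_less_le)
  show "(rho am x)\<^sup>2 = (x$1)\<^sup>2 + am\<^sup>2 * (x$2)\<^sup>2" by (simp add: rho_def)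
  then have "x$1 \<noteq> 0 \<or> am * x$2 \<noteq> 0" using p by (auto simp: power2_eq_square)
  then show "lamp am x \<noteq> 0" by (auto simp: lamp_def Complex_eq_0)
qed

lemma open_kerr_dom: "open (kerr_dom M am)"
proof -
  have "kerr_dom M am = {x. 0 < (x$1)^2 - 2*M*(x$1) + am^2} \<inter> {x. -1 < x$2} \<inter> {x. x$2 < 1}
      \<inter> {x. sqrt ((x$1)^2 + am^2 * (x$2)^2) \<noteq> 0}"
    by (auto simp: kerr_dom_def Cf_def rho_def)
  moreover have "open {x::pt. 0 < (x$1)^2 - 2*M*(x$1) + am^2}"
    by (intro open_Collect_less continuous_intros)
  moreover have "open {x::pt. -1 < x$2}" "open {x::pt. x$2 < 1}"
    by (intro open_Collect_less continuous_intros)+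
  moreover have "open {x::pt. sqrt ((x$1)^2 + am^2 * (x$2)^2) \<noteq> 0}"
    by (intro open_Collect_neq continuous_intros)
  ultimately show ?thesis by (simp add: open_Int)
qed

lemma evec_dual:
  assumes x: "x \<in> kerr_dom M am"
  shows "(\<Sum>m\<in>UNIV. ef M am a x m * evec M am b x m) = (if a = b then 1 else 0)"
proof -
  note d = kerr_domD[OF x]
  define u where "u = sqrt (Cf M am x)"
  define v where "v = sqrt (Df x)"
  define p where "p = rho am x"
  have nz: "u \<noteq> 0" "v \<noteq> 0" "p \<noteq> 0" using d by (auto simp: u_def v_def p_def)
  have pp: "p * p = x$1 * x$1 + am * am * (x$2 * x$2)" using d(5) by (simp add: p_def power2_eq_square)
  have "\<forall>a b. (\<Sum>m\<in>UNIV. ef M am a x m * evec M am b x m) = (if a = b then 1 else 0)"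
    unfolding all4 ef_def evec_def Let_def u_def[symmetric] v_def[symmetric] p_def[symmetric]
    using nz pp by (simp add: sum4 field_simps power2_eq_square) (intro conjI; algebra)
  then show ?thesis by blast
qed

lemma evec_complete:
  assumes x: "x \<in> kerr_dom M am"
  shows "(\<Sum>a\<in>UNIV. ef M am a x m * evec M am a x n) = (if m = n then 1 else 0)"
proof -
  let ?A = "\<chi> a m. ef M am a x m" and ?B = "\<chi> m b. evec M am b x m"
  have "?A ** ?B = mat 1"
    by (simp add: matrix_matrix_mult_def mat_def vec_eq_iff evec_dual[OF x])
  then have "?B ** ?A = mat 1" by (simp add: matrix_left_right_inverse)
  then have "(?B ** ?A) $ n $ m = mat 1 $ n $ m" by simp
  then show ?thesis by (simp add: matrix_matrix_mult_def mat_def ac_simps eq_commute)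
qed

lemma nu_nz: "nu a \<noteq> 0"
  by (simp add: nu_def)

lemma frame_dual:
  assumes x: "x \<in> kerr_dom M am"
  shows "(\<Sum>m\<in>UNIV. hf M am a m x * Ef M am b m x) = (if a = b then 1 else 0)"
    "(\<Sum>a\<in>UNIV. hf M am a m x * Ef M am a n x) = (if m = n then 1 else 0)"
proof -
  have l: "lamp am x \<noteq> 0" by (rule kerr_domD[OF x])
  have "(\<Sum>m\<in>UNIV. hf M am a m x * Ef M am b m x)
     = nu a / nu b * complex_of_real (\<Sum>m\<in>UNIV. ef M am a x m * evec M am b x m)"
    unfolding of_real_sum sum_distrib_left using l
    by (intro sum.cong refl) (simp add: hf_def Ef_def ec_def)
  then show "(\<Sum>m\<in>UNIV. hf M am a m x * Ef M am b m x) = (if a = b then 1 else 0)"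
    by (simp add: evec_dual[OF x] nu_nz)
  have "(\<Sum>a\<in>UNIV. hf M am a m x * Ef M am a n x)
     = complex_of_real (\<Sum>a\<in>UNIV. ef M am a x m * evec M am a x n)"
    unfolding of_real_sum using l
    by (intro sum.cong refl) (simp add: hf_def Ef_def ec_def nu_nz)
  then show "(\<Sum>a\<in>UNIV. hf M am a m x * Ef M am a n x) = (if m = n then 1 else 0)"
    by (simp add: evec_complete[OF x])
qed

lemma gmet_frame: "gmet M am x m n = (\<Sum>a\<in>UNIV. hf M am a m x * hf M am a n x)"
  by (simp add: gmet_def gKerr_def sum4 hf_def nu_def ec_def eta_def power2_eq_square algebra_simps)

section \<open>The Hodge star in the rescaled frame\<close>

lemma gKinv_frame:
  assumes x: "x \<in> kerr_dom M am"
  shows "gKinv M am x m n = (\<Sum>k\<in>UNIV. eta k * evec M am k x m * evec M am k x n)"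
proof -
  have eta2: "eta a * eta a = 1" for a by (simp add: eta_def)
  have gE: "(\<Sum>s\<in>UNIV. gKerr M am x m s * (\<Sum>k\<in>UNIV. eta k * evec M am k x s * evec M am k x n)) = (if m = n then 1 else 0)" for m n
  proof -
    have "(\<Sum>s\<in>UNIV. gKerr M am x m s * (\<Sum>k\<in>UNIV. eta k * evec M am k x s * evec M am k x n))
        = (\<Sum>s\<in>UNIV. (\<Sum>a\<in>UNIV. (eta a * ef M am a x m) * ef M am a x s) * (\<Sum>k\<in>UNIV. (eta k * evec M am k x n) * evec M am k x s))"
      by (simp add: gKerr_def ac_simps)
    also have "\<dots> = (\<Sum>a\<in>UNIV. eta a * ef M am a x m * (eta a * evec M am a x n))"
      unfolding sum_contract by (simp add: evec_dual[OF x])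
    also have "\<dots> = (\<Sum>a\<in>UNIV. ef M am a x m * evec M am a x n)"
      by (intro sum.cong refl) (use eta2 in \<open>simp add: mult.assoc[symmetric] mult.commute[of "eta _" "ef _ _ _ _ _"]\<close>)
    finally show ?thesis by (simp add: evec_complete[OF x])
  qed
  have sym: "gKerr M am x m n = gKerr M am x n m" for m n
    by (simp add: gKerr_def ac_simps)
  let ?A = "\<chi> i j. gKerr M am x i j" and ?B = "\<chi> i j. \<Sum>k\<in>UNIV. eta k * evec M am k x i * evec M am k x j"
  have AB: "?A ** ?B = mat 1"
    by (simp add: matrix_matrix_mult_def mat_def vec_eq_iff gE)
  then have "?B ** ?A = mat 1" by (simp add: matrix_left_right_inverse)
  from matrix_inv_eqI[OF AB this] show ?thesis by (simp add: gKinv_def)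
qed

lemma ef_gKinv:
  assumes x: "x \<in> kerr_dom M am"
  shows "(\<Sum>r\<in>UNIV. ef M am c x r * gKinv M am x r s) = eta c * evec M am c x s"
proof -
  have "(\<Sum>r\<in>UNIV. ef M am c x r * gKinv M am x r s)
      = (\<Sum>k\<in>UNIV. (eta k * evec M am k x s) * (\<Sum>r\<in>UNIV. ef M am c x r * evec M am k x r))"
    unfolding gKinv_frame[OF x] sum_distrib_left by (subst sum.swap) (simp add: ac_simps)
  then show ?thesis by (simp add: evec_dual[OF x])
qed

text \<open>Where \<open>eps\<close> is nonzero, exactly one index is 0. If it is \<open>c\<close>
  or \<open>d\<close>, the left factor is i times -1 and \<open>nu a * nu b\<close> is 1; if it is
  \<open>a\<close> or \<open>b\<close>, the left factor is 1 and \<open>nu a * nu b\<close> is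
  i.\<close>

lemma eps_nu: "eps a b c d * (nu c * nu d * complex_of_real (eta c * eta d)) = - \<i> * eps a b c d * (nu a * nu b)"
proof -
  have "\<forall>a b c d. eps a b c d * (nu c * nu d * complex_of_real (eta c * eta d)) = - \<i> * eps a b c d * (nu a * nu b)"
    unfolding all4 by (simp add: eps_def cyc3_def nu_def eta_def)
  then show ?thesis by blast
qed

lemma vol_eps: "complex_of_real (vol M am x m n r s) = (\<Sum>c\<in>UNIV. \<Sum>d\<in>UNIV.
    (\<Sum>a\<in>UNIV. \<Sum>b\<in>UNIV. eps a b c d * ec M am a x m * ec M am b x n) * ec M am c x r * ec M am d x s)"
proof -
  have "complex_of_real (vol M am x m n r s) = (\<Sum>a\<in>UNIV. \<Sum>b\<in>UNIV. \<Sum>c\<in>UNIV. \<Sum>d\<in>UNIV.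
      eps a b c d * ec M am a x m * ec M am b x n * ec M am c x r * ec M am d x s)"
    unfolding vol_def det_eps by (simp add: ec_def)
  also have "\<dots> = (\<Sum>c\<in>UNIV. \<Sum>d\<in>UNIV. \<Sum>a\<in>UNIV. \<Sum>b\<in>UNIV.
      eps a b c d * ec M am a x m * ec M am b x n * ec M am c x r * ec M am d x s)"
    by (rule sum_swap4)
  finally show ?thesis by (simp add: sum_distrib_right)
qed

text \<open>The two powers of \<lambda>_+ in the coframe cancel those in the dual frame, which is
  conformal invariance; the factor -i comes from \<open>eps_nu\<close>.\<close>

lemma hstar_hf:
  assumes x: "x \<in> kerr_dom M am"
  shows "hstar M am B x m n = (\<Sum>a\<in>UNIV. \<Sum>b\<in>UNIV. (- \<i> * dual (\<lambda>c d. \<Sum>r\<in>UNIV. \<Sum>s\<in>UNIV.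
    Ef M am c r x * Ef M am d s x * B x r s) a b) * hf M am a m x * hf M am b n x)"
proof -
  have l: "lamp am x \<noteq> 0" by (rule kerr_domD[OF x])
  define g where "g r s = complex_of_real (gKinv M am x r s)" for r s
  define ev where "ev c r = complex_of_real (evec M am c x r)" for c r
  define Bf where "Bf c d = (\<Sum>r\<in>UNIV. \<Sum>s\<in>UNIV. ev c r * ev d s * B x r s)" for c d
  define T where "T c d = (\<Sum>a\<in>UNIV. \<Sum>b\<in>UNIV. eps a b c d * ec M am a x m * ec M am b x n)" for c d
  have eg: "(\<Sum>r\<in>UNIV. ec M am c x r * g r s) = complex_of_real (eta c) * ev c s" for c s
    using ef_gKinv[OF x, of c s] by (simp add: ec_def g_def ev_def flip: of_real_mult of_real_sum)
  have lower: "(\<Sum>r\<in>UNIV. \<Sum>s\<in>UNIV. \<Sum>r'\<in>UNIV. \<Sum>s'\<in>UNIV. ec M am c x r * ec M am d x s * g r r' * g s s' * B x r' s')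
      = complex_of_real (eta c * eta d) * Bf c d" for c d
  proof -
    have "(\<Sum>r\<in>UNIV. \<Sum>s\<in>UNIV. \<Sum>r'\<in>UNIV. \<Sum>s'\<in>UNIV. ec M am c x r * ec M am d x s * g r r' * g s s' * B x r' s')
       = (\<Sum>r'\<in>UNIV. \<Sum>s'\<in>UNIV. \<Sum>r\<in>UNIV. \<Sum>s\<in>UNIV. ec M am c x r * ec M am d x s * g r r' * g s s' * B x r' s')"
      by (rule sum_swap4)
    also have "\<dots> = (\<Sum>r'\<in>UNIV. \<Sum>s'\<in>UNIV. (\<Sum>r\<in>UNIV. ec M am c x r * g r r') * (\<Sum>s\<in>UNIV. ec M am d x s * g s s') * B x r' s')"
      unfolding sum_product unfolding sum_distrib_right by (simp add: ac_simps)
    finally show ?thesis unfolding eg Bf_def by (simp add: sum_distrib_left ac_simps)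
  qed
  have "hstar M am B x m n = (1/2) * (\<Sum>r\<in>UNIV. \<Sum>s\<in>UNIV. (\<Sum>c\<in>UNIV. \<Sum>d\<in>UNIV. T c d * ec M am c x r * ec M am d x s)
      * (\<Sum>r'\<in>UNIV. \<Sum>s'\<in>UNIV. g r r' * g s s' * B x r' s'))"
    unfolding hstar_def of_real_mult vol_eps T_def[symmetric] g_def[symmetric]
    by (simp add: sum_distrib_left mult.assoc)
  also have "\<dots> = (1/2) * (\<Sum>r\<in>UNIV. \<Sum>s\<in>UNIV. \<Sum>c\<in>UNIV. \<Sum>d\<in>UNIV. T c d * (\<Sum>r'\<in>UNIV. \<Sum>s'\<in>UNIV.
      ec M am c x r * ec M am d x s * g r r' * g s s' * B x r' s'))"
  proof -
    have inner: "(\<Sum>r'\<in>UNIV. \<Sum>s'\<in>UNIV. ec M am c x r * ec M am d x s * g r r' * g s s' * B x r' s')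
       = ec M am c x r * ec M am d x s * (\<Sum>r'\<in>UNIV. \<Sum>s'\<in>UNIV. g r r' * g s s' * B x r' s')" for c d r s
      by (simp add: sum_distrib_left mult.assoc)
    show ?thesis unfolding inner by (simp add: sum_distrib_right mult.assoc)
  qed
  also have "\<dots> = (1/2) * (\<Sum>c\<in>UNIV. \<Sum>d\<in>UNIV. \<Sum>r\<in>UNIV. \<Sum>s\<in>UNIV. T c d * (\<Sum>r'\<in>UNIV. \<Sum>s'\<in>UNIV.
      ec M am c x r * ec M am d x s * g r r' * g s s' * B x r' s'))"
    by (subst sum_swap4) simp
  also have "\<dots> = (1/2) * (\<Sum>c\<in>UNIV. \<Sum>d\<in>UNIV. T c d * (complex_of_real (eta c * eta d) * Bf c d))"
    unfolding lower[symmetric] by (simp add: sum_distrib_left)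
  also have "\<dots> = (1/2) * (\<Sum>c\<in>UNIV. \<Sum>d\<in>UNIV. \<Sum>a\<in>UNIV. \<Sum>b\<in>UNIV.
      eps a b c d * ec M am a x m * ec M am b x n * (complex_of_real (eta c * eta d) * Bf c d))"
    unfolding T_def by (simp add: sum_distrib_right)
  also have "\<dots> = (1/2) * (\<Sum>a\<in>UNIV. \<Sum>b\<in>UNIV. \<Sum>c\<in>UNIV. \<Sum>d\<in>UNIV.
      eps a b c d * ec M am a x m * ec M am b x n * (complex_of_real (eta c * eta d) * Bf c d))"
    by (subst sum_swap4) simp
  also have "\<dots> = (1/2) * (\<Sum>a\<in>UNIV. \<Sum>b\<in>UNIV. \<Sum>c\<in>UNIV. \<Sum>d\<in>UNIV.
      - \<i> * eps a b c d * (\<Sum>r\<in>UNIV. \<Sum>s\<in>UNIV. Ef M am c r x * Ef M am d s x * B x r s) * hf M am a m x * hf M am b n x)"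
  proof -
    have "eps a b c d * ec M am a x m * ec M am b x n * (complex_of_real (eta c * eta d) * Bf c d)
      = - \<i> * eps a b c d * (\<Sum>r\<in>UNIV. \<Sum>s\<in>UNIV. Ef M am c r x * Ef M am d s x * B x r s) * hf M am a m x * hf M am b n x" for a b c d
    proof -
      have "(\<Sum>r\<in>UNIV. \<Sum>s\<in>UNIV. Ef M am c r x * Ef M am d s x * B x r s) = Bf c d / (nu c * nu d * (lamp am x)\<^sup>2)"
        unfolding Bf_def sum_divide_distrib by (simp add: Ef_def ev_def power2_eq_square ac_simps)
      then have "- \<i> * eps a b c d * (\<Sum>r\<in>UNIV. \<Sum>s\<in>UNIV. Ef M am c r x * Ef M am d s x * B x r s) * hf M am a m x * hf M am b n x
         = (- \<i> * eps a b c d * (nu a * nu b)) * (Bf c d / (nu c * nu d)) * ec M am a x m * ec M am b x n"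
        using l nu_nz[of c] nu_nz[of d] by (simp add: hf_def field_simps power2_eq_square)
      also have "\<dots> = eps a b c d * ec M am a x m * ec M am b x n * (complex_of_real (eta c * eta d) * Bf c d)"
        unfolding eps_nu[symmetric] using nu_nz[of c] nu_nz[of d] by simp
      finally show ?thesis by simp
    qed
    then show ?thesis by (simp only:)
  qed
  finally show ?thesis
    by (simp add: dual_def sum_distrib_left sum_distrib_right ac_simps)
qed

lemma Om_hf:
  "Om M am 1 x m n = (\<Sum>a\<in>UNIV. \<Sum>b\<in>UNIV. w1 a b * hf M am a m x * hf M am b n x)"
  "Om M am 2 x m n = (\<Sum>a\<in>UNIV. \<Sum>b\<in>UNIV. w2 a b * hf M am a m x * hf M am b n x)"
  "Om M am 3 x m n = (\<Sum>a\<in>UNIV. \<Sum>b\<in>UNIV. w3 a b * hf M am a m x * hf M am b n x)"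
  by (simp_all add: Om_def Sig_def wedge_def sum4 w1_def w2_def w3_def hf_def nu_def power2_eq_square algebra_simps)

section \<open>Differentiability of the coframe coefficients\<close>

definition uu :: "real \<Rightarrow> real \<Rightarrow> pt \<Rightarrow> complex" where "uu M am x = complex_of_real (sqrt (Cf M am x))"
definition vv :: "pt \<Rightarrow> complex" where "vv x = complex_of_real (sqrt (Df x))"
definition pp :: "real \<Rightarrow> pt \<Rightarrow> complex" where "pp am x = complex_of_real (rho am x)"

lemmas Ck_kerr_intros =
  Ck_const Ck_coord Ck_add[OF open_kerr_dom] Ck_diff[OF open_kerr_dom] Ck_uminus[OF open_kerr_dom]
  Ck_mult[OF open_kerr_dom] Ck_power[OF open_kerr_dom] Ck_divide[OF open_kerr_dom] Ck_inverse[OF open_kerr_dom]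

lemma lamp_eq: "lamp am x = inverse (complex_of_real (x$1) + \<i> * complex_of_real am * complex_of_real (x$2))"
  by (simp add: lamp_def divide_inverse Complex_eq mult.assoc)

lemma nonzero:
  assumes "x \<in> kerr_dom M am"
  shows "uu M am x \<noteq> 0" "vv x \<noteq> 0" "pp am x \<noteq> 0" "lamp am x \<noteq> 0"
    "complex_of_real (x$1) + \<i> * complex_of_real am * complex_of_real (x$2) \<noteq> 0"
  using kerr_domD[OF assms] lamp_eq[of am x] by (auto simp: uu_def vv_def pp_def)

lemma Ck_base:
  "Ck k (kerr_dom M am) (uu M am)" "Ck k (kerr_dom M am) vv" "Ck k (kerr_dom M am) (pp am)"
  "Ck k (kerr_dom M am) (lamp am)"
proof -
  have "Ck k (kerr_dom M am) (\<lambda>x. complex_of_real (Cf M am x))"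
    unfolding Cf_def of_real_add of_real_diff of_real_mult of_real_power by (intro Ck_kerr_intros)
  then show "Ck k (kerr_dom M am) (uu M am)"
    unfolding uu_def[abs_def] by (intro Ck_sqrt[OF open_kerr_dom]) (auto dest: kerr_domD)
  have "Ck k (kerr_dom M am) (\<lambda>x. complex_of_real (Df x))"
    unfolding Df_def of_real_add of_real_diff of_real_mult of_real_power by (intro Ck_kerr_intros)
  then show "Ck k (kerr_dom M am) vv"
    unfolding vv_def[abs_def] by (intro Ck_sqrt[OF open_kerr_dom]) (auto dest: kerr_domD)
  have "Ck k (kerr_dom M am) (\<lambda>x. complex_of_real ((x$1)^2 + am^2 * (x$2)^2))"
    unfolding of_real_add of_real_diff of_real_mult of_real_power by (intro Ck_kerr_intros)
  then show "Ck k (kerr_dom M am) (pp am)"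
    unfolding pp_def[abs_def] rho_def
    by (intro Ck_sqrt[OF open_kerr_dom]) (auto simp: rho_def dest: kerr_domD(3))
  show "Ck k (kerr_dom M am) (lamp am)"
    unfolding lamp_eq[abs_def] by (intro Ck_kerr_intros) (rule nonzero)
qed

text \<open>Each h^a is \<open>Hc M am a\<close> times a one-form with polynomial coefficients, so
  all roots and quotients are confined to these four functions.\<close>

definition Hc :: "real \<Rightarrow> real \<Rightarrow> 4 \<Rightarrow> pt \<Rightarrow> complex" where
  "Hc M am a x = (if a = 0 then \<i> * lamp am x * uu M am x / pp am x
     else if a = 1 then lamp am x * pp am x / uu M am x
     else if a = 2 then lamp am x * pp am x / vv x
     else lamp am x * vv x / pp am x)"

lemma Ck_Hc: "Ck k (kerr_dom M am) (Hc M am a)"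
proof -
  have "\<forall>a. Ck k (kerr_dom M am) (Hc M am a)"
    unfolding all4 Hc_def[abs_def] by (auto intro!: Ck_kerr_intros Ck_base dest: nonzero)
  then show ?thesis by blast
qed

lemma Hc_nonzero: "x \<in> kerr_dom M am \<Longrightarrow> Hc M am a x \<noteq> 0"
  using nonzero[of x M am] by (simp add: Hc_def)

lemma hf_components:
  "hf M am 0 0 = Hc M am 0" "hf M am 0 1 = (\<lambda>x. 0)" "hf M am 0 2 = (\<lambda>x. 0)"
  "hf M am 0 3 = (\<lambda>x. - (complex_of_real am * (1 - (complex_of_real (x$2))^2)) * Hc M am 0 x)"
  "hf M am 1 0 = (\<lambda>x. 0)" "hf M am 1 1 = Hc M am 1" "hf M am 1 2 = (\<lambda>x. 0)" "hf M am 1 3 = (\<lambda>x. 0)"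
  "hf M am 2 0 = (\<lambda>x. 0)" "hf M am 2 1 = (\<lambda>x. 0)" "hf M am 2 2 = Hc M am 2" "hf M am 2 3 = (\<lambda>x. 0)"
  "hf M am 3 0 = (\<lambda>x. - complex_of_real am * Hc M am 3 x)" "hf M am 3 1 = (\<lambda>x. 0)" "hf M am 3 2 = (\<lambda>x. 0)"
  "hf M am 3 3 = (\<lambda>x. ((complex_of_real (x$1))^2 + (complex_of_real am)^2) * Hc M am 3 x)"
  by (intro ext, simp add: hf_def nu_def ec_def ef_def Let_def Hc_def uu_def vv_def pp_def)+

lemma Ck_hf: "Ck k (kerr_dom M am) (hf M am a m)"
proof -
  have "\<forall>a m. Ck k (kerr_dom M am) (hf M am a m)"
    unfolding all4 hf_components by (intro conjI Ck_kerr_intros Ck_Hc)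
  then show ?thesis by blast
qed

lemma Ck_Ef: "Ck k (kerr_dom M am) (Ef M am a m)"
proof -
  have "\<forall>a m. Ck k (kerr_dom M am) (\<lambda>x. complex_of_real (evec M am a x m))"
    unfolding all4 evec_def Let_def
    by (auto simp flip: uu_def vv_def pp_def intro!: Ck_kerr_intros Ck_base dest: nonzero)
  then show ?thesis unfolding Ef_def[abs_def]
    by (intro Ck_divide[OF open_kerr_dom] Ck_mult[OF open_kerr_dom] Ck_const Ck_base) (auto simp: nu_nz dest: nonzero)
qed

text \<open>Logarithmic derivatives: the coframe coefficients are monomials in \<open>\<lambda>\<^sub>+\<close>, \<open>\<surd>C\<close>, \<open>\<surd>D\<close>, \<open>\<rho>\<close>.\<close>
definition has_ld :: "(pt \<Rightarrow> complex) \<Rightarrow> complex \<Rightarrow> 4 \<Rightarrow> pt \<Rightarrow> bool" where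
  "has_ld f L i x \<longleftrightarrow> has_pd f (L * f x) i x"

lemma has_ld_mult: "has_ld f L i x \<Longrightarrow> has_ld g L' i x \<Longrightarrow> has_ld (\<lambda>y. f y * g y) (L + L') i x"
  unfolding has_ld_def by (drule (1) has_pd_mult) (simp add: algebra_simps)

lemma has_ld_inverse:
  assumes "has_ld f L i x" "f x \<noteq> 0"
  shows "has_ld (\<lambda>y. inverse (f y)) (- L) i x"
proof -
  have "- (inverse (f x) * (L * f x) * inverse (f x)) = - L * inverse (f x)"
    using assms(2) by (simp add: field_simps)
  then show ?thesis
    using has_pd_inverse[OF assms(1)[unfolded has_ld_def] assms(2)] unfolding has_ld_def by (simp only:)
qed

lemma has_ld_divide: "has_ld f L i x \<Longrightarrow> has_ld g L' i x \<Longrightarrow> g x \<noteq> 0 \<Longrightarrow> has_ld (\<lambda>y. f y / g y) (L - L') i x"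
  unfolding divide_inverse using has_ld_mult[OF _ has_ld_inverse] by fastforce

lemma has_ld_const: "has_ld (\<lambda>y. c) 0 i x"
  unfolding has_ld_def using has_pd_const by simp

lemma has_ld_sqrt:
  assumes "has_pd (\<lambda>y. complex_of_real (f y)) D i x" "f x > 0"
  shows "has_ld (\<lambda>y. complex_of_real (sqrt (f y))) (D / (2 * complex_of_real (f x))) i x"
proof -
  have "complex_of_real (sqrt (f x)) * complex_of_real (sqrt (f x)) = complex_of_real (f x)"
    using assms(2) by (simp flip: of_real_mult)
  then have "D / (2 * complex_of_real (sqrt (f x))) = D / (2 * complex_of_real (f x)) * complex_of_real (sqrt (f x))"
    using assms(2) by (simp add: field_simps)
  with has_pd_sqrt[OF assms] show ?thesis unfolding has_ld_def by simp
qed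

text \<open>The logarithmic derivative of r + i a q, the reciprocal of \<lambda>_+; hence the minus
  sign wherever \<lambda>_+ is differentiated.\<close>

definition Lz :: "real \<Rightarrow> 4 \<Rightarrow> pt \<Rightarrow> complex" where
  "Lz am i x = (if i = 1 then lamp am x else if i = 2 then \<i> * complex_of_real am * lamp am x else 0)"
definition Lu :: "real \<Rightarrow> real \<Rightarrow> 4 \<Rightarrow> pt \<Rightarrow> complex" where
  "Lu M am i x = (if i = 1 then (complex_of_real (x$1) - complex_of_real M) / complex_of_real (Cf M am x) else 0)"
definition Lv :: "4 \<Rightarrow> pt \<Rightarrow> complex" where
  "Lv i x = (if i = 2 then - complex_of_real (x$2) / complex_of_real (Df x) else 0)"
definition Lp :: "real \<Rightarrow> 4 \<Rightarrow> pt \<Rightarrow> complex" where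
  "Lp am i x = (if i = 1 then complex_of_real (x$1) / (pp am x)^2
     else if i = 2 then (complex_of_real am)^2 * complex_of_real (x$2) / (pp am x)^2 else 0)"

lemma has_ld_base:
  assumes x: "x \<in> kerr_dom M am"
  shows "has_ld (lamp am) (- Lz am i x) i x" "has_ld (uu M am) (Lu M am i x) i x" "has_ld vv (Lv i x) i x"
    "has_ld (pp am) (Lp am i x) i x"
proof -
  note r = has_pd_coord[of 1 i x] and q = has_pd_coord[of 2 i x]
  note rr = has_pd_mult[OF r r] and qq = has_pd_mult[OF q q]
  have "has_pd (\<lambda>x. complex_of_real (x$1) + \<i> * complex_of_real am * complex_of_real (x$2))
     ((if i = 1 then 1 else 0) + (\<i> * complex_of_real am * (if i = 2 then 1 else 0) + 0 * complex_of_real (x$2))) i x"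
    by (rule has_pd_add[OF r has_pd_mult[OF has_pd_const q]])
  then have "has_ld (\<lambda>x. complex_of_real (x$1) + \<i> * complex_of_real am * complex_of_real (x$2)) (Lz am i x) i x"
    unfolding has_ld_def Lz_def lamp_eq using nonzero(5)[OF x] by (auto simp: mult.assoc split: if_splits)
  from has_ld_inverse[OF this nonzero(5)[OF x]]
  show "has_ld (lamp am) (- Lz am i x) i x" unfolding lamp_eq[abs_def] by simp
  have "has_pd (\<lambda>x. complex_of_real (Cf M am x)) (if i = 1 then 2 * (complex_of_real (x$1) - complex_of_real M) else 0) i x"
    using has_pd_add[OF rr has_pd_add[OF has_pd_mult[OF has_pd_const[of "- 2 * complex_of_real M"] r] has_pd_const[of "(complex_of_real am)^2"]]]
    by (auto simp: Cf_def power2_eq_square algebra_simps split: if_splits)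
  from has_ld_sqrt[OF this kerr_domD(1)[OF x]]
  have "has_ld (uu M am) ((if i = 1 then 2 * (complex_of_real (x$1) - complex_of_real M) else 0) / (2 * complex_of_real (Cf M am x))) i x"
    unfolding uu_def[abs_def] .
  moreover have "(if i = 1 then 2 * (complex_of_real (x$1) - complex_of_real M) else 0) / (2 * complex_of_real (Cf M am x)) = Lu M am i x"
    using kerr_domD(1)[OF x] by (auto simp: Lu_def field_simps)
  ultimately show "has_ld (uu M am) (Lu M am i x) i x" by (simp only:)
  have "has_pd (\<lambda>x. complex_of_real (Df x)) (if i = 2 then - 2 * complex_of_real (x$2) else 0) i x"
    using has_pd_add[OF has_pd_const[of 1] has_pd_mult[OF has_pd_const[of "-1"] qq]]
    by (auto simp: Df_def power2_eq_square algebra_simps split: if_splits)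
  from has_ld_sqrt[OF this] show "has_ld vv (Lv i x) i x"
    unfolding vv_def[abs_def] Lv_def using kerr_domD[OF x] by (auto split: if_splits)
  have "has_pd (\<lambda>x. complex_of_real ((x$1)^2 + am^2 * (x$2)^2))
      (if i = 1 then 2 * complex_of_real (x$1) else if i = 2 then 2 * ((complex_of_real am)^2 * complex_of_real (x$2)) else 0) i x"
    using has_pd_add[OF rr has_pd_mult[OF has_pd_const[of "(complex_of_real am)^2"] qq]]
    by (auto simp: power2_eq_square algebra_simps split: if_splits)
  note ld = has_ld_sqrt[OF this]
  have pos: "(x$1)^2 + am^2 * (x$2)^2 > 0" using kerr_domD(3,5)[OF x] by (metis zero_less_power)
  have p2: "(pp am x)^2 = complex_of_real ((x$1)^2 + am^2 * (x$2)^2)"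
    using kerr_domD(5)[OF x] by (simp add: pp_def flip: of_real_power)
  have "(if i = 1 then 2 * complex_of_real (x$1) else if i = 2 then 2 * ((complex_of_real am)^2 * complex_of_real (x$2)) else 0)
      / (2 * (pp am x)^2) = Lp am i x"
    using nonzero(3)[OF x] by (auto simp: Lp_def field_simps)
  with ld[OF pos] show "has_ld (pp am) (Lp am i x) i x"
    unfolding p2[symmetric] unfolding pp_def[abs_def] rho_def[abs_def] by (simp only:)
qed

lemma pd_Hc:
  assumes x: "x \<in> kerr_dom M am"
  shows "pd i (Hc M am 0) x = (- Lz am i x + Lu M am i x - Lp am i x) * Hc M am 0 x"
    "pd i (Hc M am 1) x = (- Lz am i x + Lp am i x - Lu M am i x) * Hc M am 1 x"
    "pd i (Hc M am 2) x = (- Lz am i x + Lp am i x - Lv i x) * Hc M am 2 x"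
    "pd i (Hc M am 3) x = (- Lz am i x + Lv i x - Lp am i x) * Hc M am 3 x"
proof -
  note b = has_ld_base[OF x, of i] and n = nonzero[OF x]
  have "has_ld (Hc M am 0) (0 + - Lz am i x + Lu M am i x - Lp am i x) i x"
    using has_ld_divide[OF has_ld_mult[OF has_ld_mult[OF has_ld_const b(1)] b(2)] b(4) n(3)]
    by (simp add: Hc_def[abs_def])
  then show "pd i (Hc M am 0) x = (- Lz am i x + Lu M am i x - Lp am i x) * Hc M am 0 x"
    unfolding has_ld_def by (simp add: has_pd_pd)
  have "has_ld (Hc M am 1) (- Lz am i x + Lp am i x - Lu M am i x) i x"
    using has_ld_divide[OF has_ld_mult[OF b(1) b(4)] b(2) n(1)] by (simp add: Hc_def[abs_def])
  then show "pd i (Hc M am 1) x = (- Lz am i x + Lp am i x - Lu M am i x) * Hc M am 1 x"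
    unfolding has_ld_def by (rule has_pd_pd)
  have "has_ld (Hc M am 2) (- Lz am i x + Lp am i x - Lv i x) i x"
    using has_ld_divide[OF has_ld_mult[OF b(1) b(4)] b(3) n(2)] by (simp add: Hc_def[abs_def])
  then show "pd i (Hc M am 2) x = (- Lz am i x + Lp am i x - Lv i x) * Hc M am 2 x"
    unfolding has_ld_def by (rule has_pd_pd)
  have "has_ld (Hc M am 3) (- Lz am i x + Lv i x - Lp am i x) i x"
    using has_ld_divide[OF has_ld_mult[OF b(1) b(3)] b(4) n(3)] by (simp add: Hc_def[abs_def])
  then show "pd i (Hc M am 3) x = (- Lz am i x + Lv i x - Lp am i x) * Hc M am 3 x"
    unfolding has_ld_def by (rule has_pd_pd)
qed

lemma pd_hf:
  assumes x: "x \<in> kerr_dom M am"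
  shows "pd i (hf M am 0 3) x = - (complex_of_real am * (1 - (complex_of_real (x$2))^2)) * pd i (Hc M am 0) x
      + (if i = 2 then 2 * complex_of_real am * complex_of_real (x$2) * Hc M am 0 x else 0)"
    "pd i (hf M am 3 0) x = - complex_of_real am * pd i (Hc M am 3) x"
    "pd i (hf M am 3 3) x = ((complex_of_real (x$1))^2 + (complex_of_real am)^2) * pd i (Hc M am 3) x
      + (if i = 1 then 2 * complex_of_real (x$1) * Hc M am 3 x else 0)"
proof -
  have p: "has_pd (Hc M am a) (pd i (Hc M am a) x) i x" for a
    by (rule pdiff_has_pd, rule Ck_pdiff[OF Ck_Hc[of 1] _ x]) simp
  note r = has_pd_coord[of 1 i x] and q = has_pd_coord[of 2 i x]
  note rr = has_pd_mult[OF r r] and qq = has_pd_mult[OF q q]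
  have "has_pd (\<lambda>x. (- complex_of_real am + complex_of_real am * (complex_of_real (x$2) * complex_of_real (x$2))) * Hc M am 0 x)
     (- (complex_of_real am * (1 - (complex_of_real (x$2))^2)) * pd i (Hc M am 0) x
      + (if i = 2 then 2 * complex_of_real am * complex_of_real (x$2) * Hc M am 0 x else 0)) i x"
    using has_pd_mult[OF has_pd_add[OF has_pd_const[of "- complex_of_real am"] has_pd_mult[OF has_pd_const[of "complex_of_real am"] qq]] p[of 0]]
    by (auto simp: power2_eq_square algebra_simps split: if_splits)
  moreover have "hf M am 0 3 = (\<lambda>x. (- complex_of_real am + complex_of_real am * (complex_of_real (x$2) * complex_of_real (x$2))) * Hc M am 0 x)"
    unfolding hf_components by (intro ext) (simp add: power2_eq_square algebra_simps)
  ultimately show "pd i (hf M am 0 3) x = - (complex_of_real am * (1 - (complex_of_real (x$2))^2)) * pd i (Hc M am 0) x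
      + (if i = 2 then 2 * complex_of_real am * complex_of_real (x$2) * Hc M am 0 x else 0)"
    by (simp only: has_pd_pd)
  show "pd i (hf M am 3 0) x = - complex_of_real am * pd i (Hc M am 3) x"
    unfolding hf_components by (rule pd_cmult, rule has_pd_pdiff[OF p])
  have "has_pd (\<lambda>x. (complex_of_real (x$1) * complex_of_real (x$1) + (complex_of_real am)^2) * Hc M am 3 x)
     (((complex_of_real (x$1))^2 + (complex_of_real am)^2) * pd i (Hc M am 3) x
      + (if i = 1 then 2 * complex_of_real (x$1) * Hc M am 3 x else 0)) i x"
    using has_pd_mult[OF has_pd_add[OF rr has_pd_const[of "(complex_of_real am)^2"]] p[of 3]]
    by (auto simp: power2_eq_square algebra_simps split: if_splits)
  moreover have "hf M am 3 3 = (\<lambda>x. (complex_of_real (x$1) * complex_of_real (x$1) + (complex_of_real am)^2) * Hc M am 3 x)"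
    unfolding hf_components by (intro ext) (simp add: power2_eq_square)
  ultimately show "pd i (hf M am 3 3) x = ((complex_of_real (x$1))^2 + (complex_of_real am)^2) * pd i (Hc M am 3) x
      + (if i = 1 then 2 * complex_of_real (x$1) * Hc M am 3 x else 0)"
    by (simp only: has_pd_pd)
qed

text \<open>Solution of Cartan's first structure equation for \<open>h\<^sup>a = H\<^sub>a\<alpha>\<^sup>a\<close> with \<open>\<alpha>\<^sup>0 = dt - a(1-q\<^sup>2)d\<phi>\<close>,
  \<open>\<alpha>\<^sup>1 = dr\<close>, \<open>\<alpha>\<^sup>2 = dq\<close>, \<open>\<alpha>\<^sup>3 = (r\<^sup>2+a\<^sup>2)d\<phi> - a dt\<close>.\<close>
definition Pc :: "real \<Rightarrow> real \<Rightarrow> pt \<Rightarrow> complex" where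
  "Pc M am x = - \<i> * complex_of_real am * complex_of_real (x$1) / ((pp am x)^2 * Hc M am 2 x)"

definition Rc :: "real \<Rightarrow> real \<Rightarrow> pt \<Rightarrow> complex" where
  "Rc M am x = \<i> * complex_of_real am * complex_of_real (x$2) / ((pp am x)^2 * Hc M am 1 x)"

text \<open>One ordering of each index pair is listed; \<open>Wc\<close> antisymmetrises. From
  \<rho>^2 d\<phi> = \<alpha>^3 + a \<alpha>^0 the h^2 \<and> h^0 coefficient of dh^0 is (- Lz - Lp
  + 2 a^2 q/\<rho>^2)/H_2, with q-derivatives, and the factor \<lambda>_+ reduces this to
  \<open>Pc\<close>. Likewise the h^1 \<and> h^3 coefficient of dh^3 reduces to \<open>Rc\<close>.
  These reductions allow the pairs 02, 31 and 03, 12 to share their entries.\<close>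

definition Wu :: "real \<Rightarrow> real \<Rightarrow> 4 \<Rightarrow> 4 \<Rightarrow> 4 \<Rightarrow> pt \<Rightarrow> complex" where
  "Wu M am m a b x =
    (if (a, b) = (0, 1) then (Lu M am 1 x - Lz am 1 x - Lp am 1 x) / Hc M am 1 x * hf M am 0 m x + Pc M am x * hf M am 3 m x
     else if (a, b) = (2, 3) then - (Lv 2 x - Lz am 2 x - Lp am 2 x) / Hc M am 2 x * hf M am 3 m x - Rc M am x * hf M am 0 m x
     else if (a, b) = (0, 2) \<or> (a, b) = (3, 1) then Pc M am x * hf M am 0 m x + Rc M am x * hf M am 3 m x
     else if (a, b) = (0, 3) \<or> (a, b) = (1, 2) then Pc M am x * hf M am 1 m x - Rc M am x * hf M am 2 m x
     else 0)"

definition Wc :: "real \<Rightarrow> real \<Rightarrow> 4 \<Rightarrow> 4 \<Rightarrow> 4 \<Rightarrow> pt \<Rightarrow> complex" where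
  "Wc M am m a b x = Wu M am m a b x - Wu M am m b a x"

lemma Ck_Wc: "Ck k (kerr_dom M am) (Wc M am m a b)"
proof -
  have P: "Ck k (kerr_dom M am) (Pc M am)" "Ck k (kerr_dom M am) (Rc M am)"
    unfolding Pc_def[abs_def] Rc_def[abs_def]
    by (auto intro!: Ck_kerr_intros Ck_base Ck_Hc dest: nonzero Hc_nonzero)
  have C: "Ck k (kerr_dom M am) (\<lambda>x. complex_of_real (Cf M am x))" "Ck k (kerr_dom M am) (\<lambda>x. complex_of_real (Df x))"
    unfolding Cf_def Df_def of_real_add of_real_diff of_real_mult of_real_power by (intro Ck_kerr_intros)+
  have L: "Ck k (kerr_dom M am) (Lu M am 1)" "Ck k (kerr_dom M am) (Lz am 1)" "Ck k (kerr_dom M am) (Lp am 1)"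
    "Ck k (kerr_dom M am) (Lv 2)" "Ck k (kerr_dom M am) (Lz am 2)" "Ck k (kerr_dom M am) (Lp am 2)"
    unfolding Lu_def[abs_def] Lz_def[abs_def] Lp_def[abs_def] Lv_def[abs_def]
    by (auto intro!: Ck_kerr_intros Ck_base C dest: nonzero kerr_domD)
  have "\<forall>a b. Ck k (kerr_dom M am) (Wu M am m a b)"
    unfolding all4 Wu_def[abs_def]
    by (auto intro!: Ck_kerr_intros P L Ck_Hc Ck_hf dest: Hc_nonzero)
  then show ?thesis unfolding Wc_def[abs_def] by (intro Ck_diff[OF open_kerr_dom]) auto
qed

text \<open>After logarithmic differentiation the four coefficients enter only as atoms linked by
  H_0 H_1 = i H_2 H_3, both sides being i \<lambda>_+^2. With inverses named as further atoms the
  equation is polynomial.\<close>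

lemma torsion_Wc:
  assumes x: "x \<in> kerr_dom M am"
  shows "pd m (hf M am a n) x + (\<Sum>b\<in>UNIV. Wc M am m a b x * hf M am b n x)
    = pd n (hf M am a m) x + (\<Sum>b\<in>UNIV. Wc M am n a b x * hf M am b m x)"
proof -
  define H0 H1 H2 H3 where "H0 = Hc M am 0 x" and "H1 = Hc M am 1 x" and "H2 = Hc M am 2 x" and "H3 = Hc M am 3 x"
  note Hd = H0_def[symmetric] H1_def[symmetric] H2_def[symmetric] H3_def[symmetric]
  define K1 K2 where "K1 = inverse H1" and "K2 = inverse H2"
  define r q al l where "r = complex_of_real (x$1)" and "q = complex_of_real (x$2)"
    and "al = complex_of_real am" and "l = lamp am x"
  define ip where "ip = inverse ((pp am x)^2)"
  define c where "c = Lu M am 1 x"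
  define d where "d = Lv 2 x"
  have k: "K1 * H1 = 1" "K2 * H2 = 1"
    using Hc_nonzero[OF x] by (simp_all add: K1_def K2_def H1_def H2_def)
  have rel: "H0 * H1 = \<i> * (H2 * H3)"
    using nonzero[OF x] by (simp add: H0_def H1_def H2_def H3_def Hc_def)
  have p2: "(pp am x)^2 = r^2 + al^2 * q^2"
    using kerr_domD(5)[OF x] by (simp add: pp_def r_def al_def q_def flip: of_real_power of_real_mult of_real_add)
  have ip: "ip * (r^2 + al^2 * q^2) = 1"
    using nonzero(3)[OF x] unfolding p2[symmetric] by (simp add: ip_def)
  \<comment> \<open>This makes \<lambda>_+ polynomial in \<open>r\<close>, \<open>q\<close> and the
    inverse square of \<rho>.\<close>
  have l: "l = (r - \<i> * al * q) * ip"
  proof -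
    have "l * (r + \<i> * al * q) = 1"
      using nonzero(5)[OF x] by (simp add: l_def lamp_eq r_def al_def q_def)
    moreover have "(r + \<i> * al * q) * ((r - \<i> * al * q) * ip) = 1"
      using ip by (simp add: algebra_simps power2_eq_square)
    ultimately show ?thesis by (metis mult.assoc mult.left_neutral mult.right_neutral)
  qed
  have ii: "\<i> * \<i> = -1" by simp
  \<comment> \<open>\<open>rel\<close> divided by \<open>H1\<close> and by \<open>H2\<close>, the
    shape in which it meets the factors \<open>K1\<close> of \<open>Rc\<close> and \<open>K2\<close>
    of \<open>Pc\<close>.\<close>
  have b2: "K1 * (H2 * H3) = - \<i> * H0" and b3: "K2 * (H0 * H1) = \<i> * H3"
    using k rel ii by algebra+
  have P: "Pc M am x = - (\<i> * al * r * ip * K2)" "Rc M am x = \<i> * al * q * ip * K1"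
    by (simp_all add: Pc_def Rc_def ip_def K1_def K2_def Hd r_def q_def al_def divide_inverse)
  have L: "Lz am 1 x = l" "Lz am 2 x = \<i> * al * l" "Lz am 0 x = 0" "Lz am 3 x = 0"
    "Lp am 1 x = r * ip" "Lp am 2 x = al^2 * q * ip" "Lp am 0 x = 0" "Lp am 3 x = 0"
    "Lu M am 0 x = 0" "Lu M am 2 x = 0" "Lu M am 3 x = 0" "Lv 0 x = 0" "Lv 1 x = 0" "Lv 3 x = 0"
    by (simp_all add: Lz_def Lp_def Lu_def Lv_def l_def al_def r_def q_def ip_def divide_inverse)
  \<comment> \<open>\<open>T a m n\<close> is symmetric in \<open>m n\<close> and trivial on the
    diagonal, so six index pairs suffice for each \<open>a\<close>.\<close>
  define T where "T a m n \<longleftrightarrow> pd m (hf M am a n) x + (\<Sum>b\<in>UNIV. Wc M am m a b x * hf M am b n x)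
    = pd n (hf M am a m) x + (\<Sum>b\<in>UNIV. Wc M am n a b x * hf M am b m x)" for a m n
  \<comment> \<open>At most twenty-four identities remain. Each is tried with growing sets of
    relations, since ideal membership with all of them at once would be far larger than any single
    identity requires.\<close>
  have "\<forall>a. T a 0 1 \<and> T a 0 2 \<and> T a 0 3 \<and> T a 1 2 \<and> T a 1 3 \<and> T a 2 3"
    unfolding all4 T_def sum4 pd_hf[OF x]
    unfolding hf_components Wc_def Wu_def pd_Hc[OF x] pd_const L c_def[symmetric] d_def[symmetric] P Hd r_def[symmetric] q_def[symmetric] al_def[symmetric] divide_inverse K1_def[symmetric] K2_def[symmetric]
    by simp (intro conjI disjI2;
      (algebra | (use k in algebra) | (use k l ii in algebra) | (use k b2 l ii in algebra) | (use k b3 l ii in algebra)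
        | (use k b2 l ii ip in algebra) | (use k b3 l ip ii in algebra)))
  then have T: "T a 0 1 \<and> T a 0 2 \<and> T a 0 3 \<and> T a 1 2 \<and> T a 1 3 \<and> T a 2 3" by blast
  have "\<forall>m n. T a m n"
    unfolding all4 using T unfolding T_def by (auto simp: eq_commute)
  then show ?thesis unfolding T_def by blast
qed

lemma kerr_frame_hf: "kerr_frame M am (hf M am) (Ef M am) (Wc M am)"
proof unfold_locales
  show "open (kerr_dom M am)" by (rule open_kerr_dom)
  show "Ck 2 (kerr_dom M am) (hf M am a m)" "Ck 2 (kerr_dom M am) (Ef M am a m)" for a m
    by (rule Ck_hf Ck_Ef)+
  show "Ck 1 (kerr_dom M am) (Wc M am m a b)" for m a b
    by (rule Ck_Wc)
  show "Wc M am m a b x = - Wc M am m b a x" for m a b x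
    by (simp add: Wc_def)
  show "Wc M am m 0 2 x = Wc M am m 3 1 x" "Wc M am m 0 3 x = Wc M am m 1 2 x" for m x
    by (simp_all add: Wc_def Wu_def)
qed (rule frame_dual torsion_Wc gmet_frame hstar_hf Om_hf; assumption)+

theorem theoremB:
  fixes M am :: real
  shows
   "(\<forall>B :: pt \<Rightarrow> 4 \<Rightarrow> 4 \<Rightarrow> complex.
       (\<forall>r s. smooth_fn (kerr_dom M am) (\<lambda>y. B y r s)) \<and>
       (\<forall>y\<in>kerr_dom M am. \<forall>r s. B y r s = - B y s r) \<longrightarrow>
       (\<forall>x\<in>kerr_dom M am. \<forall>m n. Oop M am B x m n = lapH M am (Pplus M am B) x m n))
    \<and>
    (\<forall>Phi Phip Phim :: pt \<Rightarrow> complex.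
       smooth_fn (kerr_dom M am) Phi \<and> smooth_fn (kerr_dom M am) Phip \<and> smooth_fn (kerr_dom M am) Phim \<longrightarrow>
       (\<forall>x\<in>kerr_dom M am. \<forall>m n.
          Oop M am (\<lambda>y r s. Phi y * omega M am y r s + Phim y * Omp M am y r s + Phip y * Omm M am y r s) x m n
          = boxneg M am Phi x * omega M am x m n
            + Ok M am (-1) Phim x * Omp M am x m n
            + Ok M am 1 Phip x * Omm M am x m n))"
proof -
  interpret kerr_frame M am "hf M am" "Ef M am" "Wc M am" "kerr_dom M am"
    by (rule kerr_frame_hf)
  show ?thesis
  proof (intro conjI allI impI ballI)
    fix B :: "pt \<Rightarrow> 4 \<Rightarrow> 4 \<Rightarrow> complex" and x m n
    assume B: "(\<forall>r s. smooth_fn (kerr_dom M am) (\<lambda>y. B y r s)) \<and> (\<forall>y\<in>kerr_dom M am. \<forall>r s. B y r s = - B y s r)"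
      and x: "x \<in> kerr_dom M am"
    show "Oop M am B x m n = lapH M am (Pplus M am B) x m n"
    proof (rule Oop_lapH[OF x])
      show "Ck 2 (kerr_dom M am) (\<lambda>y. B y r s)" for r s
        using B by (intro smooth_fn_Ck) blast
      show "B y r s = - B y s r" if "y \<in> kerr_dom M am" for y r s
        using B that by blast
    qed
  next
    fix Phi Phip Phim :: "pt \<Rightarrow> complex" and x m n
    assume P: "smooth_fn (kerr_dom M am) Phi \<and> smooth_fn (kerr_dom M am) Phip \<and> smooth_fn (kerr_dom M am) Phim"
      and x: "x \<in> kerr_dom M am"
    show "Oop M am (\<lambda>y r s. Phi y * omega M am y r s + Phim y * Omp M am y r s + Phip y * Omm M am y r s) x m n
          = boxneg M am Phi x * omega M am x m n + Ok M am (-1) Phim x * Omp M am x m n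
            + Ok M am 1 Phip x * Omm M am x m n"
      using P by (intro Oop_decomposition[OF x] smooth_fn_Ck) auto
  qed
qed

end
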